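(* Let $n\in\mathbb N$, $p_1,p_2\in(1,\infty)$ and $q,s>0$ be such that $\frac1q=\frac1{p_1}+\frac1{p_2}-\frac sn$. (a) If $s\in(0,2n)$, $0\le\delta<1$ and $\sigma\in BS^m_{1,\delta}(\mathbb R^n)$ for some $m\ge-s$, then there is a constant $C$ such that for all $f,g\in\mathcal S(\mathbb R^n)$ $$\|T_\sigma(f,g)\|_{L^q}\le C\big(\|f\|_{W^{m+s,p_1}}\|g\|_{L^{p_2}}+\|f\|_{L^{p_1}}\|g\|_{W^{m+s,p_2}}\big).$$ (b) If $s\in(0,2n)$, $0\le\delta<1$ and $\sigma\in\dot{BS}{}^m_{1,\delta}(\mathbb R^n)$ for some $m\ge-s$, then there is a constant $C$ such that for all $f,g\in\mathcal S(\mathbb R^n)$ $$\|T_\sigma(f,g)\|_{L^q}\le C\big(\|f\|_{\dot W^{m+s,p_1}}\|g\|_{L^{p_2}}+\|f\|_{L^{p_1}}\|g\|_{\dot W^{m+s,p_2}}\big).$$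
   Context: For a symbol $\sigma(x,\xi,\eta)$ and $f,g\in\mathcal S(\mathbb R^n)$ (Schwartz functions), $$T_\sigma(f,g)(x)=\int_{\mathbb R^{2n}}e^{ix\cdot(\xi+\eta)}\sigma(x,\xi,\eta)\hat f(\xi)\hat g(\eta)\,d\xi\,d\eta$$ ($\hat{\ }$ is the Fourier transform; normalization immaterial). $\|h\|_{L^q}=(\int|h|^q)^{1/q}$ also for $0<q<1$. For $r\ge0$, $\|f\|_{W^{r,p}}=\|J^rf\|_{L^p}$ and $\|f\|_{\dot W^{r,p}}=\|D^rf\|_{L^p}$, where $J^r$ and $D^r$ are the operators with Fourier multipliers $(1+|\xi|^2)^{r/2}$ and $|\xi|^r$. $BS^m_{1,\delta}(\mathbb R^n)$ is the class of $\sigma\in C^\infty(\mathbb R^{3n})$ such that for all multi-indices $\alpha,\beta,\gamma$ there is $C_{\alpha,\beta,\gamma}$ with $$|\partial_x^\alpha\partial_\xi^\beta\partial_\eta^\gamma\sigma(x,\xi,\eta)|\le C_{\alpha,\beta,\gamma}(1+|\xi|+|\eta|)^{m-(|\beta|+|\gamma|)+\delta|\alpha|}\quad\text{for all }x,\xi,\eta\in\mathbb R^n.$$ $\dot{BS}{}^m_{1,\delta}(\mathbb R^n)$ is the homogeneous version, with $1+|\xi|+|\eta|$ replaced by $|\xi|+|\eta|$, smoothness and estimates being required for $(\xi,\eta)\ne(0,0)$. *)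

theory Defs
  imports "HOL-Analysis.Analysis"
begin

section \<open>Smooth functions and multi-index derivatives\<close>

text \<open>
  \<open>C_diff_on k U F\<close> means that \<open>F\<close> is of class \<open>C\<^sup>k\<close> on the open set \<open>U\<close>.
\<close>

primrec C_diff_on ::
  "nat \<Rightarrow> 'a::euclidean_space set \<Rightarrow> ('a \<Rightarrow> 'b::real_normed_vector) \<Rightarrow> bool" where
  "C_diff_on 0 U F \<longleftrightarrow> continuous_on U F"
| "C_diff_on (Suc k) U F \<longleftrightarrow>
     (\<forall>z\<in>U. F differentiable (at z)) \<and>
     (\<forall>v. C_diff_on k U (\<lambda>z. frechet_derivative F (at z) v))"

definition smooth_on :: "'a::euclidean_space set \<Rightarrow> ('a \<Rightarrow> 'b::real_normed_vector) \<Rightarrow> bool" where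
  "smooth_on U F \<longleftrightarrow> (\<forall>k. C_diff_on k U F)"

definition dir_deriv ::
  "'a::euclidean_space \<Rightarrow> ('a \<Rightarrow> 'b::real_normed_vector) \<Rightarrow> 'a \<Rightarrow> 'b" where
  "dir_deriv v F = (\<lambda>z. frechet_derivative F (at z) v)"

text \<open>
  A multi-index is a function \<open>\<alpha> :: 'n \<Rightarrow> nat\<close> on the coordinates of \<open>real ^ 'n\<close>.  The index type
  carries no order, so some enumeration of the coordinates is chosen in which the partial
  derivatives are composed; they commute on smooth functions, so the choice has no effect there.
\<close>

definition coords :: "'n::finite list" where
  "coords = (SOME is. distinct is \<and> set is = UNIV)"

definition mi_order :: "('n::finite \<Rightarrow> nat) \<Rightarrow> nat" where
  "mi_order \<alpha> = (\<Sum>i\<in>UNIV. \<alpha> i)"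

text \<open>
  \<open>mi_deriv e \<alpha> F\<close> differentiates \<open>\<alpha> i\<close> times in direction \<open>e i\<close>, for every coordinate \<open>i\<close>.
  The argument \<open>e\<close> selects the block of variables to which the multi-index refers.
\<close>

definition mi_deriv ::
  "('n::finite \<Rightarrow> 'a::euclidean_space) \<Rightarrow> ('n \<Rightarrow> nat) \<Rightarrow> ('a \<Rightarrow> 'b::real_normed_vector) \<Rightarrow> 'a \<Rightarrow> 'b"
  where "mi_deriv e \<alpha> F = foldr (\<lambda>i. dir_deriv (e i) ^^ \<alpha> i) coords F"

section \<open>Schwartz functions, Fourier transform and Fourier multipliers\<close>

definition schwartz :: "(real ^ 'n::finite \<Rightarrow> complex) \<Rightarrow> bool" where
  "schwartz f \<longleftrightarrow> smooth_on UNIV f \<and>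
     (\<forall>\<alpha> \<beta>. \<exists>C. \<forall>x.
        norm ((\<Prod>i\<in>UNIV. (x $ i) ^ \<alpha> i) *\<^sub>R mi_deriv (\<lambda>i. axis i 1) \<beta> f x) \<le> C)"

text \<open>
  The normalization is the one for which Fourier inversion reads
  \<open>f x = (\<integral>\<xi>. cis (x \<bullet> \<xi>) * fourier f \<xi> \<partial>lborel)\<close>, so that no constants occur in multiplier
  operators, and the bilinear operator with symbol 1 is the pointwise product.
\<close>

definition fourier :: "(real ^ 'n::finite \<Rightarrow> complex) \<Rightarrow> real ^ 'n \<Rightarrow> complex" where
  "fourier f \<xi> =
     complex_of_real ((2 * pi) powr - real CARD('n)) * (\<integral>x. cis (- (x \<bullet> \<xi>)) * f x \<partial>lborel)"

definition fourier_multiplier ::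
  "(real ^ 'n::finite \<Rightarrow> real) \<Rightarrow> (real ^ 'n \<Rightarrow> complex) \<Rightarrow> real ^ 'n \<Rightarrow> complex" where
  "fourier_multiplier \<mu> f x =
     (\<integral>\<xi>. cis (x \<bullet> \<xi>) * complex_of_real (\<mu> \<xi>) * fourier f \<xi> \<partial>lborel)"

definition bessel_J :: "real \<Rightarrow> (real ^ 'n::finite \<Rightarrow> complex) \<Rightarrow> real ^ 'n \<Rightarrow> complex" where
  "bessel_J r = fourier_multiplier (\<lambda>\<xi>. (1 + (norm \<xi>)\<^sup>2) powr (r / 2))"

text \<open>
  For \<open>r = 0\<close> the multiplier takes the value \<open>0 powr 0 = 0\<close> instead of 1 at the origin, which is
  a null set.
\<close>

definition riesz_D :: "real \<Rightarrow> (real ^ 'n::finite \<Rightarrow> complex) \<Rightarrow> real ^ 'n \<Rightarrow> complex" where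
  "riesz_D r = fourier_multiplier (\<lambda>\<xi>. norm \<xi> powr r)"

section \<open>Lebesgue and Sobolev (quasi-)norms\<close>

text \<open>The value is infinite when the integral diverges; exponents below 1 are allowed.\<close>

definition Lnorm :: "real \<Rightarrow> ('a::euclidean_space \<Rightarrow> complex) \<Rightarrow> ennreal" where
  "Lnorm q h =
     (let I = (\<integral>\<^sup>+x. ennreal (norm (h x) powr q) \<partial>lborel)
      in if I = \<infinity> then \<infinity> else ennreal (enn2real I powr (1 / q)))"

definition sobolev_norm :: "real \<Rightarrow> real \<Rightarrow> (real ^ 'n::finite \<Rightarrow> complex) \<Rightarrow> ennreal" where
  "sobolev_norm r p f = Lnorm p (bessel_J r f)"

definition hom_sobolev_norm :: "real \<Rightarrow> real \<Rightarrow> (real ^ 'n::finite \<Rightarrow> complex) \<Rightarrow> ennreal" where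
  "hom_sobolev_norm r p f = Lnorm p (riesz_D r f)"

section \<open>Bilinear symbols and bilinear pseudodifferential operators\<close>

type_synonym 'n symbol = "(real ^ 'n) \<times> (real ^ 'n) \<times> (real ^ 'n) \<Rightarrow> complex"

definition symbol_deriv ::
  "('n::finite \<Rightarrow> nat) \<Rightarrow> ('n \<Rightarrow> nat) \<Rightarrow> ('n \<Rightarrow> nat) \<Rightarrow> 'n symbol \<Rightarrow> 'n symbol" where
  "symbol_deriv \<alpha> \<beta> \<gamma> \<sigma> =
     mi_deriv (\<lambda>i. (axis i 1, 0, 0)) \<alpha>
      (mi_deriv (\<lambda>i. (0, axis i 1, 0)) \<beta>
        (mi_deriv (\<lambda>i. (0, 0, axis i 1)) \<gamma> \<sigma>))"

text \<open>The classes \<open>BS\<close> and \<open>hom_BS\<close> have the parameters \<open>m\<close> (order) and \<open>\<delta>\<close>; \<open>\<rho>\<close> is 1.\<close>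

definition BS :: "real \<Rightarrow> real \<Rightarrow> 'n::finite symbol set" where
  "BS m \<delta> = {\<sigma>. smooth_on UNIV \<sigma> \<and>
     (\<forall>\<alpha> \<beta> \<gamma>. \<exists>C. \<forall>x \<xi> \<eta>.
        norm (symbol_deriv \<alpha> \<beta> \<gamma> \<sigma> (x, \<xi>, \<eta>))
          \<le> C * (1 + norm \<xi> + norm \<eta>) powr
               (m - (real (mi_order \<beta>) + real (mi_order \<gamma>)) + \<delta> * real (mi_order \<alpha>)))}"

definition hom_BS :: "real \<Rightarrow> real \<Rightarrow> 'n::finite symbol set" where
  "hom_BS m \<delta> = {\<sigma>. smooth_on {(x, \<xi>, \<eta>). (\<xi>, \<eta>) \<noteq> (0, 0)} \<sigma> \<and>
     (\<forall>\<alpha> \<beta> \<gamma>. \<exists>C. \<forall>x \<xi> \<eta>. (\<xi>, \<eta>) \<noteq> (0, 0) \<longrightarrow>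
        norm (symbol_deriv \<alpha> \<beta> \<gamma> \<sigma> (x, \<xi>, \<eta>))
          \<le> C * (norm \<xi> + norm \<eta>) powr
               (m - (real (mi_order \<beta>) + real (mi_order \<gamma>)) + \<delta> * real (mi_order \<alpha>)))}"

definition bilinear_op ::
  "'n::finite symbol \<Rightarrow> (real ^ 'n \<Rightarrow> complex) \<Rightarrow> (real ^ 'n \<Rightarrow> complex) \<Rightarrow> real ^ 'n \<Rightarrow> complex"
  where
  "bilinear_op \<sigma> f g x =
     (\<integral>(\<xi>, \<eta>). cis (x \<bullet> (\<xi> + \<eta>)) * \<sigma> (x, \<xi>, \<eta>) * fourier f \<xi> * fourier g \<eta>
        \<partial>(lborel :: ((real ^ 'n) \<times> (real ^ 'n)) measure))"

end

theory Submission
  imports Defs "HOL-Probability.Probability"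
begin

text \<open>
  Put \<open>r = m + s \<ge> 0\<close> and distribute \<open>\<sigma>\<close> by a smooth enough partition of unity in \<open>(\<xi>, \<eta>)\<close>, so that
  \<open>T\<^sub>\<sigma>(f, g) = T\<^sub>a(J\<^sup>r f, g) + T\<^sub>b(f, J\<^sup>r g)\<close> with symbols \<open>a\<close>, \<open>b\<close> of order \<open>- s\<close>; the homogeneous and the
  inhomogeneous case differ only in the parameter \<open>\<kappa> \<in> {0, 1}\<close> of the weight
  \<open>\<kappa> + \<bar>\<xi>\<bar>\<^sup>2\<close>. A continuous Littlewood-Paley decomposition \<open>a = \<integral> a\<^sub>l dl / l\<close> gives kernels
  bounded by \<open>l\<^sup>s\<close> times the tensor square of the \<open>L\<^sup>1\<close>-normalised weight
  \<open>l\<^sup>-\<^sup>n (1 + \<bar>y\<bar> / l)\<^sup>-\<^sup>n\<^sup>-\<^sup>1\<close>, hence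
  \<open>\<bar>T\<^sub>a(F, G)(x)\<bar> \<le> C \<integral> l\<^sup>s\<^sup>-\<^sup>1 F\<^sub>l(x) G\<^sub>l(x) dl\<close> with the weighted averages \<open>F\<^sub>l\<close>, \<open>G\<^sub>l\<close>; only
  size estimates for derivatives in \<open>(\<xi>, \<eta>)\<close> enter, and no derivative in \<open>x\<close>. Finally
  \<open>F\<^sub>l \<le> C M F\<close> and \<open>F\<^sub>l \<le> C l\<^sup>-\<^sup>n\<^sup>/\<^sup>p \<parallel>F\<parallel>\<^sub>p\<close>; splitting the integral over \<open>l\<close> at the optimal
  point (Hedberg's argument) reduces the claim to the Hardy-Littlewood maximal theorem.
\<close>

section \<open>The Hardy-Littlewood maximal theorem\<close>

text \<open>As \<open>q\<close> may lie below 1, neither duality nor Minkowski's inequality for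
  integrals is available in the target space. Hence all estimates are pointwise in \<open>x\<close>,
  and the norm is taken once, after the integral over the scales has been evaluated. The other
  obstacle is regularity: a homogeneous symbol may be singular at the origin of the frequency space,
  and a power of \<open>norm \<xi>\<close> on a whole subspace. The first is met by differentiating
  along lines, since in dimension \<open>2 n \<ge> 2\<close> almost every line of a given direction
  misses the origin; pure derivatives in the coordinate directions already give decay of the kernel.
  The second is met by raising the weights in the partition of unity to a large power. Frequencies
  are localised by rational functions in place of bumps of compact support, so that the product and
  quotient rules give all derivative bounds, uniformly in the scale. The orders have one source: two
  integrable weights of order \<open>n + 1\<close> on the two copies of the base space require
  kernel decay of order \<open>2 n + 2\<close>, and therefore that many derivatives of the
  symbol.\<close>

definition epowr :: "ennreal \<Rightarrow> real \<Rightarrow> ennreal" where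
  "epowr x p = (if x = \<infinity> then \<infinity> else ennreal (enn2real x powr p))"

lemma measurable_epowr [measurable]: "(\<lambda>x. epowr x p) \<in> borel_measurable borel"
  unfolding epowr_def by measurable

lemma epowr_ennreal [simp]: "0 \<le> x \<Longrightarrow> epowr (ennreal x) p = ennreal (x powr p)"
  by (simp add: epowr_def)

lemma ennreal_eq_top_if_nat_le:
  assumes "\<And>n. ennreal (real n) \<le> x"
  shows "x = \<infinity>"
proof (cases x rule: ennreal_cases)
  case (real r)
  obtain n where "r < real n" using reals_Archimedean2 by blast
  with assms[of n] real show ?thesis by (simp add: ennreal_le_iff2)
qed simp

lemma emeasure_ball_pos_finite:
  fixes c :: "'a::euclidean_space"
  assumes "r > 0"
  shows "emeasure lborel (ball c r) \<noteq> 0" "emeasure lborel (ball c r) < \<infinity>"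
  using assms unit_ball_vol_pos[of "real DIM('a)"]
  by (auto simp: emeasure_ball simp del: unit_ball_vol_pos)

lemma nn_integral_powr_less:
  assumes a: "a > (0::real)"
  shows "(\<integral>\<^sup>+t. indicator {t. 0 < t \<and> ennreal t < x} t * ennreal (t powr (a - 1)) \<partial>lborel) = ennreal (1 / a) * epowr x a"
proof (cases x rule: ennreal_cases)
  case (real u)
  have "((\<lambda>t. t powr (a - 1)) has_integral (u powr (a - 1 + 1) / (a - 1 + 1))) {0..u}"
    using a real by (intro has_integral_powr_from_0) auto
  then have "((\<lambda>t. if t \<in> {0..u} then t powr (a - 1) else 0) has_integral (u powr a / a)) UNIV"
    by (subst has_integral_restrict_UNIV) simp
  then have "(\<integral>\<^sup>+t. ennreal (if t \<in> {0..u} then t powr (a - 1) else 0) \<partial>lborel) = ennreal (u powr a / a)"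
    by (intro nn_integral_has_integral_lborel) auto
  moreover have "(\<integral>\<^sup>+t. indicator {t. 0 < t \<and> ennreal t < x} t * ennreal (t powr (a - 1)) \<partial>lborel) =
      (\<integral>\<^sup>+t. ennreal (if t \<in> {0..u} then t powr (a - 1) else 0) \<partial>lborel)"
    using AE_lborel_singleton[of 0] AE_lborel_singleton[of u]
    by (intro nn_integral_cong_AE, eventually_elim)
      (use real in \<open>auto simp: indicator_def ennreal_less_iff\<close>)
  ultimately show ?thesis using a real by (simp add: ennreal_mult'[symmetric])
next
  case top
  have "ennreal (real n) \<le> (\<integral>\<^sup>+t. indicator {t. 0 < t \<and> ennreal t < x} t * ennreal (t powr (a - 1)) \<partial>lborel)" for n
  proof -
    \<comment> \<open>\<open>u\<close> is the upper limit at which the integral of the power attains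
      the value \<open>n\<close>.\<close>
    define u where "u = (a * real n) powr (1 / a)"
    have u: "u \<ge> 0" "u powr a / a = real n" using a by (auto simp: u_def powr_powr)
    have "((\<lambda>t. t powr (a - 1)) has_integral (u powr (a - 1 + 1) / (a - 1 + 1))) {0..u}"
      using a u by (intro has_integral_powr_from_0) auto
    then have "((\<lambda>t. if t \<in> {0..u} then t powr (a - 1) else 0) has_integral real n) UNIV"
      by (subst has_integral_restrict_UNIV) (simp add: u)
    then have "(\<integral>\<^sup>+t. ennreal (if t \<in> {0..u} then t powr (a - 1) else 0) \<partial>lborel) = ennreal (real n)"
      by (intro nn_integral_has_integral_lborel) auto
    moreover have "(\<integral>\<^sup>+t. ennreal (if t \<in> {0..u} then t powr (a - 1) else 0) \<partial>lborel) \<le>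
      (\<integral>\<^sup>+t. indicator {t. 0 < t \<and> ennreal t < x} t * ennreal (t powr (a - 1)) \<partial>lborel)"
      using AE_lborel_singleton[of 0]
      by (intro nn_integral_mono_AE, eventually_elim) (auto simp: top indicator_def)
    ultimately show ?thesis by simp
  qed
  then have "(\<integral>\<^sup>+t. indicator {t. 0 < t \<and> ennreal t < x} t * ennreal (t powr (a - 1)) \<partial>lborel) = \<infinity>"
    by (rule ennreal_eq_top_if_nat_le)
  then show ?thesis using a top by (simp add: epowr_def ennreal_mult_top)
qed

lemma nn_integral_powr_tail:
  assumes a: "a > (0::real)" and u: "u > 0"
  shows "(\<integral>\<^sup>+t. indicator {u..} t * ennreal (t powr (- a - 1)) \<partial>lborel) = ennreal (u powr (- a) / a)"
proof -
  have "((\<lambda>t. t powr (- a - 1)) has_integral (- (u powr (- a - 1 + 1)) / (- a - 1 + 1))) {u..}"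
    using assms by (intro has_integral_powr_to_inf) auto
  then have "((\<lambda>t. if t \<in> {u..} then t powr (- a - 1) else 0) has_integral (u powr (- a) / a)) UNIV"
    by (subst has_integral_restrict_UNIV) simp
  then have "(\<integral>\<^sup>+t. ennreal (if t \<in> {u..} then t powr (- a - 1) else 0) \<partial>lborel) = ennreal (u powr (-a) / a)"
    by (intro nn_integral_has_integral_lborel) auto
  then show ?thesis by (subst (asm) nn_integral_cong[of _ _ "\<lambda>t. indicator {u..} t * ennreal (t powr (- a - 1))"]) (auto simp: indicator_def)
qed

text \<open>The uncentred maximal function: its superlevel sets are unions of open balls, hence
  open, and its value at \<open>x\<close> controls the average over every ball that merely contains
  \<open>x\<close>.\<close>

definition maximal :: "('a::euclidean_space \<Rightarrow> ennreal) \<Rightarrow> 'a \<Rightarrow> ennreal" where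
  "maximal f x = (SUP (c, r) \<in> {(c, r). x \<in> ball c r}.
     (\<integral>\<^sup>+y\<in>ball c r. f y \<partial>lborel) / emeasure lborel (ball c r))"

lemma maximal_greater_iff:
  "l < maximal f x \<longleftrightarrow> (\<exists>c r. x \<in> ball c r \<and> l < (\<integral>\<^sup>+y\<in>ball c r. f y \<partial>lborel) / emeasure lborel (ball c r))"
  unfolding maximal_def less_SUP_iff by auto

lemma open_maximal_greater: "open {x. l < maximal f x}"
proof -
  have "{x. l < maximal f x} = (\<Union>(c, r) \<in> {(c, r). l < (\<integral>\<^sup>+y\<in>ball c r. f y \<partial>lborel) / emeasure lborel (ball c r)}. ball c r)"
    unfolding maximal_greater_iff by (auto simp del: mem_ball)
  then show ?thesis by auto
qed

lemma measurable_maximal [measurable]: "maximal f \<in> borel_measurable borel"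
proof (rule borel_measurableI_greater)
  show "{x \<in> space borel. y < maximal f x} \<in> sets borel" for y
    using open_maximal_greater[of y f] by simp
qed

lemma ball_average_le_maximal:
  assumes "x \<in> ball c r"
  shows "(\<integral>\<^sup>+y\<in>ball c r. f y \<partial>lborel) \<le> emeasure lborel (ball c r) * maximal f x"
proof -
  have r: "r > 0" using assms by (metis ball_eq_empty empty_iff not_le)
  define V where "V = emeasure lborel (ball c r)"
  have V: "V \<noteq> 0" "V < \<infinity>"
    using emeasure_ball_pos_finite[OF r] by (auto simp: V_def)
  have "(\<integral>\<^sup>+y\<in>ball c r. f y \<partial>lborel) / V \<le> maximal f x"
    unfolding maximal_def V_def using assms by (intro SUP_upper2[of "(c,r)"]) auto
  then have "V * ((\<integral>\<^sup>+y\<in>ball c r. f y \<partial>lborel) / V) \<le> V * maximal f x"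
    by (intro mult_left_mono) auto
  moreover have "V * (X / V) = X" for X
    using V ennreal_mult_divide_eq[of V X] by (simp add: ennreal_times_divide mult.commute)
  ultimately show ?thesis by (simp add: V_def)
qed

text \<open>Vitali covering: the balls on which the average exceeds \<open>l\<close> contain a
  disjoint subfamily whose fivefold dilates cover the superlevel set. The dilation costs
  \<open>5 ^ DIM('a)\<close> in volume, and disjointness lets the integrals of \<open>f\<close> over
  the subfamily add up to at most its full integral.\<close>

lemma maximal_weak_type:
  fixes f :: "'a::euclidean_space \<Rightarrow> ennreal"
  assumes f [measurable]: "f \<in> borel_measurable borel" and l: "(l::real) > 0"
  shows "ennreal l * emeasure lborel {x. ennreal l < maximal f x} \<le> 5 ^ DIM('a) * (\<integral>\<^sup>+x. f x \<partial>lborel)"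
proof (cases "(\<integral>\<^sup>+x. f x \<partial>lborel) = \<infinity>")
  case True
  then show ?thesis by (simp add: ennreal_mult_top)
next
  case False
  let ?n = "DIM('a)" let ?v = "unit_ball_vol (real ?n)"
  obtain I where I: "(\<integral>\<^sup>+x. f x \<partial>lborel) = ennreal I" "I \<ge> 0"
    using False by (metis ennreal_cases infinity_ennreal_def)
  define K where "K = {(c::'a, r::real). r > 0 \<and> ennreal l * emeasure lborel (ball c r) < (\<integral>\<^sup>+y\<in>ball c r. f y \<partial>lborel)}"
  have v: "?v > 0" by simp
  have sub: "{x. ennreal l < maximal f x} \<subseteq> (\<Union>i\<in>K. cball (fst i) (snd i))"
  proof
    fix x assume "x \<in> {x. ennreal l < maximal f x}"
    then obtain c r where cr: "x \<in> ball c r" "ennreal l < (\<integral>\<^sup>+y\<in>ball c r. f y \<partial>lborel) / emeasure lborel (ball c r)"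
      unfolding mem_Collect_eq maximal_greater_iff by blast
    then have r: "r > 0" by (metis ball_eq_empty empty_iff not_le)
    define V where "V = emeasure lborel (ball c r)"
    define J where "J = (\<integral>\<^sup>+y\<in>ball c r. f y \<partial>lborel)"
    have V: "V \<noteq> 0" "V < \<infinity>" using emeasure_ball_pos_finite[OF r] by (auto simp: V_def)
    have "ennreal l * V < J / V * V"
      using cr(2) V unfolding V_def[symmetric] J_def[symmetric]
      by (intro ennreal_mult_strict_right_mono) (auto simp: zero_less_iff_neq_zero)
    also have "J / V * V = J" using V by (simp add: ennreal_divide_times ennreal_mult_divide_eq)
    finally have "(c, r) \<in> K" using r by (auto simp: K_def V_def J_def)
    then show "x \<in> (\<Union>i\<in>K. cball (fst i) (snd i))"
      using cr(1) by (intro UN_I[of "(c,r)"]) auto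
  qed
  \<comment> \<open>The covering lemma asks for bounded radii. They are bounded since
    \<open>l\<close> times the volume stays below the finite integral \<open>I\<close>; the maximum
    with 1 allows passing from \<open>r ^ ?n\<close> to \<open>r\<close>.\<close>
  have bound: "0 < snd i \<and> snd i \<le> max 1 (I / (l * ?v))" if "i \<in> K" for i
  proof -
    obtain c r where i: "i = (c, r)" by (cases i)
    then have r: "r > 0" and "ennreal l * emeasure lborel (ball c r) < (\<integral>\<^sup>+y\<in>ball c r. f y \<partial>lborel)"
      using that by (auto simp: K_def)
    then have "ennreal l * emeasure lborel (ball c r) < (\<integral>\<^sup>+y\<in>ball c r. f y \<partial>lborel)" by simp
    also have "\<dots> \<le> (\<integral>\<^sup>+y. f y \<partial>lborel)"
      by (intro nn_integral_mono) (auto simp: indicator_def)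
    finally have "ennreal (l * (?v * r ^ ?n)) < ennreal I"
      using r l by (simp add: I emeasure_ball ennreal_mult)
    then have *: "r ^ ?n < I / (l * ?v)" using l v r by (simp add: ennreal_less_iff field_simps)
    have "r \<le> max 1 (I / (l * ?v))"
    proof (cases "r \<le> 1")
      case False
      then have "r \<le> r ^ ?n" using DIM_positive[where 'a='a] self_le_power[of r ?n] by linarith
      then show ?thesis using * by linarith
    qed simp
    then show ?thesis using r i by simp
  qed
  obtain C where C: "countable C" "C \<subseteq> K"
     "pairwise (\<lambda>i j. disjnt (cball (fst i) (snd i)) (cball (fst j) (snd j))) C"
     "{x. ennreal l < maximal f x} \<subseteq> (\<Union>i\<in>C. cball (fst i) (5 * snd i))"
    using Vitali_covering_lemma_cballs[OF sub bound] by blast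
  define In where "In = to_nat_on C ` C"
  define b where "b = from_nat_into C"
  have bC: "b i \<in> C" if "i \<in> In" for i using that C(1) by (auto simp: In_def b_def)
  define A5 where "A5 i = (if i \<in> In then cball (fst (b i)) (5 * snd (b i)) else {})" for i
  define A1 where "A1 i = (if i \<in> In then ball (fst (b i)) (snd (b i)) else {})" for i
  have [measurable]: "A1 i \<in> sets borel" "A5 i \<in> sets borel" for i by (auto simp: A1_def A5_def)
  have cover: "{x. ennreal l < maximal f x} \<subseteq> (\<Union>i. A5 i)"
  proof
    fix x assume "x \<in> {x. ennreal l < maximal f x}"
    then obtain j where j: "j \<in> C" "x \<in> cball (fst j) (5 * snd j)" using C(4) by blast
    then have "x \<in> A5 (to_nat_on C j)" using C(1) by (auto simp: A5_def In_def b_def)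
    then show "x \<in> (\<Union>i. A5 i)" by blast
  qed
  have inj: "b i = b j \<Longrightarrow> i \<in> In \<Longrightarrow> j \<in> In \<Longrightarrow> i = j" for i j
    using C(1) by (auto simp: In_def b_def)
  have disj: "disjoint_family A1"
    unfolding disjoint_family_on_def
  proof (intro ballI impI)
    fix i j :: nat assume "i \<noteq> j"
    show "A1 i \<inter> A1 j = {}"
    proof (cases "i \<in> In \<and> j \<in> In")
      case True
      then have "b i \<noteq> b j" using inj \<open>i \<noteq> j\<close> by blast
      then have "disjnt (cball (fst (b i)) (snd (b i))) (cball (fst (b j)) (snd (b j)))"
        using C(3) bC True unfolding pairwise_def by blast
      then have "ball (fst (b i)) (snd (b i)) \<inter> ball (fst (b j)) (snd (b j)) = {}"
        unfolding disjnt_def using ball_subset_cball by fastforce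
      then show ?thesis using True by (simp add: A1_def)
    qed (auto simp: A1_def)
  qed
  have meas: "ennreal l * emeasure lborel (A5 i) \<le> 5 ^ ?n * (\<integral>\<^sup>+y\<in>A1 i. f y \<partial>lborel)" for i
  proof (cases "i \<in> In")
    case True
    then have "b i \<in> K" using bC C(2) by blast
    then have r: "snd (b i) > 0" and le: "ennreal l * emeasure lborel (A1 i) \<le> (\<integral>\<^sup>+y\<in>A1 i. f y \<partial>lborel)"
      using True by (auto simp: K_def A1_def case_prod_beta)
    have "emeasure lborel (A5 i) = 5 ^ ?n * emeasure lborel (A1 i)"
      using True r by (simp add: A5_def A1_def emeasure_ball emeasure_cball power_mult_distrib
         ennreal_mult' mult_ac ennreal_power[symmetric])
    then have "ennreal l * emeasure lborel (A5 i) = 5 ^ ?n * (ennreal l * emeasure lborel (A1 i))"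
      by (simp add: mult_ac)
    then show ?thesis using le by (metis mult_left_mono zero_le)
  qed (simp add: A5_def)
  have "ennreal l * emeasure lborel {x. ennreal l < maximal f x} \<le> ennreal l * emeasure lborel (\<Union>i. A5 i)"
    using cover by (intro mult_left_mono emeasure_mono) auto
  also have "\<dots> \<le> ennreal l * (\<Sum>i. emeasure lborel (A5 i))"
    by (intro mult_left_mono emeasure_subadditive_countably) auto
  also have "\<dots> = (\<Sum>i. ennreal l * emeasure lborel (A5 i))"
    by (rule ennreal_suminf_cmult[symmetric])
  also have "\<dots> \<le> (\<Sum>i. 5 ^ ?n * (\<integral>\<^sup>+y\<in>A1 i. f y \<partial>lborel))"
    by (intro suminf_le meas) auto
  also have "\<dots> = 5 ^ ?n * (\<Sum>i. emeasure (density lborel f) (A1 i))"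
    by (simp add: emeasure_density)
  \<comment> \<open>Summing the integrals over the disjoint balls is countable additivity of the
    measure with density \<open>f\<close>.\<close>
  also have "(\<Sum>i. emeasure (density lborel f) (A1 i)) = emeasure (density lborel f) (\<Union>i. A1 i)"
    using disj by (intro suminf_emeasure) auto
  also have "\<dots> \<le> (\<integral>\<^sup>+x. f x \<partial>lborel)"
    by (subst emeasure_density) (auto intro!: nn_integral_mono simp: indicator_def)
  finally show ?thesis by (simp add: mult_left_mono)
qed

text \<open>Marcinkiewicz interpolation with the trivial bound for bounded functions. At height
  \<open>t\<close> only the part of \<open>f\<close> above \<open>t / 2\<close> matters. The weak
  type bound for that part, integrated over \<open>t\<close> by the layer cake formula, leaves an
  integral of \<open>t powr (p - 2)\<close> up to \<open>2 * f x\<close>, which converges at 0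
  because \<open>p > 1\<close>.\<close>

lemma maximal_strong_type:
  assumes p: "p > (1::real)"
  obtains C where "C > 0"
    "\<And>f :: 'a::euclidean_space \<Rightarrow> real. f \<in> borel_measurable borel \<Longrightarrow> (\<And>x. 0 \<le> f x) \<Longrightarrow>
      (\<integral>\<^sup>+x. epowr (maximal (\<lambda>x. ennreal (f x)) x) p \<partial>lborel) \<le> ennreal C * (\<integral>\<^sup>+x. ennreal (f x powr p) \<partial>lborel)"
proof
  define D where "D = 2 * 5 ^ DIM('a) * p"
  define C where "C = D * (2 powr (p - 1) / (p - 1))"
  show "C > 0" using p by (auto simp: C_def D_def intro!: mult_pos_pos)
  fix f :: "'a \<Rightarrow> real" assume [measurable]: "f \<in> borel_measurable borel" and f: "\<And>x. 0 \<le> f x"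
  define M where "M = maximal (\<lambda>x. ennreal (f x))"
  have [measurable]: "M \<in> borel_measurable borel" unfolding M_def by measurable
  have weak: "ennreal t * emeasure lborel {x. ennreal t < M x} \<le>
      2 * 5 ^ DIM('a) * (\<integral>\<^sup>+x. ennreal (f x) * indicator {x. t < 2 * f x} x \<partial>lborel)" if t: "t > 0" for t
  proof -
    define g where "g x = ennreal (f x) * indicator {x. t < 2 * f x} x" for x
    have [measurable]: "g \<in> borel_measurable borel" unfolding g_def by measurable
    have sub: "{x. ennreal t < M x} \<subseteq> {x. ennreal (t/2) < maximal g x}"
    proof safe
      fix x assume "ennreal t < M x"
      then obtain c r where cr: "x \<in> ball c r"
        "ennreal t < (\<integral>\<^sup>+y\<in>ball c r. ennreal (f y) \<partial>lborel) / emeasure lborel (ball c r)"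
        unfolding M_def maximal_greater_iff by blast
      then have r: "r > 0" by (metis ball_eq_empty empty_iff not_le)
      define V where "V = emeasure lborel (ball c r)"
      define J where "J = (\<integral>\<^sup>+y\<in>ball c r. g y \<partial>lborel)"
      have V: "V \<noteq> 0" "V < \<infinity>" using emeasure_ball_pos_finite[OF r] by (auto simp: V_def)
      \<comment> \<open>Off the set where \<open>t < 2 * f y\<close> the function \<open>f\<close>
        is at most \<open>t / 2\<close>, so \<open>f\<close> is everywhere at most \<open>g\<close>
        plus the constant \<open>t / 2\<close>.\<close>
      have "(\<integral>\<^sup>+y\<in>ball c r. ennreal (f y) \<partial>lborel) \<le> (\<integral>\<^sup>+y\<in>ball c r. (g y + ennreal (t/2)) \<partial>lborel)"
        by (intro nn_integral_mono) (auto simp: g_def indicator_def intro!: ennreal_leI)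
      also have "\<dots> = J + ennreal (t/2) * V"
        unfolding J_def V_def distrib_right
        by (subst nn_integral_add) (auto simp: nn_integral_cmult_indicator intro!: borel_measurable_times_ennreal borel_measurable_indicator)
      finally have "(\<integral>\<^sup>+y\<in>ball c r. ennreal (f y) \<partial>lborel) / V \<le> (J + ennreal (t/2) * V) / V"
        by (intro divide_right_mono_ennreal)
      also have "\<dots> = J / V + ennreal (t/2)"
        using V by (simp add: add_divide_distrib_ennreal ennreal_mult_divide_eq)
      finally have "ennreal t < J / V + ennreal (t/2)" using cr(2) by (simp add: V_def)
      moreover have "ennreal t = ennreal (t/2) + ennreal (t/2)" using t by (simp flip: ennreal_plus)
      ultimately have "ennreal (t/2) < J / V"
        by (metis add_right_mono leD leI)
      then show "ennreal (t/2) < maximal g x" unfolding maximal_greater_iff J_def V_def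
        using cr(1) by blast
    qed
    have "ennreal t * emeasure lborel {x. ennreal t < M x} \<le> ennreal t * emeasure lborel {x. ennreal (t/2) < maximal g x}"
      by (intro mult_left_mono emeasure_mono sub) auto
    also have "\<dots> = 2 * (ennreal (t/2) * emeasure lborel {x. ennreal (t/2) < maximal g x})"
    proof -
      have "ennreal t = 2 * ennreal (t/2)" using t by (simp flip: ennreal_numeral ennreal_mult)
      then show ?thesis by (simp add: mult_ac)
    qed
    also have "\<dots> \<le> 2 * (5 ^ DIM('a) * (\<integral>\<^sup>+x. g x \<partial>lborel))"
      using t by (intro mult_left_mono maximal_weak_type) auto
    finally show ?thesis by (simp add: g_def mult_ac)
  qed
  have layer: "epowr (M x) p = ennreal p * (\<integral>\<^sup>+t. indicator {t. 0 < t \<and> ennreal t < M x} t * ennreal (t powr (p - 1)) \<partial>lborel)" for x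
    using p by (subst nn_integral_powr_less) (auto simp: mult.assoc[symmetric] simp flip: ennreal_mult')
  have "(\<integral>\<^sup>+x. epowr (M x) p \<partial>lborel) = ennreal p * (\<integral>\<^sup>+x. (\<integral>\<^sup>+t. indicator {t. 0 < t \<and> ennreal t < M x} t * ennreal (t powr (p - 1)) \<partial>lborel) \<partial>lborel)"
    unfolding layer by (subst nn_integral_cmult) auto
  also have "(\<integral>\<^sup>+x. (\<integral>\<^sup>+t. indicator {t. 0 < t \<and> ennreal t < M x} t * ennreal (t powr (p - 1)) \<partial>lborel) \<partial>lborel)
     = (\<integral>\<^sup>+t. (\<integral>\<^sup>+x. indicator {t. 0 < t \<and> ennreal t < M x} t * ennreal (t powr (p - 1)) \<partial>lborel) \<partial>lborel)"
    by (rule lborel_pair.Fubini') measurable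
  also have "\<dots> \<le> (\<integral>\<^sup>+t. (\<integral>\<^sup>+x. (2 * 5 ^ DIM('a)) * (ennreal (f x) * (indicator {t. 0 < t \<and> ennreal t < ennreal (2 * f x)} t * ennreal (t powr (p - 1 - 1)))) \<partial>lborel) \<partial>lborel)"
  proof (rule nn_integral_mono)
    fix t :: real
    show "(\<integral>\<^sup>+x. indicator {t. 0 < t \<and> ennreal t < M x} t * ennreal (t powr (p - 1)) \<partial>lborel)
       \<le> (\<integral>\<^sup>+x. (2 * 5 ^ DIM('a)) * (ennreal (f x) * (indicator {t. 0 < t \<and> ennreal t < ennreal (2 * f x)} t * ennreal (t powr (p - 1 - 1)))) \<partial>lborel)"
    proof (cases "t > 0")
      case True
      have "(\<integral>\<^sup>+x. indicator {t. 0 < t \<and> ennreal t < M x} t * ennreal (t powr (p - 1)) \<partial>lborel)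
         = (\<integral>\<^sup>+x. ennreal (t powr (p - 1)) * indicator {x. ennreal t < M x} x \<partial>lborel)"
        using True by (intro nn_integral_cong) (auto simp: indicator_def)
      also have "\<dots> = ennreal (t powr (p - 1)) * emeasure lborel {x. ennreal t < M x}"
        by (subst nn_integral_cmult_indicator) auto
      \<comment> \<open>One factor \<open>t\<close> is split off, as the weak type bound consumes
        it.\<close>
      also have "\<dots> = ennreal (t powr (p - 1 - 1)) * (ennreal t * emeasure lborel {x. ennreal t < M x})"
      proof -
        have "t powr (p - 1) = t powr (p - 1 - 1) * t" using True powr_mult_base[of t "p - 1 - 1"] by (simp add: mult.commute)
        then have "ennreal (t powr (p - 1)) = ennreal (t powr (p - 1 - 1)) * ennreal t"
          using True by (simp flip: ennreal_mult)
        then show ?thesis by (simp only: mult.assoc)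
      qed
      also have "\<dots> \<le> ennreal (t powr (p - 1 - 1)) * (2 * 5 ^ DIM('a) * (\<integral>\<^sup>+x. ennreal (f x) * indicator {x. t < 2 * f x} x \<partial>lborel))"
        by (intro mult_left_mono weak True) auto
      also have "\<dots> = (\<integral>\<^sup>+x. ennreal (t powr (p - 1 - 1)) * (2 * 5 ^ DIM('a) * (ennreal (f x) * indicator {x. t < 2 * f x} x)) \<partial>lborel)"
        by (simp add: nn_integral_cmult)
      also have "\<dots> = (\<integral>\<^sup>+x. (2 * 5 ^ DIM('a)) * (ennreal (f x) * (indicator {t. 0 < t \<and> ennreal t < ennreal (2 * f x)} t * ennreal (t powr (p - 1 - 1)))) \<partial>lborel)"
        using True by (intro nn_integral_cong) (auto simp: indicator_def ennreal_less_iff mult_ac)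
      finally show ?thesis .
    qed simp
  qed
  also have "\<dots> = (\<integral>\<^sup>+x. (\<integral>\<^sup>+t. (2 * 5 ^ DIM('a)) * (ennreal (f x) * (indicator {t. 0 < t \<and> ennreal t < ennreal (2 * f x)} t * ennreal (t powr (p - 1 - 1)))) \<partial>lborel) \<partial>lborel)"
    by (rule lborel_pair.Fubini') measurable
  also have "\<dots> = (\<integral>\<^sup>+x. (2 * 5 ^ DIM('a)) * (ennreal (f x) * (ennreal (1 / (p - 1)) * epowr (ennreal (2 * f x)) (p - 1))) \<partial>lborel)"
    using p nn_integral_powr_less[of "p - 1"] by (simp add: nn_integral_cmult del: epowr_ennreal)
  also have "\<dots> = (\<integral>\<^sup>+x. ennreal (2 * 5 ^ DIM('a) * 2 powr (p - 1) / (p - 1)) * ennreal (f x powr p) \<partial>lborel)"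
  proof (rule nn_integral_cong)
    fix x
    have "2 * 5 ^ DIM('a) = ennreal (2 * 5 ^ DIM('a))"
      by (simp add: ennreal_mult ennreal_power[symmetric])
    moreover have "f x * (1 / (p - 1) * ((2 * f x) powr (p - 1))) = 2 powr (p - 1) / (p - 1) * f x powr p"
      using f[of x] p by (cases "f x = 0") (auto simp: powr_mult powr_diff)
    ultimately show "(2 * 5 ^ DIM('a)) * (ennreal (f x) * (ennreal (1 / (p - 1)) * epowr (ennreal (2 * f x)) (p - 1)))
       = ennreal (2 * 5 ^ DIM('a) * 2 powr (p - 1) / (p - 1)) * ennreal (f x powr p)"
      using f[of x] p by (simp flip: ennreal_mult)
  qed
  also have "\<dots> = ennreal (2 * 5 ^ DIM('a) * 2 powr (p - 1) / (p - 1)) * (\<integral>\<^sup>+x. ennreal (f x powr p) \<partial>lborel)"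
    by (subst nn_integral_cmult) auto
  finally have "(\<integral>\<^sup>+x. epowr (M x) p \<partial>lborel) \<le> ennreal p * (ennreal (2 * 5 ^ DIM('a) * 2 powr (p - 1) / (p - 1)) * (\<integral>\<^sup>+x. ennreal (f x powr p) \<partial>lborel))"
    by (simp add: mult_left_mono)
  also have "\<dots> = ennreal C * (\<integral>\<^sup>+x. ennreal (f x powr p) \<partial>lborel)"
  proof -
    have "C = p * (2 * 5 ^ DIM('a) * 2 powr (p - 1) / (p - 1))" by (simp add: C_def D_def)
    then show ?thesis using p by (simp only: mult.assoc[symmetric], subst ennreal_mult) auto
  qed
  finally show "(\<integral>\<^sup>+x. epowr (maximal (\<lambda>x. ennreal (f x)) x) p \<partial>lborel) \<le> ennreal C * (\<integral>\<^sup>+x. ennreal (f x powr p) \<partial>lborel)"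
    by (simp add: M_def)
qed

section \<open>Bilinear fractional integration\<close>

lemma epowr_mono:
  assumes "x \<le> y" "0 \<le> p"
  shows "epowr x p \<le> epowr y p"
proof (cases y)
  case (real b)
  with assms obtain a where "x = ennreal a" "0 \<le> a" by (cases x) (auto simp: top_unique)
  with real assms show ?thesis by (simp add: ennreal_leI powr_mono2)
qed (simp add: epowr_def)

lemma epowr_0 [simp]: "epowr 0 p = 0"
  by (simp add: epowr_def)

lemma epowr_top [simp]: "epowr \<top> p = \<top>"
  by (simp add: epowr_def)

lemma epowr_eq_0_iff [simp]: "epowr x p = 0 \<longleftrightarrow> x = 0"
  by (cases x) auto

lemma epowr_mult: "epowr (x * y) p = epowr x p * epowr y p"
proof (cases x)
  case xreal: (real a)
  show ?thesis
  proof (cases y)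
    case (real b)
    with xreal show ?thesis by (simp add: powr_mult flip: ennreal_mult)
  next
    case top
    then show ?thesis by (cases "x = 0") (simp_all add: ennreal_mult_top)
  qed
next
  case top
  then show ?thesis by (cases "y = 0") (simp_all add: ennreal_top_mult)
qed

section \<open>Weighted averages\<close>

lemma nn_integral_reflect_translate:
  fixes f :: "'a::euclidean_space \<Rightarrow> ennreal"
  assumes [measurable]: "f \<in> borel_measurable borel"
  shows "(\<integral>\<^sup>+y. f (x - y) \<partial>lborel) = (\<integral>\<^sup>+y. f y \<partial>lborel)"
proof -
  have *: "distr lborel borel (\<lambda>y. x - y) = lborel"
    using lborel_affine[of "-1" x] by (simp add: density_1)
  have "(\<integral>\<^sup>+y. f (x - y) \<partial>lborel) = (\<integral>\<^sup>+y. f y \<partial>distr lborel borel (\<lambda>y. x - y))"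
    by (simp add: nn_integral_distr)
  then show ?thesis by (simp add: *)
qed

text \<open>\<open>DIM('a) + 1\<close> is the least integer exponent for which the weight is
  integrable; the power of \<open>l\<close> keeps its total mass independent of
  \<open>l\<close>.\<close>

definition weighted_avg :: "real \<Rightarrow> ('a::euclidean_space \<Rightarrow> real) \<Rightarrow> 'a \<Rightarrow> ennreal" where
  "weighted_avg l f x =
     (\<integral>\<^sup>+y. ennreal (1 / (l ^ DIM('a) * (1 + norm y / l) ^ (DIM('a) + 1))) * ennreal (f (x - y)) \<partial>lborel)"

lemma measurable_weighted_avg [measurable]:
  assumes [measurable]: "f \<in> borel_measurable borel" "g \<in> borel_measurable M" "h \<in> borel_measurable M"
  shows "(\<lambda>z. weighted_avg (g z) f (h z)) \<in> borel_measurable M"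
  unfolding weighted_avg_def by measurable

lemma ennreal_le_suminf: "f k \<le> (\<Sum>k. f k :: ennreal)"
  using sum_le_suminf[of f "{k}"] by simp

text \<open>For the least \<open>k\<close> with \<open>u < 2 ^ k\<close> one has
  \<open>2 ^ k \<le> 2 * (1 + u)\<close>, so a single term of the series dominates the left side.
  The weight thereby becomes a superposition of indicators of dyadic balls.\<close>

lemma tail_le_dyadic_sum:
  fixes u :: real
  assumes "u \<ge> 0"
  shows "ennreal (1 / (1 + u) ^ N) \<le> (\<Sum>k. ennreal (2 ^ N * (1 / 2) ^ (k * N)) * indicator {u. u < 2 ^ k} u)"
proof -
  define k where "k = (LEAST k. u < (2::real) ^ k)"
  have "\<exists>k. u < (2::real) ^ k" by (rule real_arch_pow) simp
  then have k: "u < 2 ^ k" unfolding k_def by (rule LeastI_ex)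
  have "1 / (1 + u) ^ N \<le> 2 ^ N * (1 / 2) ^ (k * N)"
  proof (cases k)
    case 0
    have "1 / (1 + u) ^ N \<le> 1" using assms by (simp add: one_le_power)
    also have "\<dots> \<le> 2 ^ N" by simp
    finally show ?thesis using 0 by simp
  next
    case (Suc j)
    then have "\<not> u < 2 ^ j" using not_less_Least[of j "\<lambda>k. u < 2 ^ k"] unfolding k_def by simp
    then have "2 ^ j \<le> 1 + u" by simp
    then have "(2 ^ j) ^ N \<le> (1 + u) ^ N" by (intro power_mono) auto
    then have "1 / (1 + u) ^ N \<le> 1 / (2 ^ j) ^ N"
      by (intro divide_left_mono) (use assms in auto)
    also have "\<dots> = 2 ^ N * (1 / 2) ^ (k * N)"
      by (simp add: Suc power_add power_one_over power_mult[symmetric] mult.commute)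
    finally show ?thesis .
  qed
  then have "ennreal (1 / (1 + u) ^ N) \<le> ennreal (2 ^ N * (1 / 2) ^ (k * N)) * indicator {u. u < 2 ^ k} u"
    using k by (auto intro: ennreal_leI)
  also have "\<dots> \<le> (\<Sum>k. ennreal (2 ^ N * (1 / 2) ^ (k * N)) * indicator {u. u < 2 ^ k} u)"
    by (rule ennreal_le_suminf)
  finally show ?thesis .
qed

text \<open>Every ball about \<open>x\<close> of radius at least \<open>l\<close> contains
  \<open>x'\<close>, so its average is bounded by the maximal function at \<open>x'\<close>. The
  exponent of the weight exceeds the dimension by 1, so the dyadic contributions decay like
  \<open>(1 / 2) ^ k\<close>; their sum 2 and the factor \<open>2 ^ (DIM('a) + 1)\<close> of the
  dyadic bound make up the constant.\<close>

lemma weighted_avg_le_maximal: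
  fixes f :: "'a::euclidean_space \<Rightarrow> real"
  assumes [measurable]: "f \<in> borel_measurable borel" and l: "l > 0" and x': "dist x x' < l"
  shows "weighted_avg l f x \<le> ennreal (2 ^ (DIM('a) + 2) * unit_ball_vol (real DIM('a))) * maximal (\<lambda>x. ennreal (f x)) x'"
proof -
  let ?n = "DIM('a)" let ?N = "DIM('a) + 1" let ?v = "unit_ball_vol (real DIM('a))"
  let ?M = "maximal (\<lambda>x. ennreal (f x)) x'"
  define c where "c k = 2 ^ ?N * (1 / 2) ^ (k * ?N) / l ^ ?n" for k :: nat
  have c: "c k \<ge> 0" for k using l by (simp add: c_def)
  have [measurable]: "ball x r \<in> sets borel" for r by simp
  have "weighted_avg l f x = (\<integral>\<^sup>+y. (\<lambda>y. ennreal (1 / (l ^ ?n * (1 + norm (x - y) / l) ^ ?N)) * ennreal (f y)) (x - y) \<partial>lborel)"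
    unfolding weighted_avg_def by simp
  also have "\<dots> = (\<integral>\<^sup>+y. ennreal (1 / (l ^ ?n * (1 + norm (x - y) / l) ^ ?N)) * ennreal (f y) \<partial>lborel)"
    by (rule nn_integral_reflect_translate) measurable
  also have "\<dots> \<le> (\<integral>\<^sup>+y. (\<Sum>k. ennreal (c k) * (ennreal (f y) * indicator (ball x (2 ^ k * l)) y)) \<partial>lborel)"
  proof (rule nn_integral_mono)
    fix y
    have "ennreal (1 / (l ^ ?n * (1 + norm (x - y) / l) ^ ?N)) * ennreal (f y)
        = ennreal (1 / (1 + norm (x - y) / l) ^ ?N) * (ennreal (1 / l ^ ?n) * ennreal (f y))"
    proof -
      have "ennreal (1 / (l ^ ?n * (1 + norm (x - y) / l) ^ ?N)) = ennreal (1 / (1 + norm (x - y) / l) ^ ?N) * ennreal (1 / l ^ ?n)"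
        using l by (subst ennreal_mult[symmetric]) (auto simp: mult.commute)
      then show ?thesis by (simp only: mult.assoc)
    qed
    also have "\<dots> \<le> (\<Sum>k. ennreal (2 ^ ?N * (1 / 2) ^ (k * ?N)) * indicator {u. u < 2 ^ k} (norm (x - y) / l)) * (ennreal (1 / l ^ ?n) * ennreal (f y))"
      using l by (intro mult_right_mono tail_le_dyadic_sum) auto
    also have "\<dots> = (\<Sum>k. ennreal (2 ^ ?N * (1 / 2) ^ (k * ?N)) * indicator {u. u < 2 ^ k} (norm (x - y) / l) * (ennreal (1 / l ^ ?n) * ennreal (f y)))"
      by (rule ennreal_suminf_multc[symmetric])
    also have "\<dots> = (\<Sum>k. ennreal (c k) * (ennreal (f y) * indicator (ball x (2 ^ k * l)) y))"
    proof (rule arg_cong[where f=suminf], rule ext)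
      fix k
      have "indicator {u. u < 2 ^ k} (norm (x - y) / l) = (indicator (ball x (2 ^ k * l)) y :: ennreal)"
        using l by (auto simp: indicator_def dist_norm field_simps)
      moreover have "ennreal (c k) = ennreal (2 ^ ?N * (1 / 2) ^ (k * ?N)) * ennreal (1 / l ^ ?n)"
        using l by (simp add: c_def flip: ennreal_mult)
      ultimately show "ennreal (2 ^ ?N * (1 / 2) ^ (k * ?N)) * indicator {u. u < 2 ^ k} (norm (x - y) / l) * (ennreal (1 / l ^ ?n) * ennreal (f y))
        = ennreal (c k) * (ennreal (f y) * indicator (ball x (2 ^ k * l)) y)"
        by (simp only: mult_ac)
    qed
    finally show "ennreal (1 / (l ^ ?n * (1 + norm (x - y) / l) ^ ?N)) * ennreal (f y) \<le> \<dots>" .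
  qed
  also have "\<dots> = (\<Sum>k. ennreal (c k) * (\<integral>\<^sup>+y\<in>ball x (2 ^ k * l). ennreal (f y) \<partial>lborel))"
    by (subst nn_integral_suminf, measurable, subst nn_integral_cmult) auto
  also have "\<dots> \<le> (\<Sum>k. ennreal (2 ^ ?N * ?v * (1 / 2) ^ k) * ?M)"
  proof (intro suminf_le allI)
    fix k :: nat
    have "x' \<in> ball x (2 ^ k * l)"
    proof -
      have "l \<le> 2 ^ k * l" using l by simp
      then show ?thesis using x' by simp
    qed
    then have "ennreal (c k) * (\<integral>\<^sup>+y\<in>ball x (2 ^ k * l). ennreal (f y) \<partial>lborel)
      \<le> ennreal (c k) * (emeasure lborel (ball x (2 ^ k * l)) * ?M)"
      by (intro mult_left_mono ball_average_le_maximal) auto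
    also have "\<dots> = ennreal (c k * (?v * (2 ^ k * l) ^ ?n)) * ?M"
      using l c by (simp add: emeasure_ball mult.assoc[symmetric] flip: ennreal_mult)
    also have "c k * (?v * (2 ^ k * l) ^ ?n) = 2 ^ ?N * ?v * (1 / 2) ^ k"
      using l by (simp add: c_def power_mult_distrib power_add power_mult field_simps power_one_over)
    finally show "ennreal (c k) * (\<integral>\<^sup>+y\<in>ball x (2 ^ k * l). ennreal (f y) \<partial>lborel) \<le> ennreal (2 ^ ?N * ?v * (1 / 2) ^ k) * ?M" .
  qed auto
  also have "\<dots> = (\<Sum>k. ennreal (2 ^ ?N * ?v * (1 / 2) ^ k)) * ?M"
    by (rule ennreal_suminf_multc)
  also have "(\<Sum>k. ennreal (2 ^ ?N * ?v * (1 / 2) ^ k)) = ennreal (2 ^ ?N * ?v * 2)"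
  proof (rule suminf_ennreal_eq)
    show "(\<lambda>k. 2 ^ ?N * ?v * (1 / 2) ^ k) sums (2 ^ ?N * ?v * 2)"
      using geometric_sums[of "1/2::real"] by (intro sums_mult) simp
  qed auto
  finally show ?thesis by (simp add: mult_ac)
qed

text \<open>
  The maximal function may be evaluated at any \<open>x'\<close> within distance \<open>l\<close> of \<open>x\<close>; averaging the
  \<open>p\<close>-th power over these \<open>x'\<close> replaces an application of Hoelder's inequality.
\<close>

lemma weighted_avg_le_Lp:
  assumes p: "p > (1::real)"
  obtains C where "C > 0"
    "\<And>(f :: 'a::euclidean_space \<Rightarrow> real) A l x. f \<in> borel_measurable borel \<Longrightarrow> (\<And>x. 0 \<le> f x) \<Longrightarrow> 0 < A \<Longrightarrow> 0 < l \<Longrightarrow>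
       (\<integral>\<^sup>+x. ennreal (f x powr p) \<partial>lborel) \<le> ennreal (A powr p) \<Longrightarrow>
       weighted_avg l f x \<le> ennreal (C * A * l powr (- (real DIM('a) / p)))"
proof -
  let ?n = "DIM('a)" let ?v = "unit_ball_vol (real DIM('a))"
  define C1 where "C1 = 2 ^ (DIM('a) + 2) * ?v"
  have v: "?v > 0" by simp
  then have v0: "?v \<noteq> 0" by (metis less_irrefl)
  have C1: "C1 > 0" by (simp add: C1_def)
  obtain C2 where C2: "C2 > 0"
    "\<And>f :: 'a::euclidean_space \<Rightarrow> real. f \<in> borel_measurable borel \<Longrightarrow> (\<And>x. 0 \<le> f x) \<Longrightarrow>
      (\<integral>\<^sup>+x. epowr (maximal (\<lambda>x. ennreal (f x)) x) p \<partial>lborel) \<le> ennreal C2 * (\<integral>\<^sup>+x. ennreal (f x powr p) \<partial>lborel)"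
    using maximal_strong_type[OF p] by blast
  define C where "C = C1 * (C2 / ?v) powr (1 / p)"
  show ?thesis
  proof (rule that[of C])
    show "C > 0" using C1 C2(1) v0 by (simp add: C_def)
    note \<open>C > 0\<close>
    fix f :: "'a \<Rightarrow> real" and A l :: real and x :: 'a
    assume [measurable]: "f \<in> borel_measurable borel" and f: "\<And>x. 0 \<le> f x" and A: "0 < A" and l: "0 < l"
      and le: "(\<integral>\<^sup>+x. ennreal (f x powr p) \<partial>lborel) \<le> ennreal (A powr p)"
    let ?M = "maximal (\<lambda>x. ennreal (f x))"
    define W where "W = ?v * l ^ ?n"
    have vl: "W > 0" using v l by (simp add: W_def)
    define u where "u = weighted_avg l f x"
    have "epowr u p * emeasure lborel (ball x l) = (\<integral>\<^sup>+y. epowr u p * indicator (ball x l) y \<partial>lborel)"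
      by (simp add: nn_integral_cmult_indicator)
    also have "\<dots> \<le> (\<integral>\<^sup>+y. ennreal (C1 powr p) * epowr (?M y) p \<partial>lborel)"
    proof (rule nn_integral_mono)
      fix y
      show "epowr u p * indicator (ball x l) y \<le> ennreal (C1 powr p) * epowr (?M y) p"
      proof (cases "dist x y < l")
        case True
        then have "u \<le> ennreal C1 * ?M y"
          unfolding u_def C1_def using l by (intro weighted_avg_le_maximal) auto
        then have "epowr u p \<le> epowr (ennreal C1 * ?M y) p" using p by (intro epowr_mono) auto
        then show ?thesis using True p C1 by (simp add: epowr_mult)
      qed (auto simp: indicator_def)
    qed
    also have "\<dots> = ennreal (C1 powr p) * (\<integral>\<^sup>+y. epowr (?M y) p \<partial>lborel)"
      by (rule nn_integral_cmult) measurable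
    also have "\<dots> \<le> ennreal (C1 powr p) * (ennreal C2 * (\<integral>\<^sup>+x. ennreal (f x powr p) \<partial>lborel))"
      by (intro mult_left_mono C2(2)) (use f in auto)
    also have "\<dots> \<le> ennreal (C1 powr p) * (ennreal C2 * ennreal (A powr p))"
      by (intro mult_left_mono le) auto
    also have "\<dots> = ennreal (C1 powr p * C2 * A powr p)"
      using C2(1) by (simp add: ennreal_mult mult.assoc)
    finally have *: "epowr u p * ennreal W \<le> ennreal (C1 powr p * C2 * A powr p)"
      using l by (simp add: emeasure_ball W_def)
    have "u \<noteq> \<infinity>"
    proof
      assume "u = \<infinity>"
      then have "epowr u p * ennreal W = \<infinity>" using vl by (simp add: epowr_def ennreal_top_mult)
      then show False using * by (simp add: top_unique)
    qed
    then obtain w where w: "u = ennreal w" "w \<ge> 0" by (cases u) auto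
    have "w powr p * W \<le> C1 powr p * C2 * A powr p"
      using * w vl C2(1) by (simp add: ennreal_le_iff flip: ennreal_mult)
    then have "w powr p \<le> C1 powr p * C2 * A powr p / W"
      using vl by (simp add: pos_le_divide_eq)
    also have "\<dots> = C1 powr p * (C2 / ?v) * A powr p * l powr (- real ?n)"
      using l by (simp add: W_def powr_minus powr_realpow divide_inverse)
    also have "\<dots> = (C * A * l powr (- (real ?n / p))) powr p"
      using C1 C2(1) v A l p by (simp add: C_def powr_mult powr_powr)
    finally have "(w powr p) powr (1 / p) \<le> ((C * A * l powr (- (real ?n / p))) powr p) powr (1 / p)"
      using p by (simp add: powr_mono2 del: powr_powr)
    then have "w \<le> C * A * l powr (- (real ?n / p))"
      using p w \<open>C > 0\<close> A l by (simp add: powr_powr)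
    then show "weighted_avg l f x \<le> ennreal (C * A * l powr (- (real ?n / p)))"
      using w unfolding u_def[symmetric] by (simp add: ennreal_leI)
  qed
qed

text \<open>The power \<open>s - 1\<close> is \<open>l powr s\<close> against the scale-invariant
  measure \<open>dl / l\<close>; the form plays the role of a bilinear fractional integral of order
  \<open>s\<close>.\<close>

definition fractional_form :: "real \<Rightarrow> ('a::euclidean_space \<Rightarrow> real) \<Rightarrow> ('a \<Rightarrow> real) \<Rightarrow> 'a \<Rightarrow> ennreal" where
  "fractional_form s f g x =
     (\<integral>\<^sup>+l. indicator {0<..} l * (ennreal (l powr (s - 1)) * (weighted_avg l f x * weighted_avg l g x)) \<partial>lborel)"

definition pnorm :: "real \<Rightarrow> ('a::euclidean_space \<Rightarrow> real) \<Rightarrow> ennreal" where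
  "pnorm p f = epowr (\<integral>\<^sup>+x. ennreal (f x powr p) \<partial>lborel) (1 / p)"

text \<open>The degenerate case of the theorem below, in which one cannot divide by the
  norm.\<close>

lemma weighted_avg_eq_0:
  fixes f :: "'a::euclidean_space \<Rightarrow> real"
  assumes [measurable]: "f \<in> borel_measurable borel" and f: "\<And>x. 0 \<le> f x" and "p > 0" "pnorm p f = 0"
  shows "weighted_avg l f x = 0"
proof -
  have "(\<integral>\<^sup>+x. ennreal (f x powr p) \<partial>lborel) = 0"
    using assms(3,4) by (cases "(\<integral>\<^sup>+x. ennreal (f x powr p) \<partial>lborel)") (auto simp: pnorm_def epowr_def)
  then have ae: "AE x in lborel. f x = 0" by (subst (asm) nn_integral_0_iff_AE) auto
  have "weighted_avg l f x = (\<integral>\<^sup>+y. (\<lambda>y. ennreal (1 / (l ^ DIM('a) * (1 + norm (x - y) / l) ^ (DIM('a) + 1))) * ennreal (f y)) (x - y) \<partial>lborel)"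
    unfolding weighted_avg_def by simp
  also have "\<dots> = (\<integral>\<^sup>+y. ennreal (1 / (l ^ DIM('a) * (1 + norm (x - y) / l) ^ (DIM('a) + 1))) * ennreal (f y) \<partial>lborel)"
    by (rule nn_integral_reflect_translate) measurable
  also have "\<dots> = 0" using ae by (subst nn_integral_0_iff_AE) auto
  finally show ?thesis .
qed

text \<open>
  With \<open>r\<close> the sum of the normalised powers \<open>(M f / \<parallel>f\<parallel>)\<^sup>p\<^sup>1\<close> and \<open>(M g / \<parallel>g\<parallel>)\<^sup>p\<^sup>2\<close> at \<open>x\<close>, both parts of
  the integral over \<open>l\<close>, split at \<open>r\<^sup>-\<^sup>1\<^sup>/\<^sup>n\<close>, are of size \<open>r\<^sup>1\<^sup>/\<^sup>q\<close>.
\<close>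

theorem fractional_form_bound:
  fixes p1 p2 q s :: real
  assumes p: "p1 > 1" "p2 > 1" "q > 0" "s > 0"
    and rel: "1 / q = 1 / p1 + 1 / p2 - s / real DIM('a::euclidean_space)"
  obtains C where "C > 0"
    "\<And>f g :: 'a \<Rightarrow> real. f \<in> borel_measurable borel \<Longrightarrow> g \<in> borel_measurable borel \<Longrightarrow> (\<And>x. 0 \<le> f x) \<Longrightarrow> (\<And>x. 0 \<le> g x) \<Longrightarrow>
       (\<integral>\<^sup>+x. epowr (fractional_form s f g x) q \<partial>lborel) \<le> ennreal C * epowr (pnorm p1 f * pnorm p2 g) q"
proof -
  let ?n = "real DIM('a)"
  have n: "?n > 0" by simp
  define C0 where "C0 = 2 ^ (DIM('a) + 2) * unit_ball_vol ?n"
  have C0: "C0 > 0" by (simp add: C0_def)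
  obtain C1 where C1: "C1 > 0"
    "\<And>(f :: 'a::euclidean_space \<Rightarrow> real) A l x. f \<in> borel_measurable borel \<Longrightarrow> (\<And>x. 0 \<le> f x) \<Longrightarrow> 0 < A \<Longrightarrow> 0 < l \<Longrightarrow>
       (\<integral>\<^sup>+x. ennreal (f x powr p1) \<partial>lborel) \<le> ennreal (A powr p1) \<Longrightarrow>
       weighted_avg l f x \<le> ennreal (C1 * A * l powr (- (?n / p1)))"
    using weighted_avg_le_Lp[OF p(1)] by blast
  obtain C2 where C2: "C2 > 0"
    "\<And>(f :: 'a::euclidean_space \<Rightarrow> real) A l x. f \<in> borel_measurable borel \<Longrightarrow> (\<And>x. 0 \<le> f x) \<Longrightarrow> 0 < A \<Longrightarrow> 0 < l \<Longrightarrow>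
       (\<integral>\<^sup>+x. ennreal (f x powr p2) \<partial>lborel) \<le> ennreal (A powr p2) \<Longrightarrow>
       weighted_avg l f x \<le> ennreal (C2 * A * l powr (- (?n / p2)))"
    using weighted_avg_le_Lp[OF p(2)] by blast
  obtain D1 where D1: "D1 > 0"
    "\<And>f :: 'a::euclidean_space \<Rightarrow> real. f \<in> borel_measurable borel \<Longrightarrow> (\<And>x. 0 \<le> f x) \<Longrightarrow>
      (\<integral>\<^sup>+x. epowr (maximal (\<lambda>x. ennreal (f x)) x) p1 \<partial>lborel) \<le> ennreal D1 * (\<integral>\<^sup>+x. ennreal (f x powr p1) \<partial>lborel)"
    using maximal_strong_type[OF p(1)] by blast
  obtain D2 where D2: "D2 > 0"
    "\<And>f :: 'a::euclidean_space \<Rightarrow> real. f \<in> borel_measurable borel \<Longrightarrow> (\<And>x. 0 \<le> f x) \<Longrightarrow>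
      (\<integral>\<^sup>+x. epowr (maximal (\<lambda>x. ennreal (f x)) x) p2 \<partial>lborel) \<le> ennreal D2 * (\<integral>\<^sup>+x. ennreal (f x powr p2) \<partial>lborel)"
    using maximal_strong_type[OF p(2)] by blast
  \<comment> \<open>The summands belong to the small and to the large scales; \<open>1 / s\<close>
    and \<open>q / ?n\<close> come from integrating \<open>l powr (s - 1)\<close> up to the
    splitting point and \<open>l powr (- (?n / q) - 1)\<close> beyond it.\<close>
  define K where "K = C0 * C0 * (1 / s) + C1 * C2 * (q / ?n)"
  have K: "K > 0" using C0 C1(1) C2(1) p n by (simp add: K_def add_pos_pos)
  \<comment> \<open>This is the decay rate of the tail over the scales, and \<open>q > 0\<close>
    makes it positive.\<close>
  have exps: "?n / p1 + ?n / p2 - s = ?n / q"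
  proof -
    have "?n / q = ?n * (1 / q)" by simp
    also have "\<dots> = ?n / p1 + ?n / p2 - s"
      unfolding rel using n by (simp add: right_diff_distrib distrib_left)
    finally show ?thesis by simp
  qed
  define C where "C = K powr q * (D1 + D2)"
  show ?thesis
  proof (rule that[of C])
    show "C > 0" using K D1(1) D2(1) by (simp add: C_def add_pos_pos)
    fix f g :: "'a \<Rightarrow> real"
    assume [measurable]: "f \<in> borel_measurable borel" "g \<in> borel_measurable borel"
      and f: "\<And>x. 0 \<le> f x" and g: "\<And>x. 0 \<le> g x"
    show "(\<integral>\<^sup>+x. epowr (fractional_form s f g x) q \<partial>lborel) \<le> ennreal C * epowr (pnorm p1 f * pnorm p2 g) q"
    proof (cases "pnorm p1 f = 0 \<or> pnorm p2 g = 0")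
      case True
      have zero: "weighted_avg l f x * weighted_avg l g x = 0" for l x
        using True weighted_avg_eq_0[of f p1 l x] weighted_avg_eq_0[of g p2 l x] f g p by auto
      then have "fractional_form s f g x = 0" for x
        unfolding fractional_form_def zero by simp
      then show ?thesis using p by (simp add: epowr_def)
    next
      case nz: False
      show ?thesis
      proof (cases "pnorm p1 f = \<infinity> \<or> pnorm p2 g = \<infinity>")
        case True
        then have "pnorm p1 f * pnorm p2 g = \<infinity>" using nz by (auto simp: ennreal_mult_top ennreal_top_mult)
        then show ?thesis using \<open>C > 0\<close> by (simp add: epowr_def ennreal_mult_top)
      next
        case fin: False
        \<comment> \<open>From here on both norms are positive and finite, so the maximal functions
          can be measured in units of \<open>A\<close> and \<open>B\<close>.\<close>
        obtain A where A: "pnorm p1 f = ennreal A" "A > 0"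
          using nz fin by (cases "pnorm p1 f") (auto simp: order_le_less)
        obtain B where B: "pnorm p2 g = ennreal B" "B > 0"
          using nz fin by (cases "pnorm p2 g") (auto simp: order_le_less)
        have intA: "(\<integral>\<^sup>+x. ennreal (f x powr p1) \<partial>lborel) = ennreal (A powr p1)"
          using A p by (cases "\<integral>\<^sup>+x. ennreal (f x powr p1) \<partial>lborel") (auto simp: pnorm_def powr_powr epowr_def)
        have intB: "(\<integral>\<^sup>+x. ennreal (g x powr p2) \<partial>lborel) = ennreal (B powr p2)"
          using B p by (cases "\<integral>\<^sup>+x. ennreal (g x powr p2) \<partial>lborel") (auto simp: pnorm_def powr_powr epowr_def)
        let ?Mf = "maximal (\<lambda>x. ennreal (f x))" and ?Mg = "maximal (\<lambda>x. ennreal (g x))"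
        have point: "epowr (fractional_form s f g x) q \<le> ennreal ((K * A * B) powr q) *
            (ennreal (A powr - p1) * epowr (?Mf x) p1 + ennreal (B powr - p2) * epowr (?Mg x) p2)" for x
        proof -
          let ?R = "ennreal (A powr - p1) * epowr (?Mf x) p1 + ennreal (B powr - p2) * epowr (?Mg x) p2"
          have KAB: "(K * A * B) powr q > 0" using K A B by simp
          have avf: "weighted_avg l f x \<le> ennreal C0 * ?Mf x" if "l > 0" for l
            unfolding C0_def using that by (intro weighted_avg_le_maximal) auto
          have avg: "weighted_avg l g x \<le> ennreal C0 * ?Mg x" if "l > 0" for l
            unfolding C0_def using that by (intro weighted_avg_le_maximal) auto
          show ?thesis
          proof (cases "?Mf x = \<infinity> \<or> ?Mg x = \<infinity>")
            case True
            then have "?R = \<infinity>" using A B by (auto simp: epowr_def ennreal_mult_top)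
            then have "ennreal ((K * A * B) powr q) * ?R = \<infinity>" using KAB by (simp only:) (simp add: ennreal_mult_top)
            then show ?thesis by (simp only: infinity_ennreal_def top_greatest)
          next
            case False
            obtain a where a: "?Mf x = ennreal a" "a \<ge> 0" using False by (cases "?Mf x") auto
            obtain b where b: "?Mg x = ennreal b" "b \<ge> 0" using False by (cases "?Mg x") auto
            define r where "r = A powr - p1 * a powr p1 + B powr - p2 * b powr p2"
            have R: "?R = ennreal r" by (simp add: a b r_def flip: ennreal_mult ennreal_plus)
            have r0: "r \<ge> 0" by (simp add: r_def)
            show ?thesis
            proof (cases "r = 0")
              case True
              then have "A powr - p1 * a powr p1 = 0"
                unfolding r_def by (smt (verit) mult_nonneg_nonneg powr_ge_zero)
              then have "a = 0" using A by auto
              then have "weighted_avg l f x = 0" if "l > 0" for l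
                using avf[OF that] a by simp
              then have "fractional_form s f g x = 0"
                unfolding fractional_form_def by (subst nn_integral_0_iff_AE) (auto simp: indicator_def)
              then show ?thesis by (simp add: epowr_def)
            next
              case False
              then have r: "r > 0" using r0 by simp
              \<comment> \<open>\<open>r\<close> dominates each of its two summands; solving for
                \<open>a\<close> gives the claim.\<close>
              have ar: "a \<le> A * r powr (1 / p1)"
              proof -
                have "(a / A) powr p1 \<le> r" using A a by (simp add: r_def powr_divide powr_minus field_simps)
                then have "((a / A) powr p1) powr (1 / p1) \<le> r powr (1 / p1)"
                  using p by (intro powr_mono2) auto
                then show ?thesis using A a p by (simp add: powr_powr field_simps)
              qed
              have br: "b \<le> B * r powr (1 / p2)"
              proof -
                have "(b / B) powr p2 \<le> r" using B b by (simp add: r_def powr_divide powr_minus field_simps)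
                then have "((b / B) powr p2) powr (1 / p2) \<le> r powr (1 / p2)"
                  using p by (intro powr_mono2) auto
                then show ?thesis using B b p by (simp add: powr_powr field_simps)
              qed
              define T where "T = r powr (- (1 / ?n))"
              have T: "T > 0" using r by (simp add: T_def)
              define c1 where "c1 = (C0 * (A * r powr (1 / p1))) * (C0 * (B * r powr (1 / p2)))"
              define c2 where "c2 = C1 * A * (C2 * B)"
              have c1: "c1 \<ge> 0" and c2: "c2 \<ge> 0" using C0 C1(1) C2(1) A B by (auto simp: c1_def c2_def)
              have "fractional_form s f g x \<le> (\<integral>\<^sup>+l. ennreal c1 * (indicator {t. 0 < t \<and> ennreal t < ennreal T} l * ennreal (l powr (s - 1))) +
                   ennreal c2 * (indicator {T..} l * ennreal (l powr (- (?n / q) - 1))) \<partial>lborel)"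
                unfolding fractional_form_def
              proof (rule nn_integral_mono)
                fix l :: real
                show "indicator {0<..} l * (ennreal (l powr (s - 1)) * (weighted_avg l f x * weighted_avg l g x))
                   \<le> ennreal c1 * (indicator {t. 0 < t \<and> ennreal t < ennreal T} l * ennreal (l powr (s - 1))) +
                     ennreal c2 * (indicator {T..} l * ennreal (l powr (- (?n / q) - 1)))"
                proof (cases "l > 0")
                  case l: True
                  show ?thesis
                  proof (cases "l < T")
                    case True
                    have "weighted_avg l f x \<le> ennreal (C0 * (A * r powr (1 / p1)))"
                      using avf[OF l] a ar C0 by (elim order_trans) (simp add: ennreal_leI flip: ennreal_mult)
                    moreover have "weighted_avg l g x \<le> ennreal (C0 * (B * r powr (1 / p2)))"
                      using avg[OF l] b br C0 by (elim order_trans) (simp add: ennreal_leI flip: ennreal_mult)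
                    ultimately have "weighted_avg l f x * weighted_avg l g x \<le> ennreal c1"
                      unfolding c1_def using C0 A B by (subst ennreal_mult) (auto intro: mult_mono)
                    then have "ennreal (l powr (s - 1)) * (weighted_avg l f x * weighted_avg l g x) \<le> ennreal (l powr (s - 1)) * ennreal c1"
                      by (intro mult_left_mono) auto
                    then show ?thesis using l True T by (simp add: indicator_def ennreal_less_iff mult.commute)
                  next
                    case False
                    have "weighted_avg l f x \<le> ennreal (C1 * A * l powr (- (?n / p1)))"
                      using f A l intA by (intro C1(2)) auto
                    moreover have "weighted_avg l g x \<le> ennreal (C2 * B * l powr (- (?n / p2)))"
                      using g B l intB by (intro C2(2)) auto
                    ultimately have "weighted_avg l f x * weighted_avg l g x \<le> ennreal (C1 * A * l powr (- (?n / p1))) * ennreal (C2 * B * l powr (- (?n / p2)))"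
                      by (rule mult_mono) auto
                    then have "ennreal (l powr (s - 1)) * (weighted_avg l f x * weighted_avg l g x) \<le>
                        ennreal (l powr (s - 1)) * (ennreal (C1 * A * l powr (- (?n / p1))) * ennreal (C2 * B * l powr (- (?n / p2))))"
                      by (intro mult_left_mono) auto
                    also have "\<dots> = ennreal (l powr (s - 1) * ((C1 * A * l powr (- (?n / p1))) * (C2 * B * l powr (- (?n / p2)))))"
                      using C1(1) C2(1) A B by (simp add: ennreal_mult)
                    also have "l powr (s - 1) * ((C1 * A * l powr (- (?n / p1))) * (C2 * B * l powr (- (?n / p2)))) =
                        c2 * (l powr (s - 1) * l powr (- (?n / p1)) * l powr (- (?n / p2)))"
                      by (simp add: c2_def)
                    also have "l powr (s - 1) * l powr (- (?n / p1)) * l powr (- (?n / p2)) = l powr (- (?n / q) - 1)"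
                      unfolding powr_add[symmetric] using exps by (intro arg_cong[where f="\<lambda>e. l powr e"]) linarith
                    finally show ?thesis using l False T c2 by (simp add: indicator_def ennreal_less_iff ennreal_mult)
                  qed
                qed simp
              qed
              also have "\<dots> = ennreal c1 * (\<integral>\<^sup>+l. indicator {t. 0 < t \<and> ennreal t < ennreal T} l * ennreal (l powr (s - 1)) \<partial>lborel) +
                   ennreal c2 * (\<integral>\<^sup>+l. indicator {T..} l * ennreal (l powr (- (?n / q) - 1)) \<partial>lborel)"
                by (subst nn_integral_add) (auto simp: nn_integral_cmult)
              also have "\<dots> = ennreal (c1 * (1 / s * T powr s) + c2 * (T powr (- (?n / q)) / (?n / q)))"
                using p n T c1 c2 by (subst nn_integral_powr_less, simp, subst nn_integral_powr_tail)
                  (simp_all flip: ennreal_mult ennreal_plus)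
              also have "c1 * (1 / s * T powr s) + c2 * (T powr (- (?n / q)) / (?n / q)) = K * A * B * r powr (1 / q)"
              proof -
                have "c1 * (1 / s * T powr s) = C0 * C0 * (1 / s) * A * B * (r powr (1 / p1) * r powr (1 / p2) * r powr (- (s / ?n)))"
                  by (simp add: c1_def T_def powr_powr)
                also have "r powr (1 / p1) * r powr (1 / p2) * r powr (- (s / ?n)) = r powr (1 / q)"
                  unfolding powr_add[symmetric] using rel by simp
                finally have 1: "c1 * (1 / s * T powr s) = C0 * C0 * (1 / s) * A * B * r powr (1 / q)" .
                have "T powr (- (?n / q)) = r powr (1 / q)" using n by (simp add: T_def powr_powr)
                then have 2: "c2 * (T powr (- (?n / q)) / (?n / q)) = C1 * C2 * (q / ?n) * A * B * r powr (1 / q)"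
                  by (simp add: c2_def)
                show ?thesis unfolding 1 2 K_def by (simp add: algebra_simps)
              qed
              finally have "fractional_form s f g x \<le> ennreal (K * A * B * r powr (1 / q))" .
              then have "epowr (fractional_form s f g x) q \<le> epowr (ennreal (K * A * B * r powr (1 / q))) q"
                using p by (intro epowr_mono) auto
              also have "\<dots> = ennreal ((K * A * B) powr q * r)"
                using K A B p r by (simp add: powr_mult powr_powr)
              finally show ?thesis unfolding R using r by (simp add: ennreal_mult)
            qed
          qed
        qed
        \<comment> \<open>The power \<open>q\<close> has turned \<open>r powr (1 / q)\<close> into
          \<open>r\<close>, which is a sum of one power of each maximal function, so the maximal
          theorem applies to each term separately and no Hoelder inequality for the product
          enters.\<close>
        have "(\<integral>\<^sup>+x. epowr (fractional_form s f g x) q \<partial>lborel) \<le> (\<integral>\<^sup>+x. ennreal ((K * A * B) powr q) *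
            (ennreal (A powr - p1) * epowr (?Mf x) p1 + ennreal (B powr - p2) * epowr (?Mg x) p2) \<partial>lborel)"
          by (intro nn_integral_mono point)
        also have "\<dots> = ennreal ((K * A * B) powr q) * (ennreal (A powr - p1) * (\<integral>\<^sup>+x. epowr (?Mf x) p1 \<partial>lborel) +
             ennreal (B powr - p2) * (\<integral>\<^sup>+x. epowr (?Mg x) p2 \<partial>lborel))"
          by (subst nn_integral_cmult, measurable, subst nn_integral_add) (auto simp: nn_integral_cmult)
        also have "\<dots> \<le> ennreal ((K * A * B) powr q) * (ennreal (A powr - p1) * (ennreal D1 * ennreal (A powr p1)) +
             ennreal (B powr - p2) * (ennreal D2 * ennreal (B powr p2)))"
          unfolding intA[symmetric] intB[symmetric] using f g
          by (intro mult_left_mono add_mono D1(2) D2(2)) auto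
        also have "\<dots> = ennreal ((K * A * B) powr q * (D1 + D2))"
        proof -
          have "A powr - p1 * (D1 * A powr p1) = D1" "B powr - p2 * (D2 * B powr p2) = D2"
            using A B by (simp_all add: powr_minus)
          then have "(K * A * B) powr q * (D1 + D2) = (K * A * B) powr q * (A powr - p1 * (D1 * A powr p1) + B powr - p2 * (D2 * B powr p2))"
            by (simp only:)
          then show ?thesis using D1(1) D2(1) by (simp only:) (simp flip: ennreal_mult ennreal_plus)
        qed
        also have "\<dots> = ennreal C * epowr (pnorm p1 f * pnorm p2 g) q"
          using A B K D1(1) D2(1) by (simp add: C_def powr_mult mult_ac flip: ennreal_mult)
        finally show ?thesis .
      qed
    qed
  qed
qed

section \<open>Fourier inversion\<close>

lemma measurable_cis [measurable]: "cis \<in> borel_measurable borel"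
  by (intro borel_measurable_continuous_onI) (auto intro!: continuous_intros simp: cis_conv_exp[abs_def])

lemma power2_norm_eq_sum_Basis: "(norm (v::'a::euclidean_space))\<^sup>2 = (\<Sum>b\<in>Basis. (v \<bullet> b)\<^sup>2)"
  unfolding power2_norm_eq_inner by (subst euclidean_inner) (simp add: power2_eq_square)

text \<open>\<open>lborel\<close> is the image of the product of the one-dimensional Lebesgue
  measures over the basis.\<close>

lemma integral_lborel_prod:
  fixes f :: "'a::euclidean_space \<Rightarrow> real \<Rightarrow> complex"
  assumes "\<And>b. b \<in> Basis \<Longrightarrow> integrable lborel (f b)"
  shows "integrable lborel (\<lambda>x. \<Prod>b\<in>Basis. f b (x \<bullet> b))"
    and "(\<integral>x. (\<Prod>b\<in>Basis. f b (x \<bullet> b)) \<partial>lborel) = (\<Prod>b\<in>Basis. \<integral>x. f b x \<partial>lborel)"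
proof -
  interpret product_sigma_finite "\<lambda>_::'a. lborel :: real measure" ..
  have [measurable]: "f b \<in> borel_measurable borel" if "b \<in> Basis" for b
    using assms[OF that] by auto
  have meas: "(\<lambda>x. \<Prod>b\<in>Basis. f b (x \<bullet> b)) \<in> borel_measurable borel" by measurable
  have eq: "(\<Prod>b\<in>Basis. f b ((\<Sum>b\<in>Basis. y b *\<^sub>R b) \<bullet> b)) = (\<Prod>b\<in>Basis. f b (y b))" for y
    by (intro prod.cong) auto
  show "integrable lborel (\<lambda>x. \<Prod>b\<in>Basis. f b (x \<bullet> b))"
    by (subst lborel_eq, subst integrable_distr_eq)
      (use meas product_integrable_prod[of Basis f] assms in \<open>simp_all add: eq\<close>)
  show "(\<integral>x. (\<Prod>b\<in>Basis. f b (x \<bullet> b)) \<partial>lborel) = (\<Prod>b\<in>Basis. \<integral>x. f b x \<partial>lborel)"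
    by (subst lborel_eq, subst integral_distr)
      (use meas product_integral_prod[of Basis f] assms in \<open>simp_all add: eq\<close>)
qed

lemma integral_lborel_affine:
  fixes f :: "'a::euclidean_space \<Rightarrow> 'b::{banach, second_countable_topology}"
  assumes [measurable]: "f \<in> borel_measurable borel" and c: "c \<noteq> 0"
  shows "(\<integral>x. f x \<partial>lborel) = \<bar>c\<bar> ^ DIM('a) *\<^sub>R (\<integral>x. f (t + c *\<^sub>R x) \<partial>lborel)"
    and "integrable lborel f \<longleftrightarrow> integrable lborel (\<lambda>x. f (t + c *\<^sub>R x))"
proof -
  have eq: "lborel = density (distr lborel borel (\<lambda>x. t + c *\<^sub>R x)) (\<lambda>_. ennreal (\<bar>c\<bar> ^ DIM('a)))"
    using lborel_affine[OF c, of t] by simp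
  show "(\<integral>x. f x \<partial>lborel) = \<bar>c\<bar> ^ DIM('a) *\<^sub>R (\<integral>x. f (t + c *\<^sub>R x) \<partial>lborel)"
    by (subst eq, subst integral_density) (auto simp: integral_distr)
  show "integrable lborel f \<longleftrightarrow> integrable lborel (\<lambda>x. f (t + c *\<^sub>R x))"
  proof -
    have "integrable lborel (\<lambda>x. f (t + c *\<^sub>R x))" if "integrable lborel (\<lambda>x. \<bar>c\<bar> ^ DIM('a) *\<^sub>R f (t + c *\<^sub>R x))"
      using integrable_scaleR_right[of "1 / \<bar>c\<bar> ^ DIM('a)", OF that] c by simp
    then show ?thesis
      by (subst eq, subst integrable_density) (auto simp: integrable_distr_eq)
  qed
qed

section \<open>Gaussians\<close>

definition gauss :: "'a::euclidean_space \<Rightarrow> real" where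
  "gauss v = (\<Prod>b\<in>Basis. std_normal_density (v \<bullet> b))"

lemma gauss_eq: "gauss (v::'a::euclidean_space) = exp (- (norm v)\<^sup>2 / 2) / sqrt (2 * pi) ^ DIM('a)"
proof -
  have "(norm v)\<^sup>2 = (\<Sum>b\<in>Basis. (v \<bullet> b)\<^sup>2)"
    by (rule power2_norm_eq_sum_Basis)
  then have "exp (- (norm v)\<^sup>2 / 2) = (\<Prod>b\<in>Basis. exp (- (v \<bullet> b)\<^sup>2 / 2))"
    by (simp add: exp_sum[symmetric] sum_negf sum_divide_distrib)
  then show ?thesis
    by (simp add: gauss_def std_normal_density_def prod.distrib prod_dividef power_one_over)
qed

lemma measurable_gauss [measurable]: "gauss \<in> borel_measurable borel"
  unfolding gauss_eq[abs_def] by measurable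

lemma gauss_nonneg: "gauss v \<ge> 0"
  by (simp add: gauss_eq)

text \<open>Everything factors over the basis; on the line this is the characteristic function of
  the standard normal distribution.\<close>

lemma fourier_gauss:
  fixes w :: "'a::euclidean_space"
  shows "integrable lborel (\<lambda>v. cis (w \<bullet> v) * gauss v)"
    and "(\<integral>v. cis (w \<bullet> v) * gauss v \<partial>lborel) = exp (- (norm w)\<^sup>2 / 2)"
proof -
  have eq: "cis (w \<bullet> v) * gauss v = (\<Prod>b\<in>Basis. cis ((w \<bullet> b) * (v \<bullet> b)) * std_normal_density (v \<bullet> b))" for v
  proof -
    have "cis (\<Sum>b\<in>A. f b) = (\<Prod>b\<in>A. cis (f b))" if "finite A" for A :: "'a set" and f
      using that by induction (auto simp: cis_mult[symmetric])
    then show ?thesis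
      by (simp add: gauss_def prod.distrib euclidean_inner[of w v])
  qed
  have int: "integrable lborel (\<lambda>x. cis (t * x) * std_normal_density x)" for t
  proof (rule Bochner_Integration.integrable_bound)
    show "integrable lborel std_normal_density" by (rule integrable_normal_density) simp
  qed (auto simp: norm_mult)
  have val: "(\<integral>x. cis (t * x) * std_normal_density x \<partial>lborel) = exp (- (t\<^sup>2) / 2)" for t
  proof -
    have "(\<integral>x. cis (t * x) * std_normal_density x \<partial>lborel) = (\<integral>x. std_normal_density x *\<^sub>R cis (t * x) \<partial>lborel)"
      by (simp add: scaleR_conv_of_real mult.commute)
    also have "\<dots> = char std_normal_distribution t"
      unfolding char_def by (subst integral_density) (auto simp: cis_conv_exp)
    finally show ?thesis by (simp add: char_std_normal_distribution)
  qed
  show "integrable lborel (\<lambda>v. cis (w \<bullet> v) * gauss v)"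
    unfolding eq by (rule integral_lborel_prod(1)) (rule int)
  have "(norm w)\<^sup>2 = (\<Sum>b\<in>Basis. (w \<bullet> b)\<^sup>2)"
    by (rule power2_norm_eq_sum_Basis)
  then have "exp (- (norm w)\<^sup>2 / 2) = (\<Prod>b\<in>Basis. exp (- (w \<bullet> b)\<^sup>2 / 2))"
    by (simp add: exp_sum[symmetric] sum_negf sum_divide_distrib)
  then show "(\<integral>v. cis (w \<bullet> v) * gauss v \<partial>lborel) = exp (- (norm w)\<^sup>2 / 2)"
    unfolding eq using integral_lborel_prod(2)[OF int, of "\<lambda>b. w \<bullet> b"] val by simp
qed

lemma integral_gauss:
  "integrable lborel (gauss :: 'a::euclidean_space \<Rightarrow> real)" "(\<integral>v. gauss (v::'a::euclidean_space) \<partial>lborel) = 1"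
proof -
  have i: "integrable lborel (\<lambda>v::'a. complex_of_real (gauss v))" and v: "integral\<^sup>L lborel (\<lambda>v::'a. complex_of_real (gauss v)) = 1"
    using fourier_gauss[of "0::'a"] by auto
  show "integrable lborel (gauss :: 'a \<Rightarrow> real)" using integrable_Re[OF i] by simp
  then show "(\<integral>v. gauss (v::'a::euclidean_space) \<partial>lborel) = 1"
    using v by (simp add: integral_complex_of_real)
qed

text \<open>The unnormalised Fourier integral with positive phase. Up to a constant,
  \<open>fourier f\<close> is \<open>osc f\<close> at the reflected point, whereas a Fourier
  multiplier operator is \<open>osc\<close> of the multiplied transform; one object serves
  both.\<close>

definition osc :: "('a::euclidean_space \<Rightarrow> complex) \<Rightarrow> 'a \<Rightarrow> complex" where
  "osc a w = (\<integral>z. cis (w \<bullet> z) * a z \<partial>lborel)"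

lemma integrable_cis_mult:
  fixes a :: "'a::euclidean_space \<Rightarrow> complex"
  assumes "integrable lborel a"
  shows "integrable lborel (\<lambda>z. cis (w \<bullet> z) * a z)"
  by (rule Bochner_Integration.integrable_bound[OF assms]) (use assms in \<open>auto simp: norm_mult\<close>)

lemma measurable_osc [measurable]:
  assumes [measurable]: "a \<in> borel_measurable borel"
  shows "osc a \<in> borel_measurable borel"
  unfolding osc_def[abs_def] by measurable

lemma norm_osc_le:
  assumes "integrable lborel a"
  shows "norm (osc a w) \<le> (\<integral>z. norm (a z) \<partial>lborel)"
proof -
  have "norm (osc a w) \<le> (\<integral>z. norm (cis (w \<bullet> z) * a z) \<partial>lborel)"
    unfolding osc_def by (rule integral_norm_bound)
  then show ?thesis by (simp add: norm_mult)
qed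

text \<open>The Gaussian factor makes the double integral absolutely convergent. After Fubini the
  integral over \<open>w\<close> is again a Gaussian, centred at \<open>z\<close> and of width
  \<open>e\<close>.\<close>

lemma osc_gauss_regularised:
  fixes a :: "'a::euclidean_space \<Rightarrow> complex"
  assumes a: "integrable lborel a" and e: "e > 0"
  shows "(\<integral>w. cis (- (w \<bullet> z)) * osc a w * exp (- (norm (e *\<^sub>R w))\<^sup>2 / 2) \<partial>lborel) =
         (2 * pi) ^ DIM('a) * (\<integral>v. a (z + e *\<^sub>R v) * gauss v \<partial>lborel)"
proof -
  let ?N = "DIM('a)"
  have [measurable]: "a \<in> borel_measurable borel" using a by auto
  define E where "E w = exp (- (norm (e *\<^sub>R w))\<^sup>2 / 2)" for w :: 'a
  have Eg: "E w = sqrt (2 * pi) ^ ?N * gauss (e *\<^sub>R w)" for w by (simp add: E_def gauss_eq)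
  have [measurable]: "E \<in> borel_measurable borel" unfolding E_def by measurable
  have E0: "E w \<ge> 0" for w by (simp add: E_def)
  have intE: "integrable lborel E"
    using integral_gauss(1)[where 'a='a] integral_lborel_affine(2)[OF measurable_gauss, of e "0::'a"] e
    unfolding Eg[abs_def] by simp
  have inner: "(\<integral>w. cis (w \<bullet> (y - z)) * E w \<partial>lborel) = (2 * pi) ^ ?N / e ^ ?N * gauss ((1 / e) *\<^sub>R (y - z))" for y
  proof -
    have "(\<integral>w. cis (w \<bullet> (y - z)) * E w \<partial>lborel) = \<bar>1 / e\<bar> ^ ?N *\<^sub>R (\<integral>w. cis ((0 + (1 / e) *\<^sub>R w) \<bullet> (y - z)) * E (0 + (1 / e) *\<^sub>R w) \<partial>lborel)"
      using e by (intro integral_lborel_affine(1)) auto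
    also have "(\<integral>w. cis ((0 + (1 / e) *\<^sub>R w) \<bullet> (y - z)) * E (0 + (1 / e) *\<^sub>R w) \<partial>lborel)
       = (\<integral>w. sqrt (2 * pi) ^ ?N * (cis (((1 / e) *\<^sub>R (y - z)) \<bullet> w) * gauss w) \<partial>lborel)"
      using e by (intro Bochner_Integration.integral_cong) (auto simp: Eg inner_commute)
    also have "\<dots> = sqrt (2 * pi) ^ ?N * exp (- (norm ((1 / e) *\<^sub>R (y - z)))\<^sup>2 / 2)"
      by (subst integral_mult_right_zero, subst fourier_gauss(2)) simp
    also have "\<dots> = (2 * pi) ^ ?N * gauss ((1 / e) *\<^sub>R (y - z))"
    proof -
      have "(2 * pi) ^ ?N = sqrt (2 * pi) ^ ?N * sqrt (2 * pi) ^ ?N"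
        by (subst power_mult_distrib[symmetric]) simp
      then show ?thesis by (simp add: gauss_eq)
    qed
    finally show ?thesis using e by (simp add: scaleR_conv_of_real power_one_over)
  qed
  have pair: "integrable (lborel \<Otimes>\<^sub>M lborel) (\<lambda>(w, y). cis (w \<bullet> (y - z)) * E w * a y)"
  proof (rule lborel_pair.Fubini_integrable)
    have "(\<integral>y. norm (cis (w \<bullet> (y - z)) * E w * a y) \<partial>lborel) = E w * (\<integral>y. norm (a y) \<partial>lborel)" for w
      using E0[of w] by (simp add: norm_mult)
    then show "integrable lborel (\<lambda>w. \<integral>y. norm (case (w, y) of (w, y) \<Rightarrow> cis (w \<bullet> (y - z)) * E w * a y) \<partial>lborel)"
      using intE by simp
    show "AE w in lborel. integrable lborel (\<lambda>y. case (w, y) of (w, y) \<Rightarrow> cis (w \<bullet> (y - z)) * E w * a y)"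
    proof (intro AE_I2)
      fix w
      have "integrable lborel (\<lambda>y. E w * a y)" using a by simp
      then show "integrable lborel (\<lambda>y. case (w, y) of (w, y) \<Rightarrow> cis (w \<bullet> (y - z)) * E w * a y)"
        by (rule Bochner_Integration.integrable_bound) (auto simp: norm_mult)
    qed
  qed measurable
  have "(\<integral>w. cis (- (w \<bullet> z)) * osc a w * E w \<partial>lborel) = (\<integral>w. (\<integral>y. cis (w \<bullet> (y - z)) * E w * a y \<partial>lborel) \<partial>lborel)"
  proof (rule Bochner_Integration.integral_cong[OF refl])
    fix w
    have "cis (- (w \<bullet> z)) * osc a w * E w = (\<integral>y. (cis (- (w \<bullet> z)) * E w) * (cis (w \<bullet> y) * a y) \<partial>lborel)"
      unfolding osc_def by (subst integral_mult_right_zero) (simp only: mult_ac)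
    also have "\<dots> = (\<integral>y. cis (w \<bullet> (y - z)) * E w * a y \<partial>lborel)"
    proof (rule Bochner_Integration.integral_cong[OF refl])
      fix y
      have "cis (w \<bullet> (y - z)) = cis (- (w \<bullet> z)) * cis (w \<bullet> y)" by (simp add: cis_mult inner_diff_right)
      then show "cis (- (w \<bullet> z)) * E w * (cis (w \<bullet> y) * a y) = cis (w \<bullet> (y - z)) * E w * a y" by simp
    qed
    finally show "cis (- (w \<bullet> z)) * osc a w * E w = \<dots>" .
  qed
  also have "\<dots> = (\<integral>y. (\<integral>w. cis (w \<bullet> (y - z)) * E w * a y \<partial>lborel) \<partial>lborel)"
    using lborel_pair.Fubini_integral[OF pair] by simp
  also have "\<dots> = (\<integral>y. (2 * pi) ^ ?N / e ^ ?N * (a y * gauss ((1 / e) *\<^sub>R (y - z))) \<partial>lborel)"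
    by (intro Bochner_Integration.integral_cong[OF refl]) (simp add: inner)
  also have "\<dots> = (2 * pi) ^ ?N / e ^ ?N * (\<integral>y. a y * gauss ((1 / e) *\<^sub>R (y - z)) \<partial>lborel)"
    by simp
  also have "(\<integral>y. a y * gauss ((1 / e) *\<^sub>R (y - z)) \<partial>lborel) = \<bar>e\<bar> ^ ?N *\<^sub>R (\<integral>v. a (z + e *\<^sub>R v) * gauss ((1 / e) *\<^sub>R (z + e *\<^sub>R v - z)) \<partial>lborel)"
    using e by (intro integral_lborel_affine(1)) auto
  finally show ?thesis using e by (simp add: E_def scaleR_conv_of_real)
qed

text \<open>The limit of the regularised identity as the width tends to 0: on the left
  \<open>osc a\<close> itself dominates, on the right \<open>B\<close> times the Gaussian does, and
  continuity at the single point \<open>z\<close> identifies the limit.\<close>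

theorem osc_inversion:
  fixes a :: "'a::euclidean_space \<Rightarrow> complex"
  assumes a: "integrable lborel a" and bd: "\<And>y. norm (a y) \<le> B" and cont: "isCont a z"
    and k: "integrable lborel (osc a)"
  shows "(\<integral>w. cis (- (w \<bullet> z)) * osc a w \<partial>lborel) = (2 * pi) ^ DIM('a) * a z"
proof -
  have [measurable]: "a \<in> borel_measurable borel" using a by auto
  define e where "e n = 1 / real (Suc n)" for n
  have e: "e n > 0" for n by (simp add: e_def)
  have e0: "e \<longlonglongrightarrow> 0" unfolding e_def using LIMSEQ_inverse_real_of_nat by (simp add: inverse_eq_divide)
  have lim1: "(\<lambda>n. \<integral>w. cis (- (w \<bullet> z)) * osc a w * exp (- (norm (e n *\<^sub>R w))\<^sup>2 / 2) \<partial>lborel)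
     \<longlonglongrightarrow> (\<integral>w. cis (- (w \<bullet> z)) * osc a w \<partial>lborel)"
  proof (rule integral_dominated_convergence[where w="\<lambda>w. norm (osc a w)"])
    show "integrable lborel (\<lambda>w. norm (osc a w))" using k by simp
    have "(\<lambda>n. cis (- (w \<bullet> z)) * osc a w * exp (- (norm (e n *\<^sub>R w))\<^sup>2 / 2)) \<longlonglongrightarrow> cis (- (w \<bullet> z)) * osc a w * exp (- (norm (0 *\<^sub>R w))\<^sup>2 / 2)" for w
      by (intro tendsto_intros e0) auto
    then show "AE w in lborel. (\<lambda>n. cis (- (w \<bullet> z)) * osc a w * exp (- (norm (e n *\<^sub>R w))\<^sup>2 / 2)) \<longlonglongrightarrow> cis (- (w \<bullet> z)) * osc a w"
      by simp
  qed (auto simp: norm_mult intro!: mult_left_le)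
  have lim2: "(\<lambda>n. \<integral>v. a (z + e n *\<^sub>R v) * gauss v \<partial>lborel) \<longlonglongrightarrow> integral\<^sup>L lborel (\<lambda>v::'a. a z * gauss v)"
  proof (rule integral_dominated_convergence[where w="\<lambda>v. B * gauss v"])
    show "integrable lborel (\<lambda>v::'a. B * gauss v)" using integral_gauss(1)[where 'a='a] by simp
    have "(\<lambda>n. a (z + e n *\<^sub>R v)) \<longlonglongrightarrow> a z" for v
    proof (rule isCont_tendsto_compose[OF cont])
      have "(\<lambda>n. z + e n *\<^sub>R v) \<longlonglongrightarrow> z + 0 *\<^sub>R v" by (intro tendsto_intros e0)
      then show "(\<lambda>n. z + e n *\<^sub>R v) \<longlonglongrightarrow> z" by simp
    qed
    then show "AE v in lborel. (\<lambda>n. a (z + e n *\<^sub>R v) * gauss v) \<longlonglongrightarrow> a z * gauss v"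
      by (intro AE_I2 tendsto_mult tendsto_const)
    show "AE v in lborel. norm (a (z + e n *\<^sub>R v) * gauss v) \<le> B * gauss v" for n
      using bd by (intro AE_I2) (simp add: norm_mult gauss_nonneg abs_of_nonneg mult_right_mono)
  qed auto
  have "(\<lambda>n. (2 * pi) ^ DIM('a) * (\<integral>v. a (z + e n *\<^sub>R v) * gauss v \<partial>lborel)) \<longlonglongrightarrow> (2 * pi) ^ DIM('a) * integral\<^sup>L lborel (\<lambda>v::'a. a z * gauss v)"
    by (intro tendsto_mult tendsto_const lim2)
  then have "(\<lambda>n. \<integral>w. cis (- (w \<bullet> z)) * osc a w * exp (- (norm (e n *\<^sub>R w))\<^sup>2 / 2) \<partial>lborel) \<longlonglongrightarrow> (2 * pi) ^ DIM('a) * a z"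
    unfolding osc_gauss_regularised[OF a e] using integral_gauss[where 'a='a]
    by (simp add: integral_complex_of_real)
  then show ?thesis using LIMSEQ_unique[OF lim1] by blast
qed

text \<open>Inserting the inversion formula for \<open>a\<close> turns multiplication by
  \<open>a\<close> into convolution with its kernel \<open>osc a\<close>. Continuity is asked for
  almost everywhere only, since symbols may be singular at the origin.\<close>

lemma osc_pairing:
  fixes a H :: "'a::euclidean_space \<Rightarrow> complex"
  assumes a: "integrable lborel a" "\<And>y. norm (a y) \<le> B" "AE z in lborel. isCont a z"
    and k: "integrable lborel (osc a)" and H: "integrable lborel H"
  shows "(2 * pi) ^ DIM('a) * (\<integral>z. cis (x \<bullet> z) * a z * H z \<partial>lborel) = (\<integral>w. osc a w * osc H (x - w) \<partial>lborel)"
proof -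
  have [measurable]: "a \<in> borel_measurable borel" "H \<in> borel_measurable borel" using a H by auto
  have pair: "integrable (lborel \<Otimes>\<^sub>M lborel) (\<lambda>(w, z). cis ((x - w) \<bullet> z) * H z * osc a w)"
  proof (rule lborel_pair.Fubini_integrable)
    have "(\<integral>z. norm (cis ((x - w) \<bullet> z) * H z * osc a w) \<partial>lborel) = (\<integral>z. norm (H z) \<partial>lborel) * norm (osc a w)" for w
      by (simp add: norm_mult)
    then show "integrable lborel (\<lambda>w. \<integral>z. norm (case (w, z) of (w, z) \<Rightarrow> cis ((x - w) \<bullet> z) * H z * osc a w) \<partial>lborel)"
      using k by simp
    show "AE w in lborel. integrable lborel (\<lambda>z. case (w, z) of (w, z) \<Rightarrow> cis ((x - w) \<bullet> z) * H z * osc a w)"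
      using integrable_cis_mult[OF H] by (intro AE_I2) simp
  qed measurable
  have "(2 * pi) ^ DIM('a) * (\<integral>z. cis (x \<bullet> z) * a z * H z \<partial>lborel) = (\<integral>z. cis (x \<bullet> z) * H z * ((2 * pi) ^ DIM('a) * a z) \<partial>lborel)"
    by (simp add: mult_ac flip: integral_mult_right_zero)
  also have "\<dots> = (\<integral>z. (\<integral>w. cis ((x - w) \<bullet> z) * H z * osc a w \<partial>lborel) \<partial>lborel)"
  proof (rule integral_cong_AE)
    show "AE z in lborel. cis (x \<bullet> z) * H z * ((2 * pi) ^ DIM('a) * a z) = (\<integral>w. cis ((x - w) \<bullet> z) * H z * osc a w \<partial>lborel)"
      using a(3)
    proof eventually_elim
      case (elim z)
      have "cis (x \<bullet> z) * H z * ((2 * pi) ^ DIM('a) * a z) = (\<integral>w. cis (x \<bullet> z) * H z * (cis (- (w \<bullet> z)) * osc a w) \<partial>lborel)"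
        using osc_inversion[OF a(1,2) elim k] by simp
      also have "\<dots> = (\<integral>w. cis ((x - w) \<bullet> z) * H z * osc a w \<partial>lborel)"
      proof (rule Bochner_Integration.integral_cong[OF refl])
        fix w
        have "cis ((x - w) \<bullet> z) = cis (x \<bullet> z) * cis (- (w \<bullet> z))" by (simp add: cis_mult inner_diff_left)
        then show "cis (x \<bullet> z) * H z * (cis (- (w \<bullet> z)) * osc a w) = cis ((x - w) \<bullet> z) * H z * osc a w" by simp
      qed
      finally show ?case .
    qed
  qed measurable
  also have "\<dots> = (\<integral>w. (\<integral>z. cis ((x - w) \<bullet> z) * H z * osc a w \<partial>lborel) \<partial>lborel)"
    using lborel_pair.Fubini_integral[OF pair] by simp
  also have "\<dots> = (\<integral>w. osc a w * osc H (x - w) \<partial>lborel)"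
    by (intro Bochner_Integration.integral_cong) (auto simp: osc_def mult.commute)
  finally show ?thesis .
qed

section \<open>Decay of oscillatory integrals from derivatives\<close>

lemma has_vector_derivative_line_shift:
  fixes F :: "'a::real_normed_vector \<Rightarrow> 'b::real_normed_vector"
  assumes "((\<lambda>v. F ((z + u *\<^sub>R e) + v *\<^sub>R e)) has_vector_derivative D) (at 0)"
  shows "((\<lambda>v. F (z + v *\<^sub>R e)) has_vector_derivative D) (at u)"
proof -
  have "((\<lambda>v. F ((z + u *\<^sub>R e) + v *\<^sub>R e)) has_vector_derivative D) (at (u - u))"
    using assms by simp
  moreover have "((\<lambda>v. v - u) has_vector_derivative 1) (at u)"
    by (auto intro!: derivative_eq_intros)
  ultimately have "((\<lambda>v. F ((z + u *\<^sub>R e) + v *\<^sub>R e)) \<circ> (\<lambda>v. v - u) has_vector_derivative 1 *\<^sub>R D) (at u)"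
    by (intro vector_diff_chain_at)
  then show ?thesis by (simp add: o_def algebra_simps)
qed

text \<open>
  Translating by half a period \<open>\<pi> / (w \<bullet> e)\<close> changes the sign of the character, so no boundary terms
  at infinity have to be discussed, as they would be in an integration by parts.
\<close>

lemma osc_directional_derivative_bound:
  fixes h h' :: "'a::euclidean_space \<Rightarrow> complex"
  assumes h: "integrable lborel h" and h': "integrable lborel h'"
    and der: "AE z in lborel. \<forall>u. ((\<lambda>u. h (z + u *\<^sub>R e)) has_vector_derivative h' (z + u *\<^sub>R e)) (at u)"
    and cont: "AE z in lborel. continuous_on UNIV (\<lambda>u. h' (z + u *\<^sub>R e))"
  shows "\<bar>w \<bullet> e\<bar> * norm (osc h w) \<le> 2 * norm (osc h' w)"
proof (cases "w \<bullet> e = 0")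
  case False
  let ?t = "w \<bullet> e"
  define u where "u = pi / \<bar>?t\<bar>"
  have u: "u > 0" using False by (simp add: u_def)
  have [measurable]: "h \<in> borel_measurable borel" "h' \<in> borel_measurable borel" using h h' by auto
  have shift: "osc (\<lambda>z. f (z + v *\<^sub>R e)) w = cis (- (v * ?t)) * osc f w"
    if [measurable]: "f \<in> borel_measurable borel" for f v
  proof -
    have "osc f w = \<bar>1\<bar> ^ DIM('a) *\<^sub>R (\<integral>z. cis (w \<bullet> (v *\<^sub>R e + 1 *\<^sub>R z)) * f (v *\<^sub>R e + 1 *\<^sub>R z) \<partial>lborel)"
      unfolding osc_def by (rule integral_lborel_affine(1)) auto
    also have "\<dots> = (\<integral>z. cis (v * ?t) * (cis (w \<bullet> z) * f (z + v *\<^sub>R e)) \<partial>lborel)"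
      by (simp add: inner_add_right cis_mult[symmetric] mult_ac add.commute)
    also have "\<dots> = cis (v * ?t) * osc (\<lambda>z. f (z + v *\<^sub>R e)) w" by (simp add: osc_def)
    finally show ?thesis by (simp add: cis_mult mult.assoc[symmetric])
  qed
  have int_shift: "integrable lborel (\<lambda>z. f (z + v *\<^sub>R e))" if "integrable lborel f" for f :: "'a \<Rightarrow> complex" and v
    using integral_lborel_affine(2)[of f 1 "v *\<^sub>R e"] that by (auto simp: add.commute)
  have neg1: "cis (- (u * ?t)) = -1"
    using False by (cases "?t > 0") (auto simp: u_def complex_eq_iff)
  have pair: "integrable (lborel \<Otimes>\<^sub>M lborel) (\<lambda>(v, z). indicator {0..u} v *\<^sub>R (cis (w \<bullet> z) * h' (z + v *\<^sub>R e)))"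
  proof (rule lborel_pair.Fubini_integrable)
    have "(\<integral>z. norm (h' (z + v *\<^sub>R e)) \<partial>lborel) = (\<integral>z. norm (h' z) \<partial>lborel)" for v
      using integral_lborel_affine(1)[of "\<lambda>z. norm (h' z)" 1 "v *\<^sub>R e"] by (simp add: add.commute)
    then have "(\<integral>z. norm (indicator {0..u} v *\<^sub>R (cis (w \<bullet> z) * h' (z + v *\<^sub>R e))) \<partial>lborel) = indicator {0..u} v * (\<integral>z. norm (h' z) \<partial>lborel)" for v
      by (simp add: norm_mult)
    then show "integrable lborel (\<lambda>v. \<integral>z. norm (case (v, z) of (v, z) \<Rightarrow> indicator {0..u} v *\<^sub>R (cis (w \<bullet> z) * h' (z + v *\<^sub>R e))) \<partial>lborel)"
      by (simp only: prod.case) (simp add: integrable_real_indicator emeasure_lborel_Icc_eq)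
    show "AE v in lborel. integrable lborel (\<lambda>z. case (v, z) of (v, z) \<Rightarrow> indicator {0..u} v *\<^sub>R (cis (w \<bullet> z) * h' (z + v *\<^sub>R e)))"
      using integrable_cis_mult[OF int_shift[OF h']] by (intro AE_I2) simp
  qed measurable
  \<comment> \<open>By the fundamental theorem of calculus on each line in direction
    \<open>e\<close>, the shifted function minus the original is an integral of \<open>h'\<close>
    over an interval of length \<open>u\<close>; this is the origin of the factor
    \<open>pi / \<bar>w \<bullet> e\<bar>\<close>.\<close>
  have "- 2 * osc h w = osc (\<lambda>z. h (z + u *\<^sub>R e)) w - osc h w"
    by (simp add: shift neg1)
  also have "\<dots> = (\<integral>z. cis (w \<bullet> z) * (h (z + u *\<^sub>R e) - h z) \<partial>lborel)"
    unfolding osc_def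
    by (subst Bochner_Integration.integral_diff[symmetric])
      (auto intro!: integrable_cis_mult int_shift h simp: right_diff_distrib)
  also have "\<dots> = (\<integral>z. (\<integral>v. indicator {0..u} v *\<^sub>R (cis (w \<bullet> z) * h' (z + v *\<^sub>R e)) \<partial>lborel) \<partial>lborel)"
  proof (rule integral_cong_AE)
    show "AE z in lborel. cis (w \<bullet> z) * (h (z + u *\<^sub>R e) - h z) = (\<integral>v. indicator {0..u} v *\<^sub>R (cis (w \<bullet> z) * h' (z + v *\<^sub>R e)) \<partial>lborel)"
      using der cont
    proof eventually_elim
      case (elim z)
      have "(\<integral>v. indicator {0..u} v *\<^sub>R h' (z + v *\<^sub>R e) \<partial>lborel) = h (z + u *\<^sub>R e) - h (z + 0 *\<^sub>R e)"
        using u elim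
        by (intro integral_FTC_atLeastAtMost) (auto intro: has_vector_derivative_at_within continuous_on_subset)
      moreover have "(\<integral>v. indicator {0..u} v *\<^sub>R (cis (w \<bullet> z) * h' (z + v *\<^sub>R e)) \<partial>lborel) = cis (w \<bullet> z) * (\<integral>v. indicator {0..u} v *\<^sub>R h' (z + v *\<^sub>R e) \<partial>lborel)"
        by (simp flip: integral_mult_right_zero)
      ultimately show ?case by simp
    qed
  qed measurable
  also have "\<dots> = (\<integral>v. (\<integral>z. indicator {0..u} v *\<^sub>R (cis (w \<bullet> z) * h' (z + v *\<^sub>R e)) \<partial>lborel) \<partial>lborel)"
    using lborel_pair.Fubini_integral[OF pair] by simp
  also have "\<dots> = (\<integral>v. indicator {0..u} v *\<^sub>R (cis (- (v * ?t)) * osc h' w) \<partial>lborel)"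
    using shift[of h'] by (simp add: osc_def)
  finally have "norm (- 2 * osc h w) = norm (\<integral>v. indicator {0..u} v *\<^sub>R (cis (- (v * ?t)) * osc h' w) \<partial>lborel)"
    by simp
  also have "\<dots> \<le> (\<integral>v. norm (indicator {0..u} v *\<^sub>R (cis (- (v * ?t)) * osc h' w)) \<partial>lborel)"
    by (rule integral_norm_bound)
  also have "\<dots> = u * norm (osc h' w)" using u by (simp add: norm_mult)
  finally have "2 * norm (osc h w) \<le> pi / \<bar>?t\<bar> * norm (osc h' w)" by (simp add: norm_mult u_def)
  then have "2 * (\<bar>?t\<bar> * norm (osc h w)) \<le> pi * norm (osc h' w)" using False by (simp add: field_simps)
  also have "\<dots> \<le> 4 * norm (osc h' w)" using pi_less_4 by (intro mult_right_mono) auto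
  finally show ?thesis by simp
qed simp

section \<open>Symbols with controlled directional derivatives\<close>

text \<open>For \<open>\<kappa> = 1\<close> this is the Japanese bracket, for
  \<open>\<kappa> = 0\<close> the Euclidean norm.\<close>

definition bracket :: "real \<Rightarrow> 'a::euclidean_space \<Rightarrow> real" where
  "bracket \<kappa> z = sqrt (\<kappa> + z \<bullet> z)"

text \<open>
  \<open>dsym \<kappa> e L V a\<close>: the derivatives of \<open>a\<close> of order \<open>j \<le> L\<close> in the single direction \<open>e\<close>, taken off the
  origin, are continuous and bounded by \<open>V / (bracket \<kappa>)\<^sup>j\<close>. The constants are kept inside \<open>V\<close>, so
  that uniformity in \<open>x\<close> and in the scale \<open>l\<close> is automatic.
\<close>

primrec dsym :: "real \<Rightarrow> 'a::euclidean_space \<Rightarrow> nat \<Rightarrow> ('a \<Rightarrow> real) \<Rightarrow> ('a \<Rightarrow> complex) \<Rightarrow> bool" where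
  "dsym \<kappa> e 0 V a \<longleftrightarrow> continuous_on (- {0}) a \<and> (\<forall>z. z \<noteq> 0 \<longrightarrow> norm (a z) \<le> V z)"
| "dsym \<kappa> e (Suc L) V a \<longleftrightarrow> continuous_on (- {0}) a \<and> (\<forall>z. z \<noteq> 0 \<longrightarrow> norm (a z) \<le> V z) \<and>
     (\<exists>a'. (\<forall>z. z \<noteq> 0 \<longrightarrow> ((\<lambda>u. a (z + u *\<^sub>R e)) has_vector_derivative a' z) (at 0)) \<and>
           dsym \<kappa> e L (\<lambda>z. V z / bracket \<kappa> z) a')"

text \<open>One direction is fixed at a time: decay of the kernel in each coordinate separately is
  enough, and the product, quotient and chain rules stay one-dimensional.\<close>

locale scaled_direction =
  fixes \<kappa> :: real and e :: "'a::euclidean_space"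
  assumes kappa: "0 \<le> \<kappa>" and norm_e: "norm e = 1"
begin

abbreviation "R \<equiv> bracket \<kappa> :: 'a \<Rightarrow> real"
abbreviation "csym \<equiv> dsym \<kappa> e"

lemma R_pos: "z \<noteq> 0 \<Longrightarrow> R z > 0"
  using kappa by (simp add: bracket_def add_nonneg_pos)

lemma R_nonneg: "R z \<ge> 0"
  using kappa by (simp add: bracket_def)

lemma R_power2: "(R z)\<^sup>2 = \<kappa> + z \<bullet> z"
  using kappa by (simp add: bracket_def)

lemma norm_le_R: "norm z \<le> R z"
  using kappa by (simp add: bracket_def norm_eq_sqrt_inner)

lemma csymD:
  assumes "csym L V a"
  shows "continuous_on (- {0}) a" "z \<noteq> 0 \<Longrightarrow> norm (a z) \<le> V z" "z \<noteq> 0 \<Longrightarrow> 0 \<le> V z"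
proof -
  show "continuous_on (- {0}) a" using assms by (cases L) auto
  show *: "norm (a z) \<le> V z" if "z \<noteq> 0" using assms that by (cases L) auto
  show "0 \<le> V z" if "z \<noteq> 0" using *[OF that] norm_ge_zero order_trans by blast
qed

section \<open>Rules of calculation for symbols in one direction\<close>

lemma csym_SucI:
  assumes "continuous_on (- {0}) a" "\<And>z. z \<noteq> 0 \<Longrightarrow> norm (a z) \<le> V z"
    "\<And>z. z \<noteq> 0 \<Longrightarrow> ((\<lambda>u. a (z + u *\<^sub>R e)) has_vector_derivative a' z) (at 0)"
    "csym L (\<lambda>z. V z / R z) a'"
  shows "csym (Suc L) V a"
  unfolding dsym.simps(2) using assms by (intro conjI exI[of _ a'] allI impI) simp_all

lemma csym_mono: "csym L V a \<Longrightarrow> (\<And>z. z \<noteq> 0 \<Longrightarrow> V z \<le> W z) \<Longrightarrow> csym L W a"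
proof (induction L arbitrary: V W a)
  case 0
  then show ?case by (auto intro: order_trans)
next
  case (Suc L)
  then obtain a' where a': "\<forall>z. z \<noteq> 0 \<longrightarrow> ((\<lambda>u. a (z + u *\<^sub>R e)) has_vector_derivative a' z) (at 0)"
    "csym L (\<lambda>z. V z / R z) a'" by auto
  have "csym L (\<lambda>z. W z / R z) a'"
    by (rule Suc.IH[OF a'(2)]) (use Suc.prems R_pos in \<open>auto intro!: divide_right_mono simp: less_imp_le\<close>)
  then show ?case using Suc.prems a'(1) by (auto intro: order_trans)
qed

lemma csym_Suc_imp: "csym (Suc L) V a \<Longrightarrow> csym L V a"
proof (induction L arbitrary: V a)
  case (Suc L)
  then obtain a' where a': "\<forall>z. z \<noteq> 0 \<longrightarrow> ((\<lambda>u. a (z + u *\<^sub>R e)) has_vector_derivative a' z) (at 0)"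
    "csym (Suc L) (\<lambda>z. V z / R z) a'" by (auto simp del: dsym.simps(2) simp: dsym.simps(2)[of _ _ "Suc L"])
  then show ?case using Suc.IH[OF a'(2)] Suc.prems by auto
qed auto

lemma csym_0: "(\<And>z. z \<noteq> 0 \<Longrightarrow> 0 \<le> V z) \<Longrightarrow> csym L V (\<lambda>z. 0)"
proof (induction L arbitrary: V)
  case (Suc L)
  have "csym L (\<lambda>z. V z / R z) (\<lambda>z. 0)" by (rule Suc.IH) (use Suc.prems R_nonneg in auto)
  then show ?case using Suc.prems by (auto intro!: exI[of _ "\<lambda>z. 0"])
qed auto

lemma csym_const: "csym L (\<lambda>z. norm c) (\<lambda>z. c)"
proof (cases L)
  case (Suc l)
  have "csym l (\<lambda>z. norm c / R z) (\<lambda>z. 0)" by (rule csym_0) (use R_nonneg in auto)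
  then show ?thesis using Suc by (auto intro!: exI[of _ "\<lambda>z. 0"])
qed auto

lemma csym_add: "csym L V a \<Longrightarrow> csym L W b \<Longrightarrow> csym L (\<lambda>z. V z + W z) (\<lambda>z. a z + b z)"
proof (induction L arbitrary: V W a b)
  case 0
  then show ?case by (auto intro: continuous_on_add norm_add_rule_thm)
next
  case (Suc L)
  from Suc.prems obtain a' b' where a': "\<forall>z. z \<noteq> 0 \<longrightarrow> ((\<lambda>u. a (z + u *\<^sub>R e)) has_vector_derivative a' z) (at 0)"
    "csym L (\<lambda>z. V z / R z) a'"
    and b': "\<forall>z. z \<noteq> 0 \<longrightarrow> ((\<lambda>u. b (z + u *\<^sub>R e)) has_vector_derivative b' z) (at 0)"
    "csym L (\<lambda>z. W z / R z) b'" by auto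
  have "csym L (\<lambda>z. (V z + W z) / R z) (\<lambda>z. a' z + b' z)"
    using Suc.IH[OF a'(2) b'(2)] by (simp add: add_divide_distrib)
  then show ?case using Suc.prems a'(1) b'(1)
    by (auto intro!: continuous_on_add norm_add_rule_thm exI[of _ "\<lambda>z. a' z + b' z"] has_vector_derivative_add)
qed

lemma csym_cmult: "csym L V a \<Longrightarrow> csym L (\<lambda>z. norm c * V z) (\<lambda>z. c * a z)"
proof (induction L arbitrary: V a)
  case 0
  then show ?case by (auto intro!: continuous_intros mult_left_mono simp: norm_mult)
next
  case (Suc L)
  from Suc.prems obtain a' where a': "\<forall>z. z \<noteq> 0 \<longrightarrow> ((\<lambda>u. a (z + u *\<^sub>R e)) has_vector_derivative a' z) (at 0)"
    "csym L (\<lambda>z. V z / R z) a'" by auto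
  have "csym L (\<lambda>z. (norm c * V z) / R z) (\<lambda>z. c * a' z)"
    using Suc.IH[OF a'(2)] by simp
  then show ?case using Suc.prems a'(1)
    by (auto intro!: continuous_intros mult_left_mono exI[of _ "\<lambda>z. c * a' z"] has_vector_derivative_mult_right simp: norm_mult)
qed

text \<open>Each use of the product rule yields two terms, so the constant doubles with the
  order.\<close>

lemma csym_mult: "csym L V a \<Longrightarrow> csym L W b \<Longrightarrow> csym L (\<lambda>z. 2 ^ L * (V z * W z)) (\<lambda>z. a z * b z)"
proof (induction L arbitrary: V W a b)
  case 0
  then show ?case by (auto intro!: continuous_on_mult mult_mono simp: norm_mult intro: order_trans[OF norm_ge_zero])
next
  case (Suc L)
  from Suc.prems obtain a' b' where a': "\<forall>z. z \<noteq> 0 \<longrightarrow> ((\<lambda>u. a (z + u *\<^sub>R e)) has_vector_derivative a' z) (at 0)"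
    "csym L (\<lambda>z. V z / R z) a'"
    and b': "\<forall>z. z \<noteq> 0 \<longrightarrow> ((\<lambda>u. b (z + u *\<^sub>R e)) has_vector_derivative b' z) (at 0)"
    "csym L (\<lambda>z. W z / R z) b'" by auto
  have "csym L (\<lambda>z. 2 ^ L * (V z * (W z / R z)) + 2 ^ L * (V z / R z * W z)) (\<lambda>z. a z * b' z + a' z * b z)"
    using Suc.prems[THEN csym_Suc_imp] by (intro csym_add Suc.IH a' b')
  then have 1: "csym L (\<lambda>z. (2 ^ Suc L * (V z * W z)) / R z) (\<lambda>z. a z * b' z + a' z * b z)"
    by (simp add: mult_ac)
  have 2: "norm (a z * b z) \<le> 2 ^ Suc L * (V z * W z)" if "z \<noteq> 0" for z
  proof -
    have "norm (a z * b z) \<le> V z * W z" unfolding norm_mult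
      using csymD(2,3)[OF Suc.prems(1) that] csymD(2,3)[OF Suc.prems(2) that] by (intro mult_mono) auto
    also have "\<dots> \<le> 2 ^ Suc L * (V z * W z)"
      using csymD(3)[OF Suc.prems(1) that] csymD(3)[OF Suc.prems(2) that] one_le_power[of "2::real" "Suc L"]
      using mult_right_mono[of 1 "2 ^ Suc L" "V z * W z"] by simp
    finally show ?thesis .
  qed
  have 3: "((\<lambda>u. a (z + u *\<^sub>R e) * b (z + u *\<^sub>R e)) has_vector_derivative a z * b' z + a' z * b z) (at 0)" if "z \<noteq> 0" for z
    using has_vector_derivative_mult[OF a'(1)[rule_format, OF that] b'(1)[rule_format, OF that]] by simp
  have 4: "continuous_on (- {0}) (\<lambda>z. a z * b z)"
    by (intro continuous_on_mult csymD(1)[OF Suc.prems(1)] csymD(1)[OF Suc.prems(2)])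
  show ?case by (rule csym_SucI[OF 4 2 3 1])
qed

lemma csym_power: "csym L V a \<Longrightarrow> csym L (\<lambda>z. (2 ^ L * V z) ^ k) (\<lambda>z. a z ^ k)"
proof (induction k)
  case 0
  then show ?case using csym_const[of L 1] by simp
next
  case (Suc k)
  have "csym L (\<lambda>z. 2 ^ L * (V z * (2 ^ L * V z) ^ k)) (\<lambda>z. a z * a z ^ k)"
    by (intro csym_mult Suc)
  then show ?case by (simp add: mult_ac)
qed

text \<open>The constant is chosen before \<open>V\<close> and \<open>b\<close>, which later gives
  bounds uniform in the scale. The derivative of the inverse is \<open>- b'\<close> times two
  factors \<open>inverse b\<close>, and the induction hypothesis controls these to one order
  less.\<close>

lemma csym_inverse:
  assumes "c > 0"
  shows "\<exists>C>0. \<forall>V b. csym L V b \<longrightarrow> (\<forall>z. z \<noteq> 0 \<longrightarrow> 0 < V z \<and> c * V z \<le> norm (b z)) \<longrightarrow> csym L (\<lambda>z. C / V z) (\<lambda>z. inverse (b z))"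
proof (induction L)
  case 0
  show ?case
  proof (intro exI[of _ "1 / c"] conjI allI impI)
    fix V b assume *: "csym 0 V b" "\<forall>z. z \<noteq> 0 \<longrightarrow> 0 < V z \<and> c * V z \<le> norm (b z)"
    have nz: "b z \<noteq> 0" if "z \<noteq> 0" for z using *(2) that assms
      by (metis mult_pos_pos norm_zero not_le)
    have "norm (inverse (b z)) \<le> 1 / c / V z" if "z \<noteq> 0" for z
    proof -
      have "inverse (norm (b z)) \<le> inverse (c * V z)" using *(2) that assms by (intro le_imp_inverse_le) auto
      also have "\<dots> = 1 / c / V z" by (simp add: field_simps)
      finally show ?thesis by (simp only: norm_inverse)
    qed
    then show "csym 0 (\<lambda>z. 1 / c / V z) (\<lambda>z. inverse (b z))"
      using csymD(1)[OF *(1)] nz by (auto intro!: continuous_on_inverse)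
  qed (use assms in auto)
next
  case (Suc L)
  then obtain C where C: "C > 0" "\<And>V b. csym L V b \<Longrightarrow> (\<And>z. z \<noteq> 0 \<Longrightarrow> 0 < V z \<and> c * V z \<le> norm (b z)) \<Longrightarrow> csym L (\<lambda>z. C / V z) (\<lambda>z. inverse (b z))"
    by blast
  \<comment> \<open>The two entries bound the inverse itself and its derivative; the second collects
    the constants of two products and two inverses.\<close>
  define D where "D = max (1 / c) (2 ^ L * 2 ^ L * C * C)"
  show ?case
  proof (intro exI[of _ D] conjI allI impI)
    show "D > 0" using assms by (simp add: D_def less_max_iff_disj)
    fix V b assume *: "csym (Suc L) V b" "\<forall>z. z \<noteq> 0 \<longrightarrow> 0 < V z \<and> c * V z \<le> norm (b z)"
    from *(1) obtain b' where b': "\<forall>z. z \<noteq> 0 \<longrightarrow> ((\<lambda>u. b (z + u *\<^sub>R e)) has_vector_derivative b' z) (at 0)"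
      "csym L (\<lambda>z. V z / R z) b'" by auto
    have nz: "b z \<noteq> 0" if "z \<noteq> 0" for z using *(2) that assms
      by (metis mult_pos_pos norm_zero not_le)
    have IH: "csym L (\<lambda>z. C / V z) (\<lambda>z. inverse (b z))"
      using *(2) by (intro C(2) csym_Suc_imp[OF *(1)]) auto
    have "csym L (\<lambda>z. norm (-1::complex) * (2 ^ L * (2 ^ L * (V z / R z * (C / V z)) * (C / V z)))) (\<lambda>z. (-1) * (b' z * inverse (b z) * inverse (b z)))"
      by (intro csym_cmult csym_mult b' IH)
    also have "(\<lambda>z. (-1) * (b' z * inverse (b z) * inverse (b z))) = (\<lambda>z. - (b' z * inverse (b z) * inverse (b z)))"
      by simp
    finally have 1: "csym L (\<lambda>z. D / V z / R z) (\<lambda>z. - (b' z * inverse (b z) * inverse (b z)))"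
    proof (rule csym_mono)
      fix z :: 'a assume z: "z \<noteq> 0"
      have V: "V z > 0" using *(2) z by blast
      have "norm (-1::complex) * (2 ^ L * (2 ^ L * (V z / R z * (C / V z)) * (C / V z))) = (2 ^ L * 2 ^ L * C * C) / V z / R z"
        using V R_pos[OF z] by (simp add: field_simps)
      also have "\<dots> \<le> D / V z / R z"
        using V R_pos[OF z] by (intro divide_right_mono) (auto simp: D_def less_imp_le)
      finally show "norm (-1::complex) * (2 ^ L * (2 ^ L * (V z / R z * (C / V z)) * (C / V z))) \<le> D / V z / R z" .
    qed
    have 2: "norm (inverse (b z)) \<le> D / V z" if "z \<noteq> 0" for z
    proof -
      have "inverse (norm (b z)) \<le> inverse (c * V z)" using *(2) that assms by (intro le_imp_inverse_le) auto
      also have "\<dots> = (1 / c) / V z" by (simp add: field_simps)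
      also have "\<dots> \<le> D / V z" using *(2) that by (intro divide_right_mono) (auto simp: D_def less_imp_le)
      finally show ?thesis by (simp add: norm_inverse)
    qed
    have 3: "((\<lambda>u. inverse (b (z + u *\<^sub>R e))) has_vector_derivative - (b' z * inverse (b z) * inverse (b z))) (at 0)" if "z \<noteq> 0" for z
    proof -
      have "((\<lambda>u. b (z + u *\<^sub>R e)) has_vector_derivative b' z) (at 0)" using b'(1) that by blast
      moreover have "(inverse has_field_derivative - (inverse (b z) ^ Suc (Suc 0))) (at (b (z + 0 *\<^sub>R e)))"
        using DERIV_inverse[of "b z" UNIV] nz[OF that] by simp
      ultimately have "(inverse \<circ> (\<lambda>u. b (z + u *\<^sub>R e)) has_vector_derivative b' z * - (inverse (b z) ^ Suc (Suc 0))) (at 0)"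
        by (rule field_vector_diff_chain_at)
      then show ?thesis by (simp add: o_def mult_ac)
    qed
    have 4: "continuous_on (- {0}) (\<lambda>z. inverse (b z))"
      using csymD(1)[OF *(1)] nz by (auto intro!: continuous_on_inverse)
    show "csym (Suc L) (\<lambda>z. D / V z) (\<lambda>z. inverse (b z))" by (rule csym_SucI[OF 4 2 3 1])
  qed
qed

text \<open>The derivative in direction \<open>e\<close> is constant, and \<open>norm e = 1\<close>
  keeps it below \<open>norm v\<close>.\<close>

lemma csym_inner: "csym L (\<lambda>z. norm v * R z) (\<lambda>z. of_real (z \<bullet> v))"
proof -
  have bd: "norm (complex_of_real (z \<bullet> v)) \<le> norm v * R z" for z
    using Cauchy_Schwarz_ineq2[of z v] mult_right_mono[OF norm_le_R[of z], of "norm v"] by (simp add: mult.commute)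
  have cont: "continuous_on (- {0}) (\<lambda>z. complex_of_real (z \<bullet> v))" by (intro continuous_intros)
  show ?thesis
  proof (cases L)
    case 0
    then show ?thesis using bd cont by auto
  next
    case (Suc l)
    have 1: "csym l (\<lambda>z. norm v * R z / R z) (\<lambda>z. of_real (e \<bullet> v))"
    proof (rule csym_mono[OF csym_const])
      fix z :: 'a assume "z \<noteq> 0"
      then show "norm (complex_of_real (e \<bullet> v)) \<le> norm v * R z / R z"
        using Cauchy_Schwarz_ineq2[of e v] R_pos[of z] by (simp add: norm_e)
    qed
    have 2: "((\<lambda>u. complex_of_real ((z + u *\<^sub>R e) \<bullet> v)) has_vector_derivative of_real (e \<bullet> v)) (at 0)" for z
      unfolding inner_add_left inner_scaleR_left
      by (intro has_vector_derivative_of_real) (auto intro!: derivative_eq_intros)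
    show ?thesis unfolding Suc by (rule csym_SucI[OF cont bd 2 1])
  qed
qed

section \<open>Quadratic forms of orthogonal projections and their powers\<close>

text \<open>The hypothesis \<open>proj\<close> characterises the orthogonal projections among the linear maps.\<close>

context
  fixes T :: "'a \<Rightarrow> 'a"
  assumes T: "linear T" and proj: "\<And>z w. T z \<bullet> T w = z \<bullet> T w"
begin

definition qform :: "'a \<Rightarrow> real" where "qform z = \<kappa> + T z \<bullet> T z"

lemma norm_T_le: "norm (T z) \<le> norm z"
proof -
  have "norm (T z) * norm (T z) \<le> norm z * norm (T z)"
    using Cauchy_Schwarz_ineq2[of z "T z"] proj[of z z] by (simp add: power2_norm_eq_inner[symmetric] power2_eq_square)
  then show ?thesis by (cases "norm (T z) = 0") auto
qed

lemma qform_nonneg: "0 \<le> qform z"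
  using kappa by (simp add: qform_def)

lemma qform_le: "qform z \<le> (R z)\<^sup>2"
  using norm_T_le[of z] unfolding qform_def R_power2
  by (simp add: power2_norm_eq_inner[symmetric] power_mono)

lemma qform_shift: "qform (z + u *\<^sub>R e) = qform z + 2 * u * (z \<bullet> T e) + u\<^sup>2 * (T e \<bullet> T e)"
proof -
  have "T (z + u *\<^sub>R e) = T z + u *\<^sub>R T e" using T by (simp add: linear_add linear_scale)
  then show ?thesis
    by (simp add: qform_def inner_add_left inner_add_right proj[of z e] inner_commute[of "T e" "T z"] power2_eq_square algebra_simps)
qed

lemma continuous_qform: "continuous_on S qform"
proof -
  have "continuous_on S T" using T by (simp add: linear_continuous_on linear_conv_bounded_linear)
  then show ?thesis unfolding qform_def[abs_def] by (intro continuous_intros)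
qed

lemma qform_derivative: "((\<lambda>u. qform (z + u *\<^sub>R e)) has_field_derivative 2 * (z \<bullet> T e)) (at 0)"
  unfolding qform_shift by (auto intro!: derivative_eq_intros)

text \<open>The factor 2 is dictated by the derivative \<open>2 * (z \<bullet> T e)\<close>, which
  is at most \<open>2 * R z\<close>.\<close>

lemma csym_qform: "csym L (\<lambda>z. 2 * (R z)\<^sup>2) (\<lambda>z. of_real (qform z))"
proof -
  have cont: "continuous_on (- {0}) (\<lambda>z. complex_of_real (qform z))"
    by (intro continuous_intros continuous_qform)
  have bd: "norm (complex_of_real (qform z)) \<le> 2 * (R z)\<^sup>2" for z
    using qform_le[of z] qform_nonneg[of z] by simp
  show ?thesis
  proof (cases L)
    case 0
    then show ?thesis using bd cont by auto
  next
    case (Suc l)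
    have "csym l (\<lambda>z. norm (2::complex) * (norm (T e) * R z)) (\<lambda>z. 2 * of_real (z \<bullet> T e))"
      by (intro csym_cmult csym_inner)
    then have 1: "csym l (\<lambda>z. 2 * (R z)\<^sup>2 / R z) (\<lambda>z. 2 * of_real (z \<bullet> T e))"
    proof (rule csym_mono)
      fix z :: 'a assume "z \<noteq> 0"
      have "norm (T e) * R z \<le> 1 * R z" using norm_T_le[of e] norm_e by (intro mult_right_mono R_nonneg) auto
      then show "norm (2::complex) * (norm (T e) * R z) \<le> 2 * (R z)\<^sup>2 / R z"
        using R_pos[OF \<open>z \<noteq> 0\<close>] by (simp add: power2_eq_square)
    qed
    have 2: "((\<lambda>u. complex_of_real (qform (z + u *\<^sub>R e))) has_vector_derivative 2 * of_real (z \<bullet> T e)) (at 0)" for z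
      using has_vector_derivative_of_real[OF qform_derivative] by simp
    show ?thesis unfolding Suc by (rule csym_SucI[OF cont bd 2 1])
  qed
qed

text \<open>The chain rule fails where \<open>qform z\<close> vanishes, which happens only for
  \<open>\<kappa> = 0\<close> and \<open>T z = 0\<close>. There the form along the line is a
  multiple of \<open>u\<^sup>2\<close>, and since \<open>a > 1\<close> its power is of smaller order
  than \<open>u\<close>.\<close>

lemma qform_powr_derivative:
  assumes a: "a > 1"
  shows "((\<lambda>u. qform (z + u *\<^sub>R e) powr a) has_field_derivative a * qform z powr (a - 1) * (2 * (z \<bullet> T e))) (at 0)"
proof (cases "qform z = 0")
  case False
  then have "qform z > 0" using qform_nonneg[of z] by simp
  then show ?thesis using qform_derivative[of z] a
    by (auto intro!: derivative_eq_intros simp: powr_diff)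
next
  case True
  then have "T z \<bullet> T z = 0" using kappa unfolding qform_def by (smt (verit) inner_ge_zero)
  then have "T z = 0" by simp
  then have "z \<bullet> T e = 0" using proj[of z e] by simp
  then have q: "qform (z + u *\<^sub>R e) = u\<^sup>2 * (T e \<bullet> T e)" for u using True by (simp add: qform_shift)
  let ?c = "(T e \<bullet> T e) powr a"
  have "((\<lambda>u. (qform (z + u *\<^sub>R e) powr a - qform (z + 0 *\<^sub>R e) powr a) / (u - 0)) \<longlongrightarrow> 0) (at 0)"
  proof (rule Lim_null_comparison)
    show "((\<lambda>u::real. ?c * \<bar>u\<bar>) \<longlongrightarrow> 0) (at 0)" by (auto intro!: tendsto_eq_intros)
    have "eventually (\<lambda>u::real. \<bar>u\<bar> < 1 \<and> u \<noteq> 0) (at 0)"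
      unfolding eventually_at by (auto intro!: exI[of _ 1])
    then show "eventually (\<lambda>u. norm ((qform (z + u *\<^sub>R e) powr a - qform (z + 0 *\<^sub>R e) powr a) / (u - 0)) \<le> ?c * \<bar>u\<bar>) (at 0)"
    proof eventually_elim
      case (elim u)
      have "u\<^sup>2 = \<bar>u\<bar> powr 2" using elim by simp
      then have "(u\<^sup>2) powr a = \<bar>u\<bar> powr (2 * a)" by (simp only: powr_powr)
      also have "\<dots> \<le> \<bar>u\<bar> powr 2" using elim a by (intro powr_mono') auto
      also have "\<dots> = \<bar>u\<bar> * \<bar>u\<bar>" using elim by (simp add: power2_eq_square)
      finally have "(u\<^sup>2) powr a / \<bar>u\<bar> \<le> \<bar>u\<bar>" using elim by (simp add: divide_le_eq)
      then have "(u\<^sup>2) powr a / \<bar>u\<bar> * ?c \<le> \<bar>u\<bar> * ?c" by (intro mult_right_mono) auto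
      then show ?case using True by (simp add: q powr_mult mult_ac)
    qed
  qed
  then have "((\<lambda>u. qform (z + u *\<^sub>R e) powr a) has_field_derivative 0) (at 0)"
    by (simp add: has_field_derivative_iff)
  then show ?thesis using True by simp
qed

text \<open>A derivative replaces the exponent \<open>a\<close> by \<open>a - 1\<close> and gains a
  linear factor of size \<open>R z\<close>, so the order drops by one. The exponent has to stay
  positive after \<open>L\<close> steps because for \<open>\<kappa> = 0\<close> the form vanishes on
  the whole kernel of \<open>T\<close>.\<close>

lemma csym_qform_powr: "real L < a \<Longrightarrow> \<exists>C>0. csym L (\<lambda>z. C * R z powr (2 * a)) (\<lambda>z. of_real (qform z powr a))"
proof (induction L arbitrary: a)
  case 0
  have "continuous_on (- {0}) (\<lambda>z. complex_of_real (qform z powr a))"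
    using 0 qform_nonneg by (intro continuous_intros continuous_qform continuous_on_powr') auto
  moreover have "norm (complex_of_real (qform z powr a)) \<le> 1 * R z powr (2 * a)" for z
  proof -
    have "qform z powr a \<le> (R z)\<^sup>2 powr a" using 0 qform_le[of z] qform_nonneg[of z] by (intro powr_mono2) auto
    also have "\<dots> = R z powr (2 * a)" using R_nonneg[of z] by (cases "R z = 0") (simp_all add: powr_powr flip: powr_numeral)
    finally show ?thesis by simp
  qed
  ultimately show ?case by (intro exI[of _ 1]) auto
next
  case (Suc L)
  have a: "a > 1" using Suc.prems by simp
  obtain C where C: "C > 0" "csym L (\<lambda>z. C * R z powr (2 * (a - 1))) (\<lambda>z. of_real (qform z powr (a - 1)))"
    using Suc.IH[of "a - 1"] Suc.prems by auto
  define D where "D = max 1 (2 * a * 2 ^ L * C)"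
  have "csym L (\<lambda>z. norm (complex_of_real (2 * a)) * (2 ^ L * ((C * R z powr (2 * (a - 1))) * (norm (T e) * R z))))
     (\<lambda>z. of_real (2 * a) * (of_real (qform z powr (a - 1)) * of_real (z \<bullet> T e)))"
    by (intro csym_cmult csym_mult C csym_inner)
  also have "(\<lambda>z. complex_of_real (2 * a) * (of_real (qform z powr (a - 1)) * of_real (z \<bullet> T e)))
     = (\<lambda>z. of_real (a * qform z powr (a - 1) * (2 * (z \<bullet> T e))))"
    by (intro ext) simp
  finally have 1: "csym L (\<lambda>z. D * R z powr (2 * a) / R z) (\<lambda>z. of_real (a * qform z powr (a - 1) * (2 * (z \<bullet> T e))))"
  proof (rule csym_mono)
    fix z :: 'a assume z: "z \<noteq> 0"
    have r: "R z powr (2 * (a - 1)) * R z = R z powr (2 * a) / R z"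
    proof -
      have "R z powr (2 * (a - 1)) = R z powr (2 * a) / R z powr 2" by (simp add: powr_diff right_diff_distrib)
      then show ?thesis using R_pos[OF z] by (simp add: power2_eq_square)
    qed
    have "norm (complex_of_real (2 * a)) * (2 ^ L * ((C * R z powr (2 * (a - 1))) * (norm (T e) * R z)))
       = 2 * a * 2 ^ L * C * norm (T e) * (R z powr (2 * (a - 1)) * R z)" using a by simp
    also have "\<dots> = 2 * a * 2 ^ L * C * norm (T e) * (R z powr (2 * a) / R z)" by (simp only: r)
    also have "\<dots> \<le> D * (R z powr (2 * a) / R z)"
    proof (rule mult_right_mono)
      have "2 * a * 2 ^ L * C * norm (T e) \<le> 2 * a * 2 ^ L * C * 1"
        using norm_T_le[of e] norm_e a C(1) by (intro mult_left_mono) auto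
      then show "2 * a * 2 ^ L * C * norm (T e) \<le> D" by (simp add: D_def)
    qed (use R_nonneg in auto)
    finally show "norm (complex_of_real (2 * a)) * (2 ^ L * ((C * R z powr (2 * (a - 1))) * (norm (T e) * R z))) \<le> D * R z powr (2 * a) / R z"
      by simp
  qed
  have 2: "norm (complex_of_real (qform z powr a)) \<le> D * R z powr (2 * a)" for z
  proof -
    have "qform z powr a \<le> (R z)\<^sup>2 powr a" using a qform_le[of z] qform_nonneg[of z] by (intro powr_mono2) auto
    also have "\<dots> = 1 * R z powr (2 * a)" using R_nonneg[of z] by (cases "R z = 0") (simp_all add: powr_powr flip: powr_numeral)
    also have "\<dots> \<le> D * R z powr (2 * a)" by (intro mult_right_mono) (auto simp: D_def)
    finally show ?thesis by simp
  qed
  have 3: "((\<lambda>u. complex_of_real (qform (z + u *\<^sub>R e) powr a)) has_vector_derivative of_real (a * qform z powr (a - 1) * (2 * (z \<bullet> T e)))) (at 0)" for z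
    by (intro has_vector_derivative_of_real qform_powr_derivative a)
  have 4: "continuous_on (- {0}) (\<lambda>z. complex_of_real (qform z powr a))"
    using a qform_nonneg by (intro continuous_intros continuous_qform continuous_on_powr') auto
  have "D > 0" by (simp add: D_def)
  moreover have "csym (Suc L) (\<lambda>z. D * R z powr (2 * a)) (\<lambda>z. of_real (qform z powr a))"
    by (rule csym_SucI[OF 4 2 3 1])
  ultimately show ?case by blast
qed

end

end

section \<open>Kernel estimates and the continuous Littlewood-Paley decomposition\<close>

text \<open>The points whose line meets the origin form \<open>span {e}\<close>, a null set in
  dimension at least 2. Derivatives off the origin therefore suffice for the half-period argument on
  almost every line.\<close>

lemma AE_line_avoids_0:
  fixes e :: "'a::euclidean_space"
  assumes "DIM('a) \<ge> 2"
  shows "AE z in lborel. \<forall>u. z + u *\<^sub>R e \<noteq> 0"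
proof -
  have "dim (span {e}) < DIM('a)" using dim_le_card'[of "{e}"] assms by (simp add: dim_span)
  then have "negligible (span {e})" by (rule negligible_lowdim)
  moreover have "span {e} \<in> sets lborel" by (simp add: closed_span borel_closed)
  ultimately have "span {e} \<in> null_sets lborel"
    by (simp add: negligible_iff_null_sets null_sets_completion_iff)
  then have "AE z in lborel. z \<notin> span {e}" by (rule AE_not_in)
  then show ?thesis
  proof eventually_elim
    case (elim z)
    show ?case
    proof (intro allI notI)
      fix u assume "z + u *\<^sub>R e = 0"
      then have "z = (- u) *\<^sub>R e" by (simp add: eq_neg_iff_add_eq_0)
      then have "z \<in> span {e}" by (simp only:) (intro span_scale span_base, simp)
      then show False using elim by simp
    qed
  qed
qed

lemma measurable_continuous_off_0:
  fixes a :: "'a::euclidean_space \<Rightarrow> complex"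
  assumes "continuous_on (- {0}) a"
  shows "a \<in> borel_measurable borel"
proof -
  have [measurable]: "(\<lambda>z. indicator (- {0}) z *\<^sub>R a z) \<in> borel_measurable borel"
    using assms by (intro borel_measurable_continuous_on_indicator) auto
  have "a = (\<lambda>z. if z = 0 then a 0 else indicator (- {0}) z *\<^sub>R a z)" by (auto simp: fun_eq_iff)
  also have "\<dots> \<in> borel_measurable borel" by measurable
  finally show ?thesis .
qed

text \<open>The integral is, up to a power of \<open>l\<close>, the weighted average of the constant
  1 at scale \<open>1 / l\<close>, and the maximal function of the constant 1 is at most 1.\<close>

lemma integrable_weight:
  obtains C where "C > 0"
    "\<And>l. l > 0 \<Longrightarrow> integrable lborel (\<lambda>z::'a::euclidean_space. 1 / (1 + l * norm z) ^ (DIM('a) + 1))"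
    "\<And>l. l > 0 \<Longrightarrow> (\<integral>z. 1 / (1 + l * norm (z::'a)) ^ (DIM('a) + 1) \<partial>lborel) \<le> C * l powr (- real DIM('a))"
proof -
  let ?N = "DIM('a)"
  define C where "C = 2 ^ (DIM('a) + 2) * unit_ball_vol (real DIM('a))"
  have C: "C > 0" by (simp add: C_def)
  have max: "maximal (\<lambda>x::'a. ennreal 1) x \<le> 1" for x
    unfolding maximal_def
  proof (rule SUP_least, clarify)
    fix c :: 'a and r assume "x \<in> ball c r"
    then have r: "r > 0" by (metis ball_eq_empty empty_iff not_le)
    have "(\<integral>\<^sup>+y\<in>ball c r. ennreal 1 \<partial>lborel) = emeasure lborel (ball c r)" by simp
    then show "(\<integral>\<^sup>+y\<in>ball c r. ennreal 1 \<partial>lborel) / emeasure lborel (ball c r) \<le> 1"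
      using emeasure_ball_pos_finite[OF r, of c] by simp
  qed
  have nn: "(\<integral>\<^sup>+z. ennreal (1 / (1 + l * norm (z::'a)) ^ (?N + 1)) \<partial>lborel) \<le> ennreal (C * l powr (- real ?N))" if l: "l > 0" for l
  proof -
    have "(\<integral>\<^sup>+z. ennreal (1 / (1 + l * norm (z::'a)) ^ (?N + 1)) \<partial>lborel) =
       (\<integral>\<^sup>+z. ennreal (l powr (- real ?N)) * (ennreal (1 / ((1/l) ^ ?N * (1 + norm (z::'a) / (1/l)) ^ (?N + 1))) * ennreal 1) \<partial>lborel)"
    proof (rule nn_integral_cong)
      fix z :: 'a
      have "1 / (1 + l * norm z) ^ (?N + 1) = l powr (- real ?N) * (1 / ((1/l) ^ ?N * (1 + norm z / (1/l)) ^ (?N + 1)))"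
      proof -
        define Y where "Y = (1 / l) ^ ?N"
        have Y: "Y > 0" using l by (simp add: Y_def)
        have "l powr (- real ?N) = Y"
          using l by (simp add: Y_def powr_minus powr_realpow power_one_over inverse_eq_divide)
        moreover have "norm z / (1 / l) = l * norm z" by simp
        ultimately show ?thesis unfolding Y_def[symmetric] using Y by (simp add: mult.commute)
      qed
      then show "ennreal (1 / (1 + l * norm z) ^ (?N + 1)) = ennreal (l powr (- real ?N)) * (ennreal (1 / ((1/l) ^ ?N * (1 + norm z / (1/l)) ^ (?N + 1))) * ennreal 1)"
        using l by (simp flip: ennreal_mult)
    qed
    also have "\<dots> = ennreal (l powr (- real ?N)) * weighted_avg (1/l) (\<lambda>_. 1) (0::'a)"
      unfolding weighted_avg_def by (rule nn_integral_cmult) measurable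
    also have "\<dots> \<le> ennreal (l powr (- real ?N)) * (ennreal C * maximal (\<lambda>x::'a. ennreal 1) 0)"
      using l unfolding C_def by (intro mult_left_mono weighted_avg_le_maximal) auto
    also have "\<dots> \<le> ennreal (l powr (- real ?N)) * (ennreal C * 1)"
      by (intro mult_left_mono max) auto
    finally show ?thesis using C by (simp add: mult.commute flip: ennreal_mult)
  qed
  have int: "integrable lborel (\<lambda>z::'a. 1 / (1 + l * norm z) ^ (?N + 1))" if "l > 0" for l
  proof (rule integrableI_nonneg)
    show "(\<integral>\<^sup>+z. ennreal (1 / (1 + l * norm (z::'a)) ^ (?N + 1)) \<partial>lborel) < \<infinity>"
      using nn[OF that] ennreal_less_top order.strict_trans1 unfolding infinity_ennreal_def by blast
  qed (use that in auto)
  show ?thesis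
  proof (rule that[OF C int])
    fix l :: real assume l: "l > 0"
    have "ennreal (\<integral>z. 1 / (1 + l * norm (z::'a)) ^ (?N + 1) \<partial>lborel) = (\<integral>\<^sup>+z. ennreal (1 / (1 + l * norm (z::'a)) ^ (?N + 1)) \<partial>lborel)"
      using l by (intro nn_integral_eq_integral[symmetric] int) auto
    also note nn[OF l]
    finally show "(\<integral>z. 1 / (1 + l * norm (z::'a)) ^ (?N + 1) \<partial>lborel) \<le> C * l powr (- real ?N)"
      using C by (simp add: ennreal_le_iff)
  qed
qed

section \<open>Frequency localisation\<close>

lemma power2_power_eq_powr: "x > 0 \<Longrightarrow> (x\<^sup>2) ^ M = x powr (2 * real M)" for x :: real
  using powr_realpow[of x "2 * M"] by (simp add: power_mult)

lemma powr_le_one_plus_square_power: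
  assumes "x > (0::real)" "0 \<le> c" "c \<le> 2 * real M"
  shows "x powr (2 * real M - c) \<le> (1 + x\<^sup>2) ^ M"
proof (cases "x \<le> 1")
  case True
  have "x powr (2 * real M - c) \<le> 1" using assms True by (intro powr_le1) auto
  also have "1 \<le> (1 + x\<^sup>2) ^ M" by (simp add: one_le_power)
  finally show ?thesis .
next
  case False
  have "x powr (2 * real M - c) \<le> x powr (2 * real M)" using assms False by (intro powr_mono) auto
  also have "\<dots> = (x\<^sup>2) ^ M" using assms by (simp add: power2_power_eq_powr)
  also have "\<dots> \<le> (1 + x\<^sup>2) ^ M" by (intro power_mono) auto
  finally show ?thesis .
qed

text \<open>
  A rational function of \<open>l\<^sup>2 (bracket \<kappa>)\<^sup>2\<close> localising to frequencies of size \<open>1 / l\<close>; the factor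
  \<open>M\<close> gives the vanishing at low frequencies and \<open>K - M\<close> the decay at high frequencies.
\<close>

definition psi :: "real \<Rightarrow> nat \<Rightarrow> nat \<Rightarrow> real \<Rightarrow> 'a::euclidean_space \<Rightarrow> real" where
  "psi \<kappa> M K l z = (l\<^sup>2 * (bracket \<kappa> z)\<^sup>2) ^ M / (1 + l\<^sup>2 * (bracket \<kappa> z)\<^sup>2) ^ K"

lemma psi_nonneg: "0 \<le> psi \<kappa> M K l z"
  by (simp add: psi_def)

lemma measurable_psi [measurable (raw)]:
  assumes [measurable]: "f \<in> borel_measurable N" "g \<in> borel_measurable N"
  shows "(\<lambda>x. psi \<kappa> M K (f x) (g x)) \<in> borel_measurable N"
  unfolding psi_def bracket_def by measurable

text \<open>In the variable \<open>x = l * bracket \<kappa> z\<close> the left side is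
  \<open>l powr (s + j)\<close> times
  \<open>x powr (2 * M - s - j) / (1 + x\<^sup>2) ^ (M + P)\<close>. The exponent of
  \<open>x\<close> is nonnegative, so the singularity of
  \<open>bracket \<kappa> z powr (- s)\<close> at the origin is gone, and \<open>P\<close> factors
  of the denominator remain for decay.\<close>

lemma weight_bound:
  assumes z: "z \<noteq> 0" and k: "0 \<le> \<kappa>" and l: "l > 0" and s: "0 \<le> s" "s + real j \<le> 2 * real M"
  shows "bracket \<kappa> z powr (- s) * psi \<kappa> M (M + P) l z / bracket \<kappa> z ^ j \<le> l powr (s + real j) * (2 ^ P / (1 + l * norm z) ^ P)"
proof -
  let ?R = "bracket \<kappa> z"
  have R: "?R > 0" using z k by (simp add: bracket_def add_nonneg_pos)
  have nR: "norm z \<le> ?R" using k by (simp add: bracket_def norm_eq_sqrt_inner)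
  define x where "x = l * ?R"
  have x: "x > 0" using l R by (simp add: x_def)
  have x2: "l\<^sup>2 * ?R\<^sup>2 = x\<^sup>2" by (simp add: x_def power_mult_distrib)
  have "?R powr (- s) / ?R ^ j = ?R powr (- (s + real j))"
    using R by (simp add: powr_diff powr_minus powr_realpow divide_inverse powr_add)
  also have "\<dots> = l powr (s + real j) * x powr (- (s + real j))"
  proof -
    have "?R = x / l" using l by (simp add: x_def)
    then have "?R powr (- (s + real j)) = (x / l) powr (- (s + real j))" by (simp only:)
    also have "\<dots> = x powr (- (s + real j)) / l powr (- (s + real j))"
      using x l by (simp only: powr_divide less_imp_le)
    also have "\<dots> = l powr (s + real j) * x powr (- (s + real j))"
      unfolding powr_minus by (simp add: divide_inverse mult.commute)
    finally show ?thesis .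
  qed
  finally have eq1: "?R powr (- s) / ?R ^ j = l powr (s + real j) * x powr (- (s + real j))" .
  have eq2: "x powr (- (s + real j)) * (x\<^sup>2) ^ M = x powr (2 * real M - (s + real j))"
  proof -
    have "(x\<^sup>2) ^ M = x powr (2 * real M)" using x by (rule power2_power_eq_powr)
    moreover have "- (s + real j) + 2 * real M = 2 * real M - (s + real j)" by simp
    ultimately show ?thesis by (simp only: powr_add[symmetric])
  qed
  have "?R powr (- s) * psi \<kappa> M (M + P) l z / ?R ^ j = (?R powr (- s) / ?R ^ j) * ((x\<^sup>2) ^ M / (1 + x\<^sup>2) ^ (M + P))"
    by (simp add: psi_def x2)
  also have "\<dots> = l powr (s + real j) * ((x powr (- (s + real j)) * (x\<^sup>2) ^ M) / (1 + x\<^sup>2) ^ (M + P))"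
    unfolding eq1 by simp
  also have "\<dots> = l powr (s + real j) * (x powr (2 * real M - (s + real j)) / (1 + x\<^sup>2) ^ (M + P))"
    unfolding eq2 ..
  also have "\<dots> \<le> l powr (s + real j) * ((1 + x\<^sup>2) ^ M / (1 + x\<^sup>2) ^ (M + P))"
    using x s by (intro mult_left_mono divide_right_mono powr_le_one_plus_square_power) auto
  also have "(1 + x\<^sup>2) ^ M / (1 + x\<^sup>2) ^ (M + P) = 1 / (1 + x\<^sup>2) ^ P"
  proof -
    have "(1 + x\<^sup>2) ^ M \<noteq> 0" by (smt (verit) power_not_zero zero_le_power2)
    then show ?thesis by (simp add: power_add)
  qed
  also have "l powr (s + real j) * (1 / (1 + x\<^sup>2) ^ P) \<le> l powr (s + real j) * (2 ^ P / (1 + l * norm z) ^ P)"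
  proof (intro mult_left_mono)
    \<comment> \<open>Completing the square in \<open>1 + x\<^sup>2 - (1 + x) / 2\<close>.\<close>
    have "1 + x\<^sup>2 = (1 + x) / 2 + ((x - 1 / 4)\<^sup>2 + 7 / 16)" by (simp add: power2_eq_square field_simps)
    then have "(1 + x) / 2 \<le> 1 + x\<^sup>2" by simp
    moreover have "1 + l * norm z \<le> 1 + x" using nR l by (simp add: x_def)
    ultimately have "(1 + l * norm z) / 2 \<le> 1 + x\<^sup>2" by simp
    then have "((1 + l * norm z) / 2) ^ P \<le> (1 + x\<^sup>2) ^ P" using l by (intro power_mono) auto
    then have "1 / (1 + x\<^sup>2) ^ P \<le> 1 / ((1 + l * norm z) / 2) ^ P"
      using l by (intro divide_left_mono) (auto intro!: mult_pos_pos zero_less_power add_pos_nonneg)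
    then show "1 / (1 + x\<^sup>2) ^ P \<le> 2 ^ P / (1 + l * norm z) ^ P" by (simp add: power_divide)
  qed simp
  finally show ?thesis .
qed

context scaled_direction
begin

text \<open>Each derivative trades a factor \<open>\<bar>w \<bullet> e\<bar>\<close> for a factor 2
  and one power of \<open>1 / R\<close>.\<close>

lemma osc_decay:
  assumes "DIM('a) \<ge> 2"
  shows "csym L V a \<Longrightarrow> (\<And>j. j \<le> L \<Longrightarrow> integrable lborel (\<lambda>z. V z / R z ^ j)) \<Longrightarrow>
    \<bar>w \<bullet> e\<bar> ^ L * norm (osc a w) \<le> 2 ^ L * (\<integral>z. V z / R z ^ L \<partial>lborel)"
proof (induction L arbitrary: V a)
  case 0
  have [measurable]: "a \<in> borel_measurable borel" using csymD(1)[OF 0(1)] by (rule measurable_continuous_off_0)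
  have V: "integrable lborel V" using 0(2)[of 0] by simp
  have ae: "AE z in lborel. norm (a z) \<le> V z"
    using AE_lborel_singleton[of 0] by eventually_elim (use csymD(2)[OF 0(1)] in auto)
  have a: "integrable lborel a"
    by (rule Bochner_Integration.integrable_bound[OF V]) (use ae in auto)
  have "norm (osc a w) \<le> (\<integral>z. norm (a z) \<partial>lborel)" by (rule norm_osc_le[OF a])
  also have "\<dots> \<le> (\<integral>z. V z \<partial>lborel)" using a V ae by (intro integral_mono_AE) auto
  finally show ?case by simp
next
  case (Suc L)
  from Suc.prems(1) obtain a' where a': "\<forall>z. z \<noteq> 0 \<longrightarrow> ((\<lambda>u. a (z + u *\<^sub>R e)) has_vector_derivative a' z) (at 0)"
    "csym L (\<lambda>z. V z / R z) a'" by auto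
  have [measurable]: "a \<in> borel_measurable borel" "a' \<in> borel_measurable borel"
    using csymD(1)[OF Suc.prems(1)] csymD(1)[OF a'(2)] by (auto intro: measurable_continuous_off_0)
  have V: "integrable lborel V" using Suc.prems(2)[of 0] by simp
  have V': "integrable lborel (\<lambda>z. V z / R z)" using Suc.prems(2)[of 1] by simp
  have ae: "AE z in lborel. norm (a z) \<le> V z" "AE z in lborel. norm (a' z) \<le> V z / R z"
    using AE_lborel_singleton[of 0] by (eventually_elim; use csymD(2)[OF Suc.prems(1)] csymD(2)[OF a'(2)] in auto)+
  have a: "integrable lborel a"
  proof (rule Bochner_Integration.integrable_bound[OF V])
    show "AE z in lborel. norm (a z) \<le> norm (V z)" using ae(1) by eventually_elim simp
  qed measurable
  have ia': "integrable lborel a'"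
  proof (rule Bochner_Integration.integrable_bound[OF V'])
    show "AE z in lborel. norm (a' z) \<le> norm (V z / R z)" using ae(2) by eventually_elim (metis abs_ge_self order_trans real_norm_def)
  qed measurable
  have "\<bar>w \<bullet> e\<bar> * norm (osc a w) \<le> 2 * norm (osc a' w)"
  proof (rule osc_directional_derivative_bound[OF a ia'])
    show "AE z in lborel. \<forall>u. ((\<lambda>u. a (z + u *\<^sub>R e)) has_vector_derivative a' (z + u *\<^sub>R e)) (at u)"
      using AE_line_avoids_0[OF assms, of e]
    proof eventually_elim
      case (elim z)
      show ?case
      proof
        fix u
        have "z + u *\<^sub>R e \<noteq> 0" using elim by blast
        then have "((\<lambda>v. a ((z + u *\<^sub>R e) + v *\<^sub>R e)) has_vector_derivative a' (z + u *\<^sub>R e)) (at 0)"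
          using a'(1) by blast
        then show "((\<lambda>v. a (z + v *\<^sub>R e)) has_vector_derivative a' (z + u *\<^sub>R e)) (at u)"
          by (rule has_vector_derivative_line_shift[where F=a])
      qed
    qed
    show "AE z in lborel. continuous_on UNIV (\<lambda>u. a' (z + u *\<^sub>R e))"
      using AE_line_avoids_0[OF assms, of e]
    proof eventually_elim
      case (elim z)
      show ?case
        by (rule continuous_on_compose2[OF csymD(1)[OF a'(2)]]) (use elim in \<open>auto intro!: continuous_intros\<close>)
    qed
  qed
  then have "\<bar>w \<bullet> e\<bar> ^ L * (\<bar>w \<bullet> e\<bar> * norm (osc a w)) \<le> \<bar>w \<bullet> e\<bar> ^ L * (2 * norm (osc a' w))"
    by (intro mult_left_mono) auto
  also have "\<dots> = 2 * (\<bar>w \<bullet> e\<bar> ^ L * norm (osc a' w))" by simp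
  also have "\<dots> \<le> 2 * (2 ^ L * (\<integral>z. V z / R z / R z ^ L \<partial>lborel))"
  proof (intro mult_left_mono Suc.IH[OF a'(2)])
    fix j assume "j \<le> L"
    then show "integrable lborel (\<lambda>z. V z / R z / R z ^ j)" using Suc.prems(2)[of "Suc j"] by simp
  qed simp
  finally show ?case by (simp add: mult_ac)
qed

text \<open>The function is rational in the quadratic form of the identity. The rules of calculation
  carry \<open>l\<close> inside their bounds, so the constant does not depend on it.\<close>

lemma csym_psi: "\<exists>C>0. \<forall>l>0. csym L (\<lambda>z. C * psi \<kappa> M K l z) (\<lambda>z. of_real (psi \<kappa> M K l z))"
proof -
  have id: "linear (\<lambda>z::'a. z)" by (rule linear_ident)
  have q: "qform (\<lambda>z. z) z = (R z)\<^sup>2" for z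
    using qform_def[OF id, of z] by (simp add: R_power2)
  \<comment> \<open>\<open>1/2\<close> suffices since the sum rule bounds the denominator by
    \<open>1 + 2 * (l\<^sup>2 * (R z)\<^sup>2)\<close>, which is at most twice its actual
    value.\<close>
  obtain C where C: "C > 0" "\<And>V b. csym L V b \<Longrightarrow> (\<And>z. z \<noteq> 0 \<Longrightarrow> 0 < V z \<and> 1/2 * V z \<le> norm (b z)) \<Longrightarrow> csym L (\<lambda>z. C / V z) (\<lambda>z. inverse (b z))"
    using csym_inverse[of "1/2" L] by auto
  define D where "D = 2 ^ L * ((2 ^ L * 2) ^ M * (2 ^ L * C) ^ K)"
  have "csym L (\<lambda>z. D * psi \<kappa> M K l z) (\<lambda>z. of_real (psi \<kappa> M K l z))" if l: "l > 0" for l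
  proof -
    have 1: "csym L (\<lambda>z. norm (complex_of_real (l\<^sup>2)) * (2 * (R z)\<^sup>2)) (\<lambda>z. of_real (l\<^sup>2) * of_real ((R z)\<^sup>2))"
      using csym_cmult[OF csym_qform[OF id], of L "of_real (l\<^sup>2)"] by (simp only: q)
    have 2: "csym L (\<lambda>z. C / (norm (1::complex) + norm (complex_of_real (l\<^sup>2)) * (2 * (R z)\<^sup>2))) (\<lambda>z. inverse (1 + of_real (l\<^sup>2) * of_real ((R z)\<^sup>2)))"
    proof (rule C(2)[OF csym_add[OF csym_const 1]])
      fix z :: 'a
      have aux: "0 < Y \<and> 1/2 * Y \<le> X" if "0 \<le> t" "X = 1 + t" "Y = 1 + 2 * t" for t X Y :: real
        using that by simp
      have "norm (1 + complex_of_real (l\<^sup>2) * of_real ((R z)\<^sup>2)) = 1 + l\<^sup>2 * (R z)\<^sup>2"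
      proof -
        have "1 + complex_of_real (l\<^sup>2) * of_real ((R z)\<^sup>2) = of_real (1 + l\<^sup>2 * (R z)\<^sup>2)" by simp
        then show ?thesis by (simp only: norm_of_real) simp
      qed
      moreover have "norm (1::complex) + norm (complex_of_real (l\<^sup>2)) * (2 * (R z)\<^sup>2) = 1 + 2 * (l\<^sup>2 * (R z)\<^sup>2)" by (simp add: norm_power)
      moreover have "0 \<le> l\<^sup>2 * (R z)\<^sup>2" by simp
      ultimately show "0 < norm (1::complex) + norm (complex_of_real (l\<^sup>2)) * (2 * (R z)\<^sup>2) \<and>
         1/2 * (norm (1::complex) + norm (complex_of_real (l\<^sup>2)) * (2 * (R z)\<^sup>2)) \<le> norm (1 + complex_of_real (l\<^sup>2) * of_real ((R z)\<^sup>2))"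
        by (intro aux[of "l\<^sup>2 * (R z)\<^sup>2"])
    qed
    have 3: "csym L (\<lambda>z. C / (1 + l\<^sup>2 * (R z)\<^sup>2)) (\<lambda>z. inverse (1 + of_real (l\<^sup>2) * of_real ((R z)\<^sup>2)))"
    proof (rule csym_mono[OF 2])
      fix z :: 'a
      have "0 \<le> l\<^sup>2 * (R z)\<^sup>2" by simp
      then have "C / (1 + 2 * (l\<^sup>2 * (R z)\<^sup>2)) \<le> C / (1 + l\<^sup>2 * (R z)\<^sup>2)"
        using C(1) by (intro divide_left_mono mult_pos_pos) linarith+
      then show "C / (norm (1::complex) + norm (complex_of_real (l\<^sup>2)) * (2 * (R z)\<^sup>2)) \<le> C / (1 + l\<^sup>2 * (R z)\<^sup>2)"
        by (simp add: norm_power mult.left_commute)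
    qed
    have 4: "csym L (\<lambda>z. 2 ^ L * ((2 ^ L * (norm (complex_of_real (l\<^sup>2)) * (2 * (R z)\<^sup>2))) ^ M * (2 ^ L * (C / (1 + l\<^sup>2 * (R z)\<^sup>2))) ^ K))
      (\<lambda>z. (of_real (l\<^sup>2) * of_real ((R z)\<^sup>2)) ^ M * (inverse (1 + of_real (l\<^sup>2) * of_real ((R z)\<^sup>2))) ^ K)"
      by (intro csym_mult csym_power 1 3)
    have eV: "2 ^ L * ((2 ^ L * (norm (complex_of_real (l\<^sup>2)) * (2 * (R z)\<^sup>2))) ^ M * (2 ^ L * (C / (1 + l\<^sup>2 * (R z)\<^sup>2))) ^ K) = D * psi \<kappa> M K l z" for z
      by (simp add: D_def psi_def norm_power power_mult_distrib power_divide)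
    have ea: "(of_real (l\<^sup>2) * of_real ((R z)\<^sup>2)) ^ M * (inverse (1 + of_real (l\<^sup>2) * of_real ((R z)\<^sup>2))) ^ K = complex_of_real (psi \<kappa> M K l z)" for z
      by (simp add: psi_def power_inverse divide_inverse)
    show ?thesis using 4 by (simp only: eV ea)
  qed
  moreover have "D > 0" using C(1) by (simp add: D_def)
  ultimately show ?thesis by blast
qed

text \<open>The localised symbol has size \<open>l powr s\<close> and is essentially concentrated
  where \<open>norm z\<close> is at most of size \<open>1 / l\<close>, a region of volume comparable
  to \<open>l powr (- DIM('a))\<close>. Each derivative contributes a factor \<open>l\<close>, which
  is absorbed by measuring \<open>w\<close> in units of \<open>l\<close>.\<close>

lemma osc_localised_bound:
  assumes DIM: "DIM('a) \<ge> 2" and s: "0 \<le> s" "s + real L \<le> 2 * real M" and C0: "C0 \<ge> 0"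
  shows "\<exists>D>0. \<forall>l>0. \<forall>a. csym L (\<lambda>z. C0 * R z powr (- s)) a \<longrightarrow>
    integrable lborel (\<lambda>z. a z * psi \<kappa> M (M + (DIM('a) + 1)) l z) \<and>
    (\<forall>z. z \<noteq> 0 \<longrightarrow> norm (a z * psi \<kappa> M (M + (DIM('a) + 1)) l z) \<le> D * l powr s) \<and>
    (\<forall>w. norm (osc (\<lambda>z. a z * psi \<kappa> M (M + (DIM('a) + 1)) l z) w) \<le> D * l powr (s - real DIM('a)) \<and>
         (\<bar>w \<bullet> e\<bar> / l) ^ L * norm (osc (\<lambda>z. a z * psi \<kappa> M (M + (DIM('a) + 1)) l z) w) \<le> D * l powr (s - real DIM('a)))"
proof -
  let ?P = "DIM('a) + 1"
  obtain C1 where C1: "C1 > 0" "\<And>l. l > 0 \<Longrightarrow> csym L (\<lambda>z. C1 * psi \<kappa> M (M + ?P) l z) (\<lambda>z. of_real (psi \<kappa> M (M + ?P) l z))"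
    using csym_psi by blast
  obtain C2 where C2: "C2 > 0"
    "\<And>l. l > 0 \<Longrightarrow> integrable lborel (\<lambda>z::'a::euclidean_space. 1 / (1 + l * norm z) ^ ?P)"
    "\<And>l. l > 0 \<Longrightarrow> (\<integral>z. 1 / (1 + l * norm (z::'a)) ^ ?P \<partial>lborel) \<le> C2 * l powr (- real DIM('a))"
    using integrable_weight[where 'a='a] by blast
  define B where "B = 2 ^ L * C0 * C1 * 2 ^ ?P"
  have B: "B \<ge> 0" using C0 C1(1) by (simp add: B_def)
  \<comment> \<open>One constant for three bounds: \<open>B\<close> for the size of the symbol,
    multiples of \<open>B * C2\<close> for its kernel without and with the factor
    \<open>(\<bar>w \<bullet> e\<bar> / l) ^ L\<close>.\<close>
  define D where "D = max 1 (B + 2 ^ L * B * C2)"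
  have DB: "B \<le> D" "2 ^ L * B * C2 \<le> D" "B * C2 \<le> D"
  proof -
    have "0 \<le> 2 ^ L * B * C2" using B C2(1) by simp
    moreover have "B * C2 \<le> 2 ^ L * (B * C2)"
      using B C2(1) mult_right_mono[of 1 "2 ^ L" "B * C2"] by simp
    ultimately show "B \<le> D" "2 ^ L * B * C2 \<le> D" "B * C2 \<le> D" using B by (auto simp: D_def)
  qed
  show ?thesis
  proof (intro exI[of _ D] conjI allI impI)
    show "D > 0" by (simp add: D_def)
    fix l a assume l: "l > (0::real)" and a: "csym L (\<lambda>z. C0 * R z powr (- s)) a"
    define b where "b z = a z * psi \<kappa> M (M + ?P) l z" for z
    define V where "V z = 2 ^ L * (C0 * R z powr (- s) * (C1 * psi \<kappa> M (M + ?P) l z))" for z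
    have b: "csym L V b" unfolding V_def b_def by (intro csym_mult a C1(2) l)
    have [measurable]: "b \<in> borel_measurable borel" using csymD(1)[OF b] by (rule measurable_continuous_off_0)
    have V0: "V z \<ge> 0" for z using C0 C1(1) by (simp add: V_def psi_nonneg)
    have Vle: "V z / R z ^ j \<le> B * l powr (s + real j) * (1 / (1 + l * norm z) ^ ?P)" if "z \<noteq> 0" "j \<le> L" for z j
    proof -
      have "V z / R z ^ j = 2 ^ L * C0 * C1 * (R z powr (- s) * psi \<kappa> M (M + ?P) l z / R z ^ j)" by (simp add: V_def)
      also have "\<dots> \<le> 2 ^ L * C0 * C1 * (l powr (s + real j) * (2 ^ ?P / (1 + l * norm z) ^ ?P))"
        using C0 C1(1) s that by (intro mult_left_mono weight_bound kappa l) auto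
      also have "\<dots> = B * l powr (s + real j) * (1 / (1 + l * norm z) ^ ?P)" by (simp add: B_def)
      finally show ?thesis .
    qed
    have [measurable]: "V \<in> borel_measurable borel" unfolding V_def[abs_def] bracket_def[abs_def] by measurable
    have [measurable]: "R \<in> borel_measurable borel" unfolding bracket_def[abs_def] by measurable
    have ae: "AE z in lborel. norm (V z / R z ^ j) \<le> B * l powr (s + real j) * (1 / (1 + l * norm z) ^ ?P)" if "j \<le> L" for j
      using AE_lborel_singleton[of 0]
    proof eventually_elim
      case (elim z)
      have "0 \<le> V z / R z ^ j" using V0 R_nonneg by simp
      then show ?case using Vle[OF elim that] by simp
    qed
    have int: "integrable lborel (\<lambda>z. V z / R z ^ j)" if "j \<le> L" for j
    proof (rule Bochner_Integration.integrable_bound)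
      show "integrable lborel (\<lambda>z. B * l powr (s + real j) * (1 / (1 + l * norm (z::'a)) ^ ?P))"
        by (intro integrable_mult_right C2(2) l)
      show "AE z in lborel. norm (V z / R z ^ j) \<le> norm (B * l powr (s + real j) * (1 / (1 + l * norm z) ^ ?P))"
        using ae[OF that] by eventually_elim (metis abs_ge_self order_trans real_norm_def)
    qed measurable
    have intle: "(\<integral>z. V z / R z ^ j \<partial>lborel) \<le> B * C2 * l powr (s + real j - real DIM('a))" if "j \<le> L" for j
    proof -
      have "(\<integral>z. V z / R z ^ j \<partial>lborel) \<le> (\<integral>z. B * l powr (s + real j) * (1 / (1 + l * norm (z::'a)) ^ ?P) \<partial>lborel)"
      proof (rule integral_mono_AE)
        show "AE z in lborel. V z / R z ^ j \<le> B * l powr (s + real j) * (1 / (1 + l * norm z) ^ ?P)"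
          using ae[OF that] by eventually_elim (metis abs_ge_self order_trans real_norm_def)
      qed (intro int that integrable_mult_right C2(2) l)+
      also have "\<dots> = B * l powr (s + real j) * (\<integral>z. 1 / (1 + l * norm (z::'a)) ^ ?P \<partial>lborel)"
        by (rule Bochner_Integration.integral_mult_right_zero)
      also have "\<dots> \<le> B * l powr (s + real j) * (C2 * l powr (- real DIM('a)))"
        using B by (intro mult_left_mono C2(3) l) auto
      also have "\<dots> = B * C2 * (l powr (s + real j) * l powr (- real DIM('a)))" by simp
      finally show ?thesis by (simp flip: powr_add)
    qed
    have intb: "integrable lborel b"
    proof (rule Bochner_Integration.integrable_bound)
      show "integrable lborel V" using int[of 0] by simp
      show "AE z in lborel. norm (b z) \<le> norm (V z)"
        using AE_lborel_singleton[of 0]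
      proof eventually_elim
        case (elim z)
        then show ?case using csymD(2)[OF b elim] by simp
      qed
    qed measurable
    then show "integrable lborel (\<lambda>z. a z * psi \<kappa> M (M + ?P) l z)" by (simp add: b_def[abs_def])
    show "norm (a z * psi \<kappa> M (M + ?P) l z) \<le> D * l powr s" if "z \<noteq> 0" for z
    proof -
      have "norm (b z) \<le> V z" using csymD(2)[OF b that] .
      also have "\<dots> \<le> B * l powr s * (1 / (1 + l * norm z) ^ ?P)" using Vle[OF that, of 0] by simp
      also have "\<dots> \<le> B * l powr s * 1"
      proof (rule mult_left_mono)
        have "1 \<le> (1 + l * norm z) ^ ?P" using l by (intro one_le_power) simp
        then show "1 / (1 + l * norm z) ^ ?P \<le> 1" by (simp add: divide_le_eq_1)
      qed (use B in simp)
      also have "\<dots> \<le> D * l powr s" using DB(1) by (simp add: mult_right_mono)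
      finally show ?thesis by (simp add: b_def)
    qed
    fix w
    have "norm (osc b w) \<le> (\<integral>z. norm (b z) \<partial>lborel)" by (rule norm_osc_le[OF intb])
    also have "\<dots> \<le> (\<integral>z. V z / R z ^ 0 \<partial>lborel)"
    proof (rule integral_mono_AE)
      show "AE z in lborel. norm (b z) \<le> V z / R z ^ 0"
        using AE_lborel_singleton[of 0] by eventually_elim (use csymD(2)[OF b] in auto)
      show "integrable lborel (\<lambda>z. norm (b z))" using intb by simp
      show "integrable lborel (\<lambda>z. V z / R z ^ 0)" by (rule int) simp
    qed
    also have "\<dots> \<le> B * C2 * l powr (s + real 0 - real DIM('a))" by (rule intle) simp
    also have "\<dots> \<le> D * l powr (s - real DIM('a))" using DB(3) by (simp add: mult_right_mono)
    finally show "norm (osc (\<lambda>z. a z * psi \<kappa> M (M + ?P) l z) w) \<le> D * l powr (s - real DIM('a))"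
      by (simp add: b_def[abs_def])
    have "\<bar>w \<bullet> e\<bar> ^ L * norm (osc b w) \<le> 2 ^ L * (\<integral>z. V z / R z ^ L \<partial>lborel)"
      by (rule osc_decay[OF DIM b int])
    also have "\<dots> \<le> 2 ^ L * (B * C2 * l powr (s + real L - real DIM('a)))"
      by (intro mult_left_mono intle) auto
    finally have "(\<bar>w \<bullet> e\<bar> ^ L * norm (osc b w)) / l ^ L \<le> 2 ^ L * (B * C2 * l powr (s + real L - real DIM('a))) / l ^ L"
      using l by (intro divide_right_mono) auto
    also have "\<dots> = 2 ^ L * B * C2 * l powr (s - real DIM('a))"
    proof -
      have "l powr (s + real L - real DIM('a)) = l powr (s - real DIM('a)) * l ^ L"
        using l by (simp add: powr_add[symmetric] powr_realpow[symmetric] algebra_simps)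
      then show ?thesis using l by simp
    qed
    also have "\<dots> \<le> D * l powr (s - real DIM('a))" using DB(2) by (intro mult_right_mono) auto
    finally show "(\<bar>w \<bullet> e\<bar> / l) ^ L * norm (osc (\<lambda>z. a z * psi \<kappa> M (M + ?P) l z) w) \<le> D * l powr (s - real DIM('a))"
      by (simp add: b_def[abs_def] power_divide)
  qed
qed

end

text \<open>Some coordinate of \<open>w\<close> has absolute value at least
  \<open>norm w / DIM('a)\<close>, so decay in the coordinates one at a time is decay in
  \<open>norm w\<close>; for \<open>norm w \<le> 1\<close> the bound on \<open>k\<close> alone is
  enough.\<close>

lemma coordinatewise_decay:
  fixes w :: "'a::euclidean_space"
  assumes "\<And>b. b \<in> Basis \<Longrightarrow> \<bar>w \<bullet> b\<bar> ^ L * k \<le> A" "k \<le> A" "0 \<le> k"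
  shows "(1 + norm w) ^ L * k \<le> (2 * real DIM('a)) ^ L * A"
proof -
  have A: "A \<ge> 0" using assms by linarith
  have N: "real DIM('a) \<ge> 1" using DIM_positive[where 'a='a] by linarith
  show ?thesis
  proof (cases "norm w \<le> 1")
    case True
    have "(1 + norm w) ^ L \<le> (2 * real DIM('a)) ^ L"
    proof (rule power_mono)
      show "1 + norm w \<le> 2 * real DIM('a)" using True N by linarith
    qed simp
    then show ?thesis using assms A by (intro mult_mono) auto
  next
    case False
    have "\<exists>b\<in>Basis. norm w \<le> real DIM('a) * \<bar>w \<bullet> b\<bar>"
    proof (rule ccontr)
      assume *: "\<not> (\<exists>b\<in>Basis. norm w \<le> real DIM('a) * \<bar>w \<bullet> b\<bar>)"
      have "norm w \<le> (\<Sum>b\<in>Basis. \<bar>w \<bullet> b\<bar>)" by (rule norm_le_l1)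
      also have "\<dots> < (\<Sum>b\<in>(Basis::'a set). norm w / real DIM('a))"
        using * N by (intro sum_strict_mono) (auto simp: field_simps not_le)
      also have "\<dots> = norm w" using N by simp
      finally show False by simp
    qed
    then obtain b where b: "b \<in> Basis" "norm w \<le> real DIM('a) * \<bar>w \<bullet> b\<bar>" by blast
    have "1 + norm w \<le> 2 * real DIM('a) * \<bar>w \<bullet> b\<bar>" using False b(2) by linarith
    then have "(1 + norm w) ^ L \<le> (2 * real DIM('a) * \<bar>w \<bullet> b\<bar>) ^ L" by (intro power_mono) auto
    then have "(1 + norm w) ^ L * k \<le> (2 * real DIM('a) * \<bar>w \<bullet> b\<bar>) ^ L * k"
      using assms by (intro mult_right_mono) auto
    also have "\<dots> = (2 * real DIM('a)) ^ L * (\<bar>w \<bullet> b\<bar> ^ L * k)" by (simp add: power_mult_distrib)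
    also have "\<dots> \<le> (2 * real DIM('a)) ^ L * A" by (intro mult_left_mono assms b) auto
    finally show ?thesis .
  qed
qed

section \<open>From kernels to weighted averages\<close>

lemma ennreal_norm_integral_le:
  fixes f :: "'a \<Rightarrow> complex"
  shows "ennreal (norm (integral\<^sup>L M f)) \<le> (\<integral>\<^sup>+x. ennreal (norm (f x)) \<partial>M)"
  by (cases "integrable M f") (auto simp: integral_norm_bound_ennreal not_integrable_integral_eq)

text \<open>The inner product on the product space is a sum, so the character factorises and Fubini
  separates the variables.\<close>

lemma tensor_osc:
  fixes \<phi> \<gamma> :: "'a::euclidean_space \<Rightarrow> complex"
  assumes "integrable lborel \<phi>" "integrable lborel \<gamma>"
  shows "integrable lborel (\<lambda>z. \<phi> (fst z) * \<gamma> (snd z))"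
    and "osc (\<lambda>z. \<phi> (fst z) * \<gamma> (snd z)) y = osc \<phi> (fst y) * osc \<gamma> (snd y)"
proof -
  have [measurable]: "\<phi> \<in> borel_measurable borel" "\<gamma> \<in> borel_measurable borel" using assms by auto
  have pair: "integrable (lborel \<Otimes>\<^sub>M lborel) (\<lambda>(u, v). \<phi> u * \<gamma> v)"
    if "integrable lborel \<phi>" "integrable lborel \<gamma>" for \<phi> \<gamma> :: "'a \<Rightarrow> complex"
  proof (rule lborel_pair.Fubini_integrable)
    have [measurable]: "\<phi> \<in> borel_measurable borel" "\<gamma> \<in> borel_measurable borel" using that by auto
    show "(\<lambda>(u, v). \<phi> u * \<gamma> v) \<in> borel_measurable (lborel \<Otimes>\<^sub>M lborel)" by measurable
    show "integrable lborel (\<lambda>u. \<integral>v. norm (case (u, v) of (u, v) \<Rightarrow> \<phi> u * \<gamma> v) \<partial>lborel)"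
      using that by (simp add: norm_mult)
    show "AE u in lborel. integrable lborel (\<lambda>v. case (u, v) of (u, v) \<Rightarrow> \<phi> u * \<gamma> v)"
      using that by simp
  qed
  show "integrable lborel (\<lambda>z. \<phi> (fst z) * \<gamma> (snd z))"
    using pair[OF assms] by (simp add: lborel_prod case_prod_beta')
  let ?f = "\<lambda>u. cis (fst y \<bullet> u) * \<phi> u" and ?g = "\<lambda>v. cis (snd y \<bullet> v) * \<gamma> v"
  have "osc (\<lambda>z. \<phi> (fst z) * \<gamma> (snd z)) y = (\<integral>z. (case z of (u, v) \<Rightarrow> ?f u * ?g v) \<partial>(lborel \<Otimes>\<^sub>M lborel))"
    unfolding osc_def lborel_prod
  proof (rule Bochner_Integration.integral_cong[OF refl])
    fix z :: "'a \<times> 'a"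
    have "cis (y \<bullet> z) = cis (fst y \<bullet> fst z) * cis (snd y \<bullet> snd z)"
      by (simp add: inner_prod_def cis_mult)
    then show "cis (y \<bullet> z) * (\<phi> (fst z) * \<gamma> (snd z)) = (case z of (u, v) \<Rightarrow> ?f u * ?g v)"
      by (simp add: case_prod_beta')
  qed
  also have "\<dots> = (\<integral>u. (\<integral>v. ?f u * ?g v \<partial>lborel) \<partial>lborel)"
    using lborel_pair.integral_fst'[OF pair[OF integrable_cis_mult[OF assms(1)] integrable_cis_mult[OF assms(2)]], of "fst y" "snd y"]
    by simp
  also have "\<dots> = osc \<phi> (fst y) * osc \<gamma> (snd y)"
    by (simp add: osc_def)
  finally show "osc (\<lambda>z. \<phi> (fst z) * \<gamma> (snd z)) y = osc \<phi> (fst y) * osc \<gamma> (snd y)" .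
qed

text \<open>Both components of \<open>w\<close> have norm at most \<open>norm w\<close>, so with
  \<open>n = DIM('a)\<close> the weight of order \<open>2 * n + 2\<close> is dominated by a product
  of weights of order \<open>n + 1\<close>. The power of \<open>l\<close> undoes the normalisation
  of the two averages.\<close>

lemma nn_integral_weight_tensor:
  fixes f g :: "'a::euclidean_space \<Rightarrow> real"
  assumes [measurable]: "f \<in> borel_measurable borel" "g \<in> borel_measurable borel" and l: "l > 0"
    and fg: "\<And>x. 0 \<le> f x" "\<And>x. 0 \<le> g x"
  shows "(\<integral>\<^sup>+w. ennreal (1 / (1 + norm w / l) ^ (2 * DIM('a) + 2)) * ennreal (f (x - fst w) * g (x - snd w)) \<partial>(lborel :: ('a \<times> 'a) measure))
    \<le> ennreal (l powr (2 * real DIM('a))) * (weighted_avg l f x * weighted_avg l g x)"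
proof -
  let ?n = "DIM('a)"
  define h where "h y = 1 / (l ^ ?n * (1 + norm (y::'a) / l) ^ (?n + 1))" for y
  have [measurable]: "h \<in> borel_measurable borel" unfolding h_def by measurable
  have h0: "h y \<ge> 0" for y using l by (simp add: h_def)
  have "(\<integral>\<^sup>+w. ennreal (1 / (1 + norm w / l) ^ (2 * ?n + 2)) * ennreal (f (x - fst w) * g (x - snd w)) \<partial>(lborel :: ('a \<times> 'a) measure))
    \<le> (\<integral>\<^sup>+w. ennreal (l powr (2 * real ?n)) * ((ennreal (h (fst w)) * ennreal (f (x - fst w))) * (ennreal (h (snd w)) * ennreal (g (x - snd w)))) \<partial>(lborel :: ('a \<times> 'a) measure))"
  proof (rule nn_integral_mono)
    fix w :: "'a \<times> 'a"
    define A where "A = 1 + norm (fst w) / l"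
    define B where "B = 1 + norm (snd w) / l"
    define E where "E = 1 + norm w / l"
    have AB: "A \<ge> 1" "B \<ge> 1" using l by (auto simp: A_def B_def)
    have "A \<le> E" "B \<le> E"
      using l norm_fst_le[of "fst w" "snd w"] norm_snd_le[of "snd w" "fst w"] by (auto simp: A_def B_def E_def divide_right_mono)
    then have "A ^ (?n + 1) * B ^ (?n + 1) \<le> E ^ (?n + 1) * E ^ (?n + 1)"
      using AB by (intro mult_mono power_mono) auto
    also have "\<dots> = E ^ (2 * ?n + 2)" by (simp add: power_add[symmetric] mult_2 del: power_Suc)
    finally have "1 / E ^ (2 * ?n + 2) \<le> 1 / (A ^ (?n + 1) * B ^ (?n + 1))"
      using AB by (intro divide_left_mono) (auto intro!: mult_pos_pos zero_less_power simp: E_def l less_imp_le add_pos_nonneg)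
    also have "\<dots> = l powr (2 * real ?n) * (h (fst w) * h (snd w))"
    proof -
      have "l powr (2 * real ?n) = l ^ ?n * l ^ ?n" using l by (simp add: powr_realpow[symmetric] powr_add[symmetric])
      then show ?thesis using l AB by (simp add: h_def A_def[symmetric] B_def[symmetric])
    qed
    finally have "1 / E ^ (2 * ?n + 2) * (f (x - fst w) * g (x - snd w)) \<le> l powr (2 * real ?n) * (h (fst w) * h (snd w)) * (f (x - fst w) * g (x - snd w))"
      using fg by (intro mult_right_mono) auto
    then have "ennreal (1 / E ^ (2 * ?n + 2) * (f (x - fst w) * g (x - snd w))) \<le> ennreal (l powr (2 * real ?n) * ((h (fst w) * f (x - fst w)) * (h (snd w) * g (x - snd w))))"
      by (intro ennreal_leI) (simp add: mult_ac)
    then show "ennreal (1 / (1 + norm w / l) ^ (2 * ?n + 2)) * ennreal (f (x - fst w) * g (x - snd w))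
      \<le> ennreal (l powr (2 * real ?n)) * ((ennreal (h (fst w)) * ennreal (f (x - fst w))) * (ennreal (h (snd w)) * ennreal (g (x - snd w))))"
    proof -
      have "1 / E ^ (2 * ?n + 2) \<ge> 0" using l by (simp add: E_def)
      then have "ennreal (1 / E ^ (2 * ?n + 2) * (f (x - fst w) * g (x - snd w))) = ennreal (1 / E ^ (2 * ?n + 2)) * ennreal (f (x - fst w) * g (x - snd w))"
        using fg by (intro ennreal_mult) auto
      moreover have "ennreal (l powr (2 * real ?n) * ((h (fst w) * f (x - fst w)) * (h (snd w) * g (x - snd w)))) =
        ennreal (l powr (2 * real ?n)) * ((ennreal (h (fst w)) * ennreal (f (x - fst w))) * (ennreal (h (snd w)) * ennreal (g (x - snd w))))"
        using fg h0 by (simp add: ennreal_mult)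
      ultimately show ?thesis using \<open>ennreal _ \<le> ennreal _\<close> unfolding E_def[symmetric] by (simp only:)
    qed
  qed
  also have "\<dots> = (\<integral>\<^sup>+u. \<integral>\<^sup>+v. ennreal (l powr (2 * real ?n)) * ((ennreal (h u) * ennreal (f (x - u))) * (ennreal (h v) * ennreal (g (x - v)))) \<partial>lborel \<partial>lborel)"
    unfolding lborel_prod[symmetric] by (subst lborel.nn_integral_fst[symmetric]) auto
  also have "\<dots> = ennreal (l powr (2 * real ?n)) * (weighted_avg l f x * weighted_avg l g x)"
    unfolding weighted_avg_def h_def[symmetric] by (simp add: nn_integral_cmult nn_integral_multc)
  finally show ?thesis .
qed

lemma norm_Basis_scaled_direction: "0 \<le> \<kappa> \<Longrightarrow> e \<in> Basis \<Longrightarrow> scaled_direction \<kappa> e"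
  by unfold_locales auto

text \<open>With \<open>N = DIM('a)\<close>, the kernel of the localised symbol is bounded by
  \<open>l powr (s - N)\<close> times a weight of order \<open>N + 2\<close> at scale
  \<open>l\<close>, and the pairing with \<open>H\<close> transfers the bound. The order is one
  above the least integer that makes the weight integrable, so that for \<open>N = 2 * n\<close> it
  splits evenly into two weights of order \<open>n + 1\<close>.\<close>

lemma localised_kernel_bound:
  assumes DIM: "DIM('a::euclidean_space) \<ge> 2" and k: "0 \<le> \<kappa>" and s: "0 \<le> s" "s \<le> real DIM('a)" and C0: "C0 \<ge> 0"
  shows "\<exists>D>0. \<forall>l>0. \<forall>a :: 'a \<Rightarrow> complex. (\<forall>e\<in>Basis. dsym \<kappa> e (DIM('a) + 2) (\<lambda>z. C0 * bracket \<kappa> z powr (- s)) a) \<longrightarrow>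
    (\<forall>H x. integrable lborel H \<longrightarrow>
      ennreal (norm (\<integral>z. cis (x \<bullet> z) * (a z * psi \<kappa> (DIM('a) + 1) (2 * DIM('a) + 2) l z) * H z \<partial>lborel)) \<le>
      ennreal (D * l powr (s - real DIM('a))) * (\<integral>\<^sup>+w. ennreal (1 / (1 + norm w / l) ^ (DIM('a) + 2)) * ennreal (norm (osc H (x - w))) \<partial>lborel))"
proof -
  let ?N = "DIM('a)"
  \<comment> \<open>Vanishing of order \<open>?N + 1\<close> meets the requirement
    \<open>s + (?N + 2) \<le> 2 * (?N + 1)\<close>, which amounts to \<open>s \<le> ?N\<close>; the
    other \<open>?N + 1\<close> powers give integrability at high frequencies.\<close>
  let ?psi = "psi \<kappa> (?N + 1) (?N + 1 + (?N + 1)) :: real \<Rightarrow> 'a \<Rightarrow> real"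
  define Q where "Q e D \<longleftrightarrow> (\<forall>l>0. \<forall>a :: 'a \<Rightarrow> complex. dsym \<kappa> e (?N + 2) (\<lambda>z. C0 * bracket \<kappa> z powr (- s)) a \<longrightarrow>
    integrable lborel (\<lambda>z. a z * ?psi l z) \<and>
    (\<forall>z. z \<noteq> 0 \<longrightarrow> norm (a z * ?psi l z) \<le> D * l powr s) \<and>
    (\<forall>w. norm (osc (\<lambda>z. a z * ?psi l z) w) \<le> D * l powr (s - real ?N) \<and>
         (\<bar>w \<bullet> e\<bar> / l) ^ (?N + 2) * norm (osc (\<lambda>z. a z * ?psi l z) w) \<le> D * l powr (s - real ?N)))" for e D
  have "\<exists>D>0. Q e D" if "e \<in> Basis" for e
    unfolding Q_def using s(2)
    by (intro scaled_direction.osc_localised_bound[OF norm_Basis_scaled_direction[OF k that] DIM s(1) _ C0]) simp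
  then have "\<forall>e\<in>Basis. \<exists>D. D > 0 \<and> Q e D" by blast
  then obtain De where "\<forall>e\<in>Basis. De e > 0 \<and> Q e (De e)" using bchoice by meson
  then have De: "\<And>e. e \<in> Basis \<Longrightarrow> De e > 0"
    "\<And>e l a. e \<in> Basis \<Longrightarrow> l > 0 \<Longrightarrow> dsym \<kappa> e (?N + 2) (\<lambda>z. C0 * bracket \<kappa> z powr (- s)) a \<Longrightarrow>
    integrable lborel (\<lambda>z::'a. a z * ?psi l z) \<and>
    (\<forall>z. z \<noteq> 0 \<longrightarrow> norm (a z * ?psi l z) \<le> De e * l powr s) \<and>
    (\<forall>w. norm (osc (\<lambda>z. a z * ?psi l z) w) \<le> De e * l powr (s - real ?N) \<and>
         (\<bar>w \<bullet> e\<bar> / l) ^ (?N + 2) * norm (osc (\<lambda>z. a z * ?psi l z) w) \<le> De e * l powr (s - real ?N))"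
    unfolding Q_def by auto
  define D1 where "D1 = (\<Sum>e\<in>Basis. De e)"
  have De_le: "De e \<le> D1" if "e \<in> Basis" for e
    unfolding D1_def using De(1) that by (intro member_le_sum) (auto simp: less_imp_le)
  obtain e0 :: 'a where e0: "e0 \<in> Basis" using nonempty_Basis by blast
  have D1: "D1 > 0" using De(1)[OF e0] De_le[OF e0] by linarith
  define D where "D = (2 * real ?N) ^ (?N + 2) * D1"
  have D: "D > 0" using D1 DIM by (simp add: D_def)
  show ?thesis
  proof (intro exI[of _ D] conjI D allI impI)
    fix l and a H :: "'a \<Rightarrow> complex" and x
    assume l: "l > (0::real)" and a: "\<forall>e\<in>Basis. dsym \<kappa> e (?N + 2) (\<lambda>z. C0 * bracket \<kappa> z powr (- s)) a"
      and H: "integrable lborel H"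
    interpret scaled_direction \<kappa> e0 by (rule norm_Basis_scaled_direction[OF k e0])
    have [measurable]: "H \<in> borel_measurable borel" using H by auto
    define b where "b z = a z * ?psi l z" for z
    note fact = De(2)[OF _ l a[rule_format], folded b_def[abs_def] b_def]
    have b: "integrable lborel b" using fact[OF e0] e0 by blast
    have [measurable]: "b \<in> borel_measurable borel" using b by auto
    \<comment> \<open>\<open>dsym\<close> does not control the value at the origin, but inversion
      asks for a bound at every point.\<close>
    define B where "B = max (De e0 * l powr s) (norm (b 0))"
    have bB: "norm (b z) \<le> B" for z
      using fact[OF e0] e0 by (cases "z = 0") (auto simp: B_def max.coboundedI1)
    have kb: "(1 + norm w / l) ^ (?N + 2) * norm (osc b w) \<le> D * l powr (s - real ?N)" for w
    proof -
      have "(1 + norm ((1 / l) *\<^sub>R w)) ^ (?N + 2) * norm (osc b w) \<le> (2 * real ?N) ^ (?N + 2) * (D1 * l powr (s - real ?N))"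
      proof (rule coordinatewise_decay)
        have up: "De e * l powr (s - real ?N) \<le> D1 * l powr (s - real ?N)" if "e \<in> Basis" for e
          using De_le[OF that] by (intro mult_right_mono) auto
        show "\<bar>((1 / l) *\<^sub>R w) \<bullet> e\<bar> ^ (?N + 2) * norm (osc b w) \<le> D1 * l powr (s - real ?N)" if e: "e \<in> Basis" for e
        proof -
          have "\<bar>((1 / l) *\<^sub>R w) \<bullet> e\<bar> = \<bar>w \<bullet> e\<bar> / l" using l by (simp add: abs_mult)
          then show ?thesis using fact[OF e] e up[OF e] order_trans by metis
        qed
        show "norm (osc b w) \<le> D1 * l powr (s - real ?N)" using fact[OF e0] e0 up[OF e0] order_trans by metis
      qed simp
      then show ?thesis using l by (simp add: D_def mult.assoc)
    qed
    have kb': "norm (osc b w) \<le> D * l powr (s - real ?N) * (1 / (1 + norm w / l) ^ (?N + 2))" for w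
    proof -
      have "(1 + norm w / l) ^ (?N + 2) > 0" using l by (intro zero_less_power add_pos_nonneg) auto
      then show ?thesis using kb[of w] by (simp add: pos_le_divide_eq mult.commute)
    qed
    obtain C2 where C2: "\<And>l. l > 0 \<Longrightarrow> integrable lborel (\<lambda>z::'a. 1 / (1 + l * norm z) ^ (?N + 1))"
      using integrable_weight[where 'a='a] by blast
    have iosc: "integrable lborel (osc b)"
    proof (rule Bochner_Integration.integrable_bound)
      show "integrable lborel (\<lambda>w. D * l powr (s - real ?N) * (1 / (1 + (1 / l) * norm (w::'a)) ^ (?N + 1)))"
        using l by (intro integrable_mult_right C2) auto
      have "norm (osc b w) \<le> norm (D * l powr (s - real ?N) * (1 / (1 + (1 / l) * norm w) ^ (?N + 1)))" for w
      proof -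
        have "1 \<le> 1 + norm w / l" using l by simp
        then have "(1 + norm w / l) ^ (?N + 1) \<le> (1 + norm w / l) ^ (?N + 2)" by (intro power_increasing) auto
        moreover have "(1 + norm w / l) ^ (?N + 1) > 0" using l by (intro zero_less_power add_pos_nonneg) auto
        ultimately have "1 / (1 + norm w / l) ^ (?N + 2) \<le> 1 / (1 + norm w / l) ^ (?N + 1)"
          by (intro divide_left_mono mult_pos_pos) auto
        then have "D * l powr (s - real ?N) * (1 / (1 + norm w / l) ^ (?N + 2)) \<le> D * l powr (s - real ?N) * (1 / (1 + norm w / l) ^ (?N + 1))"
          using D by (intro mult_left_mono) auto
        with kb'[of w] have "norm (osc b w) \<le> D * l powr (s - real ?N) * (1 / (1 + norm w / l) ^ (?N + 1))" by linarith
        also have "\<dots> = D * l powr (s - real ?N) * (1 / (1 + (1 / l) * norm w) ^ (?N + 1))" by simp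
        also have "\<dots> \<le> norm \<dots>" by (simp only: real_norm_def abs_ge_self)
        finally show ?thesis .
      qed
      then show "AE w in lborel. norm (osc b w) \<le> norm (D * l powr (s - real ?N) * (1 / (1 + (1 / l) * norm w) ^ (?N + 1)))"
        by (intro AE_I2)
    qed measurable
    have cont: "continuous_on (- {0}) b"
    proof -
      obtain C where "csym 0 (\<lambda>z. C * ?psi l z) (\<lambda>z. of_real (?psi l z))" using csym_psi l by blast
      then have "continuous_on (- {0}) (\<lambda>z. complex_of_real (?psi l z))" by (rule csymD(1))
      moreover have "continuous_on (- {0}) a" using a e0 by (intro csymD(1)) blast
      ultimately show ?thesis unfolding b_def[abs_def] by (intro continuous_on_mult)
    qed
    have ae: "AE z in lborel. isCont b z"
      using AE_lborel_singleton[of 0]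
    proof eventually_elim
      case (elim z)
      then show ?case using cont by (simp add: continuous_on_eq_continuous_at open_Compl)
    qed
    let ?I = "\<integral>z. cis (x \<bullet> z) * b z * H z \<partial>lborel"
    \<comment> \<open>The inversion constant is at least 1 and may be dropped.\<close>
    have "norm ?I \<le> norm ((2 * pi) ^ ?N * ?I)"
    proof -
      have "1 \<le> (2 * pi) ^ ?N" using pi_ge_two by (intro one_le_power) linarith
      then have "1 * norm ?I \<le> (2 * pi) ^ ?N * norm ?I" by (intro mult_right_mono) auto
      then show ?thesis by (simp add: norm_mult norm_power)
    qed
    also have "(2 * pi) ^ ?N * ?I = (\<integral>w. osc b w * osc H (x - w) \<partial>lborel)"
      by (rule osc_pairing[OF b bB ae iosc H])
    finally have "ennreal (norm ?I) \<le> ennreal (norm (\<integral>w. osc b w * osc H (x - w) \<partial>lborel))" by (rule ennreal_leI)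
    also have "\<dots> \<le> (\<integral>\<^sup>+w. ennreal (norm (osc b w * osc H (x - w))) \<partial>lborel)" by (rule ennreal_norm_integral_le)
    also have "\<dots> \<le> (\<integral>\<^sup>+w. ennreal (D * l powr (s - real ?N)) * (ennreal (1 / (1 + norm w / l) ^ (?N + 2)) * ennreal (norm (osc H (x - w)))) \<partial>lborel)"
    proof (rule nn_integral_mono)
      fix w
      have "norm (osc b w * osc H (x - w)) \<le> D * l powr (s - real ?N) * (1 / (1 + norm w / l) ^ (?N + 2)) * norm (osc H (x - w))"
        unfolding norm_mult by (intro mult_right_mono kb') auto
      then have "ennreal (norm (osc b w * osc H (x - w))) \<le> ennreal (D * l powr (s - real ?N) * (1 / (1 + norm w / l) ^ (?N + 2)) * norm (osc H (x - w)))"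
        by (rule ennreal_leI)
      also have "\<dots> = ennreal (D * l powr (s - real ?N)) * (ennreal (1 / (1 + norm w / l) ^ (?N + 2)) * ennreal (norm (osc H (x - w))))"
      proof -
        have gen: "ennreal (X * Y * Z) = ennreal X * (ennreal Y * ennreal Z)" if "X \<ge> 0" "Y \<ge> 0" "Z \<ge> 0" for X Y Z
          using that by (simp add: ennreal_mult mult.assoc)
        show ?thesis by (rule gen) (use D l in auto)
      qed
      finally show "ennreal (norm (osc b w * osc H (x - w))) \<le> \<dots>" .
    qed
    also have "\<dots> = ennreal (D * l powr (s - real ?N)) * (\<integral>\<^sup>+w. ennreal (1 / (1 + norm w / l) ^ (?N + 2)) * ennreal (norm (osc H (x - w))) \<partial>lborel)"
      by (rule nn_integral_cmult) measurable
    finally show "ennreal (norm (\<integral>z. cis (x \<bullet> z) * (a z * psi \<kappa> (?N + 1) (2 * ?N + 2) l z) * H z \<partial>lborel)) \<le>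
      ennreal (D * l powr (s - real ?N)) * (\<integral>\<^sup>+w. ennreal (1 / (1 + norm w / l) ^ (?N + 2)) * ennreal (norm (osc H (x - w))) \<partial>lborel)"
      by (simp add: b_def mult_2)
  qed
qed

text \<open>For a tensor product \<open>H\<close> the factor \<open>osc H ((x, x) - w)\<close>
  splits, so the kernel bound becomes a product of two weighted averages. The power
  \<open>s - 2 * DIM('a)\<close> of \<open>l\<close> from the kernel and the power
  \<open>2 * DIM('a)\<close> from the normalisation combine to \<open>s\<close>.\<close>

lemma localised_bilinear_bound:
  assumes k: "0 \<le> \<kappa>" and s: "0 \<le> s" "s \<le> 2 * real DIM('a::euclidean_space)" and C0: "C0 \<ge> 0"
  shows "\<exists>D>0. \<forall>l>0. \<forall>a :: 'a \<times> 'a \<Rightarrow> complex. (\<forall>e\<in>Basis. dsym \<kappa> e (2 * DIM('a) + 2) (\<lambda>z. C0 * bracket \<kappa> z powr (- s)) a) \<longrightarrow>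
    (\<forall>\<phi> \<gamma> x. integrable lborel \<phi> \<longrightarrow> integrable lborel \<gamma> \<longrightarrow>
      ennreal (norm (\<integral>z. cis ((x, x) \<bullet> z) * (a z * psi \<kappa> (2 * DIM('a) + 1) (4 * DIM('a) + 2) l z) * (\<phi> (fst z) * \<gamma> (snd z)) \<partial>lborel)) \<le>
      ennreal (D * l powr s) * (weighted_avg l (\<lambda>y. norm (osc \<phi> y)) x * weighted_avg l (\<lambda>y. norm (osc \<gamma> y)) x))"
proof -
  let ?N = "2 * DIM('a)"
  have N: "DIM('a \<times> 'a) = ?N" by simp
  have DIM: "DIM('a \<times> 'a) \<ge> 2" unfolding N using DIM_positive[where 'a='a] by linarith
  have s2: "s \<le> real DIM('a \<times> 'a)" using s(2) by simp
  obtain D where "D > 0" and D2: "\<forall>l>0. \<forall>a :: 'a \<times> 'a \<Rightarrow> complex. (\<forall>e\<in>Basis. dsym \<kappa> e (?N + 2) (\<lambda>z. C0 * bracket \<kappa> z powr (- s)) a) \<longrightarrow>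
      (\<forall>H x. integrable lborel H \<longrightarrow>
      ennreal (norm (\<integral>z. cis (x \<bullet> z) * (a z * psi \<kappa> (?N + 1) (2 * ?N + 2) l z) * H z \<partial>lborel)) \<le>
      ennreal (D * l powr (s - real ?N)) * (\<integral>\<^sup>+w. ennreal (1 / (1 + norm w / l) ^ (?N + 2)) * ennreal (norm (osc H (x - w))) \<partial>lborel))"
    using localised_kernel_bound[OF DIM k s(1) s2 C0] unfolding N by blast
  then have D: "D > 0" "\<And>l H x. \<And>a :: 'a \<times> 'a \<Rightarrow> complex. l > 0 \<Longrightarrow> (\<forall>e\<in>Basis. dsym \<kappa> e (?N + 2) (\<lambda>z. C0 * bracket \<kappa> z powr (- s)) a) \<Longrightarrow>
      integrable lborel H \<Longrightarrow>
      ennreal (norm (\<integral>z. cis (x \<bullet> z) * (a z * psi \<kappa> (?N + 1) (2 * ?N + 2) l z) * H z \<partial>lborel)) \<le>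
      ennreal (D * l powr (s - real ?N)) * (\<integral>\<^sup>+w. ennreal (1 / (1 + norm w / l) ^ (?N + 2)) * ennreal (norm (osc H (x - w))) \<partial>lborel)"
    by blast+
  show ?thesis
  proof (intro exI[of _ D] conjI D(1) allI impI)
    fix l and a :: "'a \<times> 'a \<Rightarrow> complex" and \<phi> \<gamma> :: "'a \<Rightarrow> complex" and x :: 'a
    assume l: "l > (0::real)" and a: "\<forall>e\<in>Basis. dsym \<kappa> e (?N + 2) (\<lambda>z. C0 * bracket \<kappa> z powr (- s)) a"
      and int: "integrable lborel \<phi>" "integrable lborel \<gamma>"
    have [measurable]: "\<phi> \<in> borel_measurable borel" "\<gamma> \<in> borel_measurable borel" using int by auto
    let ?H = "\<lambda>z. \<phi> (fst z) * \<gamma> (snd z)"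
    have "ennreal (norm (\<integral>z. cis ((x, x) \<bullet> z) * (a z * psi \<kappa> (?N + 1) (2 * ?N + 2) l z) * ?H z \<partial>lborel)) \<le>
      ennreal (D * l powr (s - real ?N)) * (\<integral>\<^sup>+w. ennreal (1 / (1 + norm w / l) ^ (?N + 2)) * ennreal (norm (osc ?H ((x, x) - w))) \<partial>lborel)"
      by (rule D(2)[OF l a tensor_osc(1)[OF int]])
    also have "\<dots> = ennreal (D * l powr (s - real ?N)) * (\<integral>\<^sup>+w. ennreal (1 / (1 + norm w / l) ^ (?N + 2)) * ennreal (norm (osc \<phi> (x - fst w)) * norm (osc \<gamma> (x - snd w))) \<partial>lborel)"
      by (simp add: tensor_osc(2)[OF int] norm_mult)
    also have "\<dots> \<le> ennreal (D * l powr (s - real ?N)) * (ennreal (l powr (2 * real DIM('a))) * (weighted_avg l (\<lambda>y. norm (osc \<phi> y)) x * weighted_avg l (\<lambda>y. norm (osc \<gamma> y)) x))"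
      by (intro mult_left_mono nn_integral_weight_tensor l) auto
    also have "\<dots> = ennreal (D * l powr s) * (weighted_avg l (\<lambda>y. norm (osc \<phi> y)) x * weighted_avg l (\<lambda>y. norm (osc \<gamma> y)) x)"
    proof -
      have "D * l powr (s - real ?N) * l powr (2 * real DIM('a)) = D * l powr s"
        by (simp add: mult.assoc powr_add[symmetric])
      then have "ennreal (D * l powr (s - real ?N)) * ennreal (l powr (2 * real DIM('a))) = ennreal (D * l powr s)"
        using D(1) by (simp flip: ennreal_mult)
      then show ?thesis by (simp only: mult.assoc[symmetric])
    qed
    finally show "ennreal (norm (\<integral>z. cis ((x, x) \<bullet> z) * (a z * psi \<kappa> (2 * DIM('a) + 1) (4 * DIM('a) + 2) l z) * (\<phi> (fst z) * \<gamma> (snd z)) \<partial>lborel)) \<le>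
      ennreal (D * l powr s) * (weighted_avg l (\<lambda>y. norm (osc \<phi> y)) x * weighted_avg l (\<lambda>y. norm (osc \<gamma> y)) x)"
      by simp
  qed
qed

text \<open>Calderon's reproducing formula: rescaling \<open>l\<close> by
  \<open>bracket \<kappa> z\<close> shows that the integral over all scales does not depend on
  \<open>z\<close>. Convergence at small scales comes from \<open>M > 0\<close>, at large scales
  from \<open>K > M\<close>.\<close>

lemma psi_scale_integral:
  assumes M: "M > 0" "K > M"
  obtains c where "c > 0" "\<And>z::'a::euclidean_space. bracket \<kappa> z > 0 \<Longrightarrow>
     integrable lborel (\<lambda>l. indicator {0<..} l * (psi \<kappa> M K l z / l)) \<and>
     (\<integral>l. indicator {0<..} l * (psi \<kappa> M K l z / l) \<partial>lborel) = c"
proof -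
  define g where "g l = indicator {0<..} l * ((l\<^sup>2) ^ M / (1 + l\<^sup>2) ^ K / l)" for l :: real
  have g0: "g l \<ge> 0" for l by (simp add: g_def indicator_def)
  have [measurable]: "g \<in> borel_measurable borel" unfolding g_def by measurable
  have "(\<integral>\<^sup>+l. ennreal (g l) \<partial>lborel) \<le> (\<integral>\<^sup>+l. indicator {l. 0 < l \<and> ennreal l < ennreal 1} l * ennreal (l powr (1 - 1)) + indicator {1..} l * ennreal (l powr (- 1 - 1)) \<partial>lborel)"
  proof (rule nn_integral_mono)
    fix l :: real
    have 1: "g l \<le> 1" if "0 < l" "l < 1"
    proof -
      have "(l\<^sup>2) ^ M / l \<le> 1"
      proof -
        have "(l\<^sup>2) ^ M = l ^ (2 * M)" by (simp add: power_mult)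
        also have "\<dots> \<le> l ^ 1" using that M by (intro power_decreasing) auto
        finally show ?thesis using that by (simp add: divide_le_eq)
      qed
      moreover have "1 \<le> (1 + l\<^sup>2) ^ K" by (intro one_le_power) simp
      ultimately have "(l\<^sup>2) ^ M / l / (1 + l\<^sup>2) ^ K \<le> 1 / 1" by (intro frac_le) (use that in auto)
      then show ?thesis using that by (simp add: g_def divide_divide_eq_left mult.commute)
    qed
    have 2: "g l \<le> l powr (- 1 - 1)" if "l \<ge> 1"
    proof -
      have "(l\<^sup>2) ^ M * l\<^sup>2 \<le> (l\<^sup>2) ^ K"
      proof -
        have "(l\<^sup>2) ^ M * l\<^sup>2 = (l\<^sup>2) ^ (M + 1)" by simp
        also have "\<dots> \<le> (l\<^sup>2) ^ K" using that M by (intro power_increasing) auto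
        finally show ?thesis .
      qed
      also have "\<dots> \<le> (1 + l\<^sup>2) ^ K" by (intro power_mono) auto
      also have "\<dots> = (1 + l\<^sup>2) ^ K * 1" by simp
      also have "\<dots> \<le> (1 + l\<^sup>2) ^ K * l" using that by (intro mult_left_mono) auto
      finally have "(l\<^sup>2) ^ M * l\<^sup>2 \<le> (1 + l\<^sup>2) ^ K * l" .
      moreover have "(1 + l\<^sup>2) ^ K * l > 0" using that by (intro mult_pos_pos zero_less_power) (auto intro: add_pos_nonneg)
      ultimately have "(l\<^sup>2) ^ M / ((1 + l\<^sup>2) ^ K * l) \<le> 1 / l\<^sup>2"
        using that by (simp add: pos_divide_le_eq pos_le_divide_eq)
      moreover have "l powr (- 1 - 1) = 1 / l\<^sup>2" using that by (simp add: powr_minus_divide powr_numeral)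
      ultimately show ?thesis using that by (simp add: g_def)
    qed
    show "ennreal (g l) \<le> indicator {l. 0 < l \<and> ennreal l < ennreal 1} l * ennreal (l powr (1 - 1)) + indicator {1..} l * ennreal (l powr (- 1 - 1))"
    proof (cases "0 < l")
      case pos: True
      show ?thesis
      proof (cases "l < 1")
        case True
        then show ?thesis using 1 pos by (simp add: indicator_def ennreal_less_iff ennreal_le_1)
      next
        case False
        then show ?thesis using 2 pos by (simp add: indicator_def ennreal_leI)
      qed
    qed (simp add: g_def)
  qed
  also have "\<dots> = ennreal 2"
    using nn_integral_powr_less[of 1 "ennreal 1"] nn_integral_powr_tail[of 1 1]
    by (subst nn_integral_add) (auto simp: epowr_def one_add_one)
  finally have "(\<integral>\<^sup>+l. ennreal (g l) \<partial>lborel) \<le> ennreal 2" .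
  then have fin: "(\<integral>\<^sup>+l. ennreal (g l) \<partial>lborel) < \<infinity>" by (rule le_less_trans) simp
  have ig: "integrable lborel g" using fin g0 by (intro integrableI_nonneg) auto
  have pos: "(\<integral>l. g l \<partial>lborel) > 0"
  \<comment> \<open>A vanishing integral would make the set where \<open>g\<close> is positive a
    null set, but \<open>g\<close> is positive on all of \<open>{1..2}\<close>.\<close>
  proof (rule ccontr)
    assume "\<not> ?thesis"
    then have "(\<integral>l. g l \<partial>lborel) = 0" using integral_nonneg_AE[of g lborel] g0 by (simp add: antisym not_less)
    then have "AE l in lborel. g l = 0" using integral_nonneg_eq_0_iff_AE[OF ig] g0 by simp
    then have "AE l in lborel. l \<notin> {1..2::real}"
    proof eventually_elim
      case (elim l)
      have "g l > 0" if "l > 0"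
        using that by (simp add: g_def add_pos_nonneg)
      then show ?case using elim by fastforce
    qed
    then have "{1..2::real} \<in> null_sets lborel" by (subst AE_iff_null_sets) simp_all
    then show False by (simp add: null_sets_def)
  qed
  show ?thesis
  proof (rule that[OF pos])
    fix z :: 'a assume R: "bracket \<kappa> z > 0"
    have eq: "indicator {0<..} l * (psi \<kappa> M K l z / l) = bracket \<kappa> z * g (0 + bracket \<kappa> z * l)" for l
      using R by (auto simp: g_def psi_def indicator_def power_mult_distrib zero_less_mult_iff mult.commute)
    have "(\<integral>l. g l \<partial>lborel) = \<bar>bracket \<kappa> z\<bar> *\<^sub>R (\<integral>l. g (0 + bracket \<kappa> z * l) \<partial>lborel)"
      using R by (intro lborel_integral_real_affine) auto
    then have "(\<integral>l. indicator {0<..} l * (psi \<kappa> M K l z / l) \<partial>lborel) = (\<integral>l. g l \<partial>lborel)"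
      unfolding eq using R by simp
    moreover have "integrable lborel (\<lambda>l. indicator {0<..} l * (psi \<kappa> M K l z / l))"
      unfolding eq using lborel_integrable_real_affine[OF ig, of "bracket \<kappa> z" 0] R by (intro integrable_mult_right) auto
    ultimately show "integrable lborel (\<lambda>l. indicator {0<..} l * (psi \<kappa> M K l z / l)) \<and>
     (\<integral>l. indicator {0<..} l * (psi \<kappa> M K l z / l) \<partial>lborel) = (\<integral>l. g l \<partial>lborel)" by blast
  qed
qed

text \<open>Averaging the localised operators over \<open>dl / l\<close> reproduces the full one up
  to the constant \<open>c\<close>. Fubini is justified because the full integrand is integrable and
  the integral of \<open>psi\<close> over the scales is the same finite number at every frequency
  off the origin.\<close>

theorem bilinear_multiplier_bound:
  assumes k: "0 \<le> \<kappa>" and s: "0 \<le> s" "s \<le> 2 * real DIM('a::euclidean_space)" and C0: "C0 \<ge> 0"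
  shows "\<exists>D>0. \<forall>a :: 'a \<times> 'a \<Rightarrow> complex. (\<forall>e\<in>Basis. dsym \<kappa> e (2 * DIM('a) + 2) (\<lambda>z. C0 * bracket \<kappa> z powr (- s)) a) \<longrightarrow>
    (\<forall>\<phi> \<gamma> x. integrable lborel \<phi> \<longrightarrow> integrable lborel \<gamma> \<longrightarrow> integrable lborel (\<lambda>z. a z * (\<phi> (fst z) * \<gamma> (snd z))) \<longrightarrow>
      ennreal (norm (\<integral>z. cis ((x, x) \<bullet> z) * (a z * (\<phi> (fst z) * \<gamma> (snd z))) \<partial>lborel)) \<le>
      ennreal D * fractional_form s (\<lambda>y. norm (osc \<phi> y)) (\<lambda>y. norm (osc \<gamma> y)) x)"
proof -
  let ?M = "2 * DIM('a) + 1" and ?K = "4 * DIM('a) + 2"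
  let ?psi = "psi \<kappa> ?M ?K :: real \<Rightarrow> 'a \<times> 'a \<Rightarrow> real"
  obtain D where "D > 0" and "\<forall>l>0. \<forall>a :: 'a \<times> 'a \<Rightarrow> complex. (\<forall>e\<in>Basis. dsym \<kappa> e (2 * DIM('a) + 2) (\<lambda>z. C0 * bracket \<kappa> z powr (- s)) a) \<longrightarrow>
    (\<forall>\<phi> \<gamma> x. integrable lborel \<phi> \<longrightarrow> integrable lborel \<gamma> \<longrightarrow>
      ennreal (norm (\<integral>z. cis ((x, x) \<bullet> z) * (a z * ?psi l z) * (\<phi> (fst z) * \<gamma> (snd z)) \<partial>lborel)) \<le>
      ennreal (D * l powr s) * (weighted_avg l (\<lambda>y. norm (osc \<phi> y)) x * weighted_avg l (\<lambda>y. norm (osc \<gamma> y)) x))"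
    using localised_bilinear_bound[OF k s C0] by (elim exE conjE)
  then have D: "D > 0" "\<And>l \<phi> \<gamma> x. \<And>a :: 'a \<times> 'a \<Rightarrow> complex. l > 0 \<Longrightarrow> (\<forall>e\<in>Basis. dsym \<kappa> e (2 * DIM('a) + 2) (\<lambda>z. C0 * bracket \<kappa> z powr (- s)) a) \<Longrightarrow>
     integrable lborel \<phi> \<Longrightarrow> integrable lborel \<gamma> \<Longrightarrow>
      ennreal (norm (\<integral>z. cis ((x, x) \<bullet> z) * (a z * ?psi l z) * (\<phi> (fst z) * \<gamma> (snd z)) \<partial>lborel)) \<le>
      ennreal (D * l powr s) * (weighted_avg l (\<lambda>y. norm (osc \<phi> y)) x * weighted_avg l (\<lambda>y. norm (osc \<gamma> y)) x)"
    by simp_all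
  have KM: "0 < ?M" "?M < ?K" by auto
  obtain c where c: "c > 0" "\<And>z::'a \<times> 'a. bracket \<kappa> z > 0 \<Longrightarrow>
     integrable lborel (\<lambda>l. indicator {0<..} l * (?psi l z / l)) \<and>
     (\<integral>l. indicator {0<..} l * (?psi l z / l) \<partial>lborel) = c"
    using psi_scale_integral[OF KM, where 'a="'a \<times> 'a" and \<kappa>=\<kappa>] by blast
  show ?thesis
  proof (intro exI[of _ "D / c"] conjI allI impI)
    show "D / c > 0" using D c by simp
    fix a :: "'a \<times> 'a \<Rightarrow> complex" and \<phi> \<gamma> :: "'a \<Rightarrow> complex" and x :: 'a
    assume a: "\<forall>e\<in>Basis. dsym \<kappa> e (2 * DIM('a) + 2) (\<lambda>z. C0 * bracket \<kappa> z powr (- s)) a"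
      and int: "integrable lborel \<phi>" "integrable lborel \<gamma>" "integrable lborel (\<lambda>z. a z * (\<phi> (fst z) * \<gamma> (snd z)))"
    define U where "U z = cis ((x, x) \<bullet> z) * (a z * (\<phi> (fst z) * \<gamma> (snd z)))" for z
    have U: "integrable lborel U" unfolding U_def by (rule integrable_cis_mult[OF int(3)])
    have [measurable]: "U \<in> borel_measurable borel" using U by auto
    have [measurable]: "\<phi> \<in> borel_measurable borel" "\<gamma> \<in> borel_measurable borel" using int by auto
    define w where "w l z = indicator {0<..} l * (?psi l z / l)" for l z
    have cw: "integrable lborel (\<lambda>l. w l z) \<and> (\<integral>l. w l z \<partial>lborel) = c" if "bracket \<kappa> z > 0" for z
      unfolding w_def by (rule c(2)[OF that])
    have w0: "w l z \<ge> 0" for l z by (simp add: w_def indicator_def psi_nonneg)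
    have [measurable]: "(\<lambda>p. w (snd p) (fst p)) \<in> borel_measurable (borel \<Otimes>\<^sub>M borel)" unfolding w_def by measurable
    have [measurable]: "(\<lambda>l. w l z) \<in> borel_measurable borel" for z unfolding w_def by measurable
    have Rpos: "AE z in lborel. bracket \<kappa> (z :: 'a \<times> 'a) > 0"
      using AE_lborel_singleton[of 0] by eventually_elim (use k in \<open>simp add: bracket_def add_nonneg_pos\<close>)
    have pair: "integrable (lborel \<Otimes>\<^sub>M lborel) (\<lambda>(z, l). complex_of_real (w l z) * U z)"
    proof (rule lborel_pair.Fubini_integrable)
      show "(\<lambda>(z, l). complex_of_real (w l z) * U z) \<in> borel_measurable (lborel \<Otimes>\<^sub>M lborel)"
        unfolding case_prod_beta' by measurable
      have "AE z in lborel. (\<integral>l. norm (case (z, l) of (z, l) \<Rightarrow> complex_of_real (w l z) * U z) \<partial>lborel) = c * norm (U z)"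
        using Rpos
      proof eventually_elim
        case (elim z)
        have "(\<integral>l. norm (case (z, l) of (z, l) \<Rightarrow> complex_of_real (w l z) * U z) \<partial>lborel) = (\<integral>l. w l z * norm (U z) \<partial>lborel)"
          using w0 by (simp add: norm_mult)
        also have "\<dots> = c * norm (U z)" using cw[OF elim] by simp
        finally show ?case .
      qed
      then show "integrable lborel (\<lambda>z. \<integral>l. norm (case (z, l) of (z, l) \<Rightarrow> complex_of_real (w l z) * U z) \<partial>lborel)"
        using U by (subst integrable_cong_AE[where g="\<lambda>z. c * norm (U z)"]) (auto simp: case_prod_beta')
      show "AE z in lborel. integrable lborel (\<lambda>l. case (z, l) of (z, l) \<Rightarrow> complex_of_real (w l z) * U z)"
        using Rpos
      proof eventually_elim
        case (elim z)
        have "integrable lborel (\<lambda>l. w l z)" using cw[OF elim] by simp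
        then show ?case by (simp add: integrable_mult_left)
      qed
    qed
    have "complex_of_real c * (\<integral>z. U z \<partial>lborel) = (\<integral>z. complex_of_real c * U z \<partial>lborel)" by simp
    also have "\<dots> = (\<integral>z. (\<integral>l. complex_of_real (w l z) * U z \<partial>lborel) \<partial>lborel)"
    proof (rule integral_cong_AE)
      show "AE z in lborel. complex_of_real c * U z = (\<integral>l. complex_of_real (w l z) * U z \<partial>lborel)"
        using Rpos
      proof eventually_elim
        case (elim z)
        have "(\<integral>l. complex_of_real (w l z) * U z \<partial>lborel) = complex_of_real (\<integral>l. w l z \<partial>lborel) * U z"
          by (simp add: integral_complex_of_real)
        then show ?case using cw[OF elim] by simp
      qed
      show "(\<lambda>z. \<integral>l. complex_of_real (w l z) * U z \<partial>lborel) \<in> borel_measurable lborel"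
        using borel_measurable_integrable[OF lborel_pair.integrable_fst'[OF pair]] by simp
    qed simp
    also have "\<dots> = (\<integral>l. (\<integral>z. complex_of_real (w l z) * U z \<partial>lborel) \<partial>lborel)"
      using lborel_pair.Fubini_integral[OF pair] by simp
    finally have "ennreal (norm (complex_of_real c * (\<integral>z. U z \<partial>lborel))) = ennreal (norm (\<integral>l. (\<integral>z. complex_of_real (w l z) * U z \<partial>lborel) \<partial>lborel))"
      by simp
    also have "\<dots> \<le> (\<integral>\<^sup>+l. ennreal (norm (\<integral>z. complex_of_real (w l z) * U z \<partial>lborel)) \<partial>lborel)"
      by (rule ennreal_norm_integral_le)
    also have "\<dots> \<le> (\<integral>\<^sup>+l. ennreal D * (indicator {0<..} l * (ennreal (l powr (s - 1)) * (weighted_avg l (\<lambda>y. norm (osc \<phi> y)) x * weighted_avg l (\<lambda>y. norm (osc \<gamma> y)) x))) \<partial>lborel)"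
    proof (rule nn_integral_mono)
      fix l :: real
      let ?W = "weighted_avg l (\<lambda>y. norm (osc \<phi> y)) x * weighted_avg l (\<lambda>y. norm (osc \<gamma> y)) x"
      show "ennreal (norm (\<integral>z. complex_of_real (w l z) * U z \<partial>lborel)) \<le> ennreal D * (indicator {0<..} l * (ennreal (l powr (s - 1)) * ?W))"
      proof (cases "l > 0")
        case l: True
        let ?I = "\<integral>z. cis ((x, x) \<bullet> z) * (a z * ?psi l z) * (\<phi> (fst z) * \<gamma> (snd z)) \<partial>lborel"
        have "(\<integral>z. complex_of_real (w l z) * U z \<partial>lborel) = (\<integral>z. complex_of_real (1 / l) * (cis ((x, x) \<bullet> z) * (a z * ?psi l z) * (\<phi> (fst z) * \<gamma> (snd z))) \<partial>lborel)"
          using l by (intro Bochner_Integration.integral_cong) (auto simp: w_def U_def)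
        also have "\<dots> = complex_of_real (1 / l) * ?I" by (rule integral_mult_right_zero)
        finally have "norm (\<integral>z. complex_of_real (w l z) * U z \<partial>lborel) = (1 / l) * norm ?I"
          using l by (simp add: norm_mult norm_divide)
        then have "ennreal (norm (\<integral>z. complex_of_real (w l z) * U z \<partial>lborel)) = ennreal (1 / l) * ennreal (norm ?I)"
          using l by (simp only:) (rule ennreal_mult, auto)
        also have "\<dots> \<le> ennreal (1 / l) * (ennreal (D * l powr s) * ?W)"
          by (intro mult_left_mono D(2)[OF l a int(1,2)]) auto
        also have "\<dots> = ennreal D * (ennreal (l powr (s - 1)) * ?W)"
        proof -
          have "1 / l * (D * l powr s) = D * l powr (s - 1)" using l by (simp add: powr_diff)
          then have "ennreal (1 / l) * ennreal (D * l powr s) = ennreal D * ennreal (l powr (s - 1))"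
            using l D(1) by (simp flip: ennreal_mult)
          then show ?thesis by (simp only: mult.assoc[symmetric])
        qed
        finally show ?thesis using l by simp
      qed (simp add: w_def)
    qed
    also have "\<dots> = ennreal D * fractional_form s (\<lambda>y. norm (osc \<phi> y)) (\<lambda>y. norm (osc \<gamma> y)) x"
      unfolding fractional_form_def by (rule nn_integral_cmult) measurable
    finally have *: "ennreal (norm (complex_of_real c * (\<integral>z. U z \<partial>lborel))) \<le> ennreal D * fractional_form s (\<lambda>y. norm (osc \<phi> y)) (\<lambda>y. norm (osc \<gamma> y)) x" .
    have "ennreal (norm (\<integral>z. U z \<partial>lborel)) = ennreal (1 / c) * ennreal (norm (complex_of_real c * (\<integral>z. U z \<partial>lborel)))"
      using c(1) by (simp add: norm_mult flip: ennreal_mult)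
    also have "\<dots> \<le> ennreal (1 / c) * (ennreal D * fractional_form s (\<lambda>y. norm (osc \<phi> y)) (\<lambda>y. norm (osc \<gamma> y)) x)"
      by (intro mult_left_mono *) auto
    also have "\<dots> = ennreal (D / c) * fractional_form s (\<lambda>y. norm (osc \<phi> y)) (\<lambda>y. norm (osc \<gamma> y)) x"
      using c(1) D(1) by (simp add: mult.assoc[symmetric] flip: ennreal_mult)
    finally show "ennreal (norm (\<integral>z. cis ((x, x) \<bullet> z) * (a z * (\<phi> (fst z) * \<gamma> (snd z))) \<partial>lborel)) \<le>
      ennreal (D / c) * fractional_form s (\<lambda>y. norm (osc \<phi> y)) (\<lambda>y. norm (osc \<gamma> y)) x"
      unfolding U_def .
  qed
qed

section \<open>Schwartz functions\<close>

lemma smooth_on_imp_differentiable: "smooth_on U F \<Longrightarrow> z \<in> U \<Longrightarrow> F differentiable (at z)"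
  unfolding smooth_on_def by (metis C_diff_on.simps(2))

lemma smooth_on_imp_continuous_on: "smooth_on U F \<Longrightarrow> continuous_on U F"
  unfolding smooth_on_def by (metis C_diff_on.simps(1))

lemma smooth_on_dir_deriv: "smooth_on U F \<Longrightarrow> smooth_on U (dir_deriv v F)"
  unfolding smooth_on_def dir_deriv_def by (metis C_diff_on.simps(2))

lemma smooth_on_funpow_dir_deriv: "smooth_on U F \<Longrightarrow> smooth_on U ((dir_deriv v ^^ l) F)"
  by (induction l) (auto intro: smooth_on_dir_deriv)

lemma dir_deriv_has_vector_derivative:
  assumes "F differentiable (at z)"
  shows "((\<lambda>u. F (z + u *\<^sub>R v)) has_vector_derivative dir_deriv v F z) (at 0)"
proof -
  have F: "(F has_derivative frechet_derivative F (at z)) (at z)"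
    using assms by (simp add: frechet_derivative_works)
  have "((\<lambda>u. z + u *\<^sub>R v) has_derivative (\<lambda>u. u *\<^sub>R v)) (at (0::real))"
    by (auto intro!: derivative_eq_intros)
  moreover have "(F has_derivative frechet_derivative F (at z)) (at (z + 0 *\<^sub>R v))" using F by simp
  ultimately have "((\<lambda>u. F (z + u *\<^sub>R v)) has_derivative (\<lambda>u. frechet_derivative F (at z) (u *\<^sub>R v))) (at 0)"
    by (rule has_derivative_compose)
  moreover have "frechet_derivative F (at z) (u *\<^sub>R v) = u *\<^sub>R dir_deriv v F z" for u
    using F by (simp add: dir_deriv_def has_derivative_bounded_linear linear_simps(5))
  ultimately show ?thesis by (simp add: has_vector_derivative_def)
qed

lemma coords: "distinct (coords :: 'n::finite list)" "set (coords :: 'n list) = UNIV"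
proof -
  have "\<exists>xs :: 'n list. distinct xs \<and> set xs = UNIV" using finite_distinct_list[of "UNIV :: 'n set"] by auto
  then have "distinct (coords :: 'n::finite list) \<and> set (coords :: 'n list) = UNIV"
    unfolding coords_def by (rule someI_ex)
  then show "distinct (coords :: 'n::finite list)" "set (coords :: 'n list) = UNIV" by auto
qed

lemma mi_deriv_0: "mi_deriv e (\<lambda>_. 0) F = F"
proof -
  have "foldr (\<lambda>i. dir_deriv (e i) ^^ 0) xs F = F" for xs by (induction xs) auto
  then show ?thesis by (simp add: mi_deriv_def)
qed

text \<open>A pure derivative involves one coordinate only, so the enumeration chosen in
  \<open>coords\<close> has no influence on it.\<close>

lemma mi_deriv_single:
  fixes e :: "'n::finite \<Rightarrow> 'a::euclidean_space"
  shows "mi_deriv e (\<lambda>j. if j = i then l else 0) F = (dir_deriv (e i) ^^ l) F"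
proof -
  have "foldr (\<lambda>j. dir_deriv (e j) ^^ (if j = i then l else 0)) xs F = (if i \<in> set xs then (dir_deriv (e i) ^^ l) F else F)"
    if "distinct xs" for xs
    using that by (induction xs) auto
  then show ?thesis using coords[where 'n='n] by (simp add: mi_deriv_def)
qed

lemma mi_order_0: "mi_order (\<lambda>_. 0) = 0"
  by (simp add: mi_order_def)

lemma mi_order_single: "mi_order (\<lambda>j. if j = i then l else 0) = l"
  by (simp add: mi_order_def)

lemma Basis_vecE:
  assumes "b \<in> (Basis :: (real ^ 'n::finite) set)"
  obtains i where "b = axis i 1"
  using assms by (auto simp: Basis_vec_def)

text \<open>The seminorms with a power of one coordinate give decay in each coordinate separately,
  and \<open>coordinatewise_decay\<close> combines them.\<close>

lemma schwartz_derivative_decay: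
  fixes f :: "real ^ 'n::finite \<Rightarrow> complex"
  assumes "schwartz f"
  obtains C where "\<And>x. (1 + norm x) ^ k * norm ((dir_deriv (axis i 1) ^^ l) f x) \<le> C"
proof -
  let ?D = "(dir_deriv (axis i 1) ^^ l) f"
  have bd: "\<exists>C. \<forall>x. norm ((\<Prod>i\<in>UNIV. (x $ i) ^ \<alpha> i) *\<^sub>R ?D x) \<le> C" for \<alpha>
    using assms mi_deriv_single[of "\<lambda>i. axis i 1" i l f] unfolding schwartz_def by metis
  obtain C0 where C0: "\<And>x. norm (?D x) \<le> C0" using bd[of "\<lambda>_. 0"] by auto
  have "\<exists>C. \<forall>x. \<bar>x $ j\<bar> ^ k * norm (?D x) \<le> C" for j
  proof -
    have eq: "(\<Prod>i\<in>UNIV. (x $ i) ^ (if i = j then k else 0)) = (x $ j) ^ k" for x :: "real ^ 'n"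
    proof -
      have "(\<Prod>i\<in>UNIV. (x $ i) ^ (if i = j then k else 0)) = (\<Prod>i\<in>UNIV. if i = j then (x $ i) ^ k else 1)"
        by (intro prod.cong) auto
      then show ?thesis by simp
    qed
    show ?thesis using bd[of "\<lambda>i. if i = j then k else 0"] unfolding eq by (simp add: power_abs)
  qed
  then obtain C where C: "\<And>j x. \<bar>x $ j\<bar> ^ k * norm (?D x) \<le> C j" by metis
  define A where "A = \<bar>C0\<bar> + (\<Sum>j\<in>UNIV. \<bar>C j\<bar>)"
  have CA: "C j \<le> A" for j
  proof -
    have "\<bar>C j\<bar> \<le> (\<Sum>j\<in>UNIV. \<bar>C j\<bar>)" by (intro member_le_sum) auto
    then show ?thesis by (simp add: A_def)
  qed
  have C0A: "C0 \<le> A" unfolding A_def using sum_nonneg[of UNIV "\<lambda>j. \<bar>C j\<bar>"] by linarith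
  show ?thesis
  proof (rule that)
    show "(1 + norm x) ^ k * norm (?D x) \<le> (2 * real DIM(real ^ 'n)) ^ k * A" for x
    proof (rule coordinatewise_decay)
      fix b :: "real ^ 'n" assume "b \<in> Basis"
      then obtain j where "b = axis j 1" by (rule Basis_vecE)
      then show "\<bar>x \<bullet> b\<bar> ^ k * norm (?D x) \<le> A" using order_trans[OF C[of x j] CA[of j]] by (simp add: inner_axis)
    next
      show "norm (?D x) \<le> A" using C0[of x] C0A by linarith
    qed simp
  qed
qed

lemma integrable_of_decay:
  fixes h :: "'a::euclidean_space \<Rightarrow> complex"
  assumes [measurable]: "h \<in> borel_measurable borel" and h: "\<And>x. (1 + norm x) ^ (DIM('a) + 1) * norm (h x) \<le> C"
  shows "integrable lborel h"
proof -
  obtain C2 where C2: "\<And>l. l > 0 \<Longrightarrow> integrable lborel (\<lambda>z::'a. 1 / (1 + l * norm z) ^ (DIM('a) + 1))"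
    using integrable_weight[where 'a='a] by blast
  show ?thesis
  proof (rule Bochner_Integration.integrable_bound)
    show "integrable lborel (\<lambda>z::'a. C * (1 / (1 + 1 * norm z) ^ (DIM('a) + 1)))"
      by (intro integrable_mult_right C2) simp
    have "norm (h x) \<le> norm (C * (1 / (1 + 1 * norm x) ^ (DIM('a) + 1)))" for x
    proof -
      have "(1 + norm x) ^ (DIM('a) + 1) > 0" by (intro zero_less_power add_pos_nonneg) auto
      then have "norm (h x) \<le> C / (1 + norm x) ^ (DIM('a) + 1)"
        using h[of x] by (simp only: pos_le_divide_eq mult.commute)
      also have "\<dots> \<le> norm (C * (1 / (1 + 1 * norm x) ^ (DIM('a) + 1)))" by (simp add: divide_right_mono)
      finally show ?thesis .
    qed
    then show "AE x in lborel. norm (h x) \<le> norm (C * (1 / (1 + 1 * norm x) ^ (DIM('a) + 1)))" by simp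
  qed simp
qed

lemma schwartz_smooth: "schwartz f \<Longrightarrow> smooth_on UNIV f"
  by (simp add: schwartz_def)

lemma integrable_schwartz_derivative:
  fixes f :: "real ^ 'n::finite \<Rightarrow> complex"
  assumes "schwartz f"
  shows "integrable lborel ((dir_deriv (axis i 1) ^^ l) f)"
proof -
  obtain C where "\<And>x. (1 + norm x) ^ (DIM(real ^ 'n) + 1) * norm ((dir_deriv (axis i 1) ^^ l) f x) \<le> C"
    using schwartz_derivative_decay[OF assms] by blast
  moreover have "(dir_deriv (axis i 1) ^^ l) f \<in> borel_measurable borel"
    using smooth_on_imp_continuous_on[OF smooth_on_funpow_dir_deriv[OF schwartz_smooth[OF assms]]]
    by (rule borel_measurable_continuous_onI)
  ultimately show ?thesis by (intro integrable_of_decay)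
qed

lemma integrable_schwartz: "schwartz f \<Longrightarrow> integrable lborel f"
  for f :: "real ^ 'n::finite \<Rightarrow> complex"
  using integrable_schwartz_derivative[where f=f and i=undefined and l=0] by simp

text \<open>The half-period bound is iterated \<open>k\<close> times in each coordinate direction,
  and the last derivative is bounded through its integral norm.\<close>

lemma osc_schwartz_decay:
  fixes f :: "real ^ 'n::finite \<Rightarrow> complex"
  assumes f: "schwartz f"
  obtains C where "\<And>w. (1 + norm w) ^ k * norm (osc f w) \<le> C"
proof -
  let ?D = "\<lambda>i l. (dir_deriv (axis i 1) ^^ l) f"
  have step: "\<bar>w \<bullet> axis i 1\<bar> * norm (osc (?D i l) w) \<le> 2 * norm (osc (?D i (Suc l)) w)" for i l w
  proof (rule osc_directional_derivative_bound)
    have sm: "smooth_on UNIV (?D i l)" for l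
      by (intro smooth_on_funpow_dir_deriv schwartz_smooth f)
    have der: "((\<lambda>u. ?D i l (z + u *\<^sub>R axis i 1)) has_vector_derivative ?D i (Suc l) z) (at 0)" for z
      using dir_deriv_has_vector_derivative[OF smooth_on_imp_differentiable[OF sm UNIV_I], of l z "axis i 1"] by simp
    show "AE z in lborel. \<forall>u. ((\<lambda>u. ?D i l (z + u *\<^sub>R axis i 1)) has_vector_derivative ?D i (Suc l) (z + u *\<^sub>R axis i 1)) (at u)"
      by (intro AE_I2 allI, rule has_vector_derivative_line_shift[where F="?D i l"], rule der)
    show "AE z in lborel. continuous_on UNIV (\<lambda>u. ?D i (Suc l) (z + u *\<^sub>R axis i 1))"
      by (intro AE_I2 continuous_on_compose2[OF smooth_on_imp_continuous_on[OF sm[of "Suc l"]], where f="\<lambda>u. _ + u *\<^sub>R axis i 1"])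
        (auto intro!: continuous_intros)
  qed (intro integrable_schwartz_derivative f)+
  have iter: "\<bar>w \<bullet> axis i 1\<bar> ^ l * norm (osc f w) \<le> 2 ^ l * norm (osc (?D i l) w)" for i l w
  proof (induction l)
    case (Suc l)
    have "\<bar>w \<bullet> axis i 1\<bar> ^ Suc l * norm (osc f w) = \<bar>w \<bullet> axis i 1\<bar> * (\<bar>w \<bullet> axis i 1\<bar> ^ l * norm (osc f w))" by simp
    also have "\<dots> \<le> \<bar>w \<bullet> axis i 1\<bar> * (2 ^ l * norm (osc (?D i l) w))" by (intro mult_left_mono Suc) auto
    also have "\<dots> = 2 ^ l * (\<bar>w \<bullet> axis i 1\<bar> * norm (osc (?D i l) w))" by simp
    also have "\<dots> \<le> 2 ^ l * (2 * norm (osc (?D i (Suc l)) w))" by (intro mult_left_mono step) auto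
    finally show ?case by simp
  qed simp
  define B where "B i = 2 ^ k * (\<integral>z. norm (?D i k z) \<partial>lborel)" for i
  have B: "\<bar>w \<bullet> axis i 1\<bar> ^ k * norm (osc f w) \<le> B i" for i w
  proof -
    have "norm (osc (?D i k) w) \<le> (\<integral>z. norm (?D i k z) \<partial>lborel)"
      by (rule norm_osc_le[OF integrable_schwartz_derivative[OF f]])
    then have "2 ^ k * norm (osc (?D i k) w) \<le> B i" unfolding B_def by (intro mult_left_mono) auto
    then show ?thesis using iter[of w i k] by linarith
  qed
  have B0: "B i \<ge> 0" for i by (simp add: B_def)
  define A where "A = (\<integral>z. norm (f z) \<partial>lborel) + (\<Sum>i\<in>UNIV. B i)"
  have BA: "B i \<le> A" for i
  proof -
    have "B i \<le> (\<Sum>i\<in>UNIV. B i)" using B0 by (intro member_le_sum) auto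
    moreover have "0 \<le> (\<integral>z. norm (f z) \<partial>lborel)" by simp
    ultimately show ?thesis unfolding A_def by linarith
  qed
  have A0: "norm (osc f w) \<le> A" for w
    using norm_osc_le[OF integrable_schwartz[OF f], of w] sum_nonneg[of UNIV B] B0 by (simp add: A_def)
  show ?thesis
  proof (rule that)
    show "(1 + norm w) ^ k * norm (osc f w) \<le> (2 * real DIM(real ^ 'n)) ^ k * A" for w
    proof (rule coordinatewise_decay)
      fix b :: "real ^ 'n" assume "b \<in> Basis"
      then obtain j where "b = axis j 1" by (rule Basis_vecE)
      then show "\<bar>w \<bullet> b\<bar> ^ k * norm (osc f w) \<le> A" using B[of w j] BA[of j] by simp
    qed (simp_all add: A0)
  qed
qed

section \<open>Fourier transform and multipliers on Schwartz functions\<close>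

lemma fourier_eq_osc: "fourier f \<xi> = complex_of_real ((2 * pi) powr - real CARD('n)) * osc f (- \<xi>)"
  for f :: "real ^ 'n::finite \<Rightarrow> complex"
  by (simp add: fourier_def osc_def inner_commute)

lemma fourier_multiplier_eq_osc:
  "fourier_multiplier \<mu> f = osc (\<lambda>\<xi>. complex_of_real (\<mu> \<xi>) * fourier f \<xi>)"
  by (simp add: fourier_multiplier_def[abs_def] osc_def[abs_def] mult.assoc)

lemma measurable_fourier [measurable]:
  fixes f :: "real ^ 'n::finite \<Rightarrow> complex"
  assumes "f \<in> borel_measurable borel"
  shows "fourier f \<in> borel_measurable borel"
proof -
  have [measurable]: "osc f \<in> borel_measurable borel" using assms by measurable
  show ?thesis unfolding fourier_eq_osc[abs_def] by measurable
qed

text \<open>The multiplier grows at most like \<open>(1 + norm \<xi>) powr r\<close>, while the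
  transform of a Schwartz function decays faster than every power.\<close>

lemma integrable_multiplier_fourier:
  fixes f :: "real ^ 'n::finite \<Rightarrow> complex"
  assumes f: "schwartz f" and k: "0 \<le> \<kappa>" "\<kappa> \<le> 1" and r: "0 \<le> r"
  shows "integrable lborel (\<lambda>\<xi>. complex_of_real ((\<kappa> + (norm \<xi>)\<^sup>2) powr (r / 2)) * fourier f \<xi>)"
proof -
  have [measurable]: "f \<in> borel_measurable borel" using integrable_schwartz[OF f] by auto
  obtain j :: nat where j: "r \<le> real j" using real_arch_simple by blast
  obtain C where C: "\<And>w. (1 + norm w) ^ (j + (DIM(real ^ 'n) + 1)) * norm (osc f w) \<le> C"
    using osc_schwartz_decay[OF f] by blast
  let ?c = "(2 * pi) powr - real CARD('n)"
  show ?thesis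
  proof (rule integrable_of_decay)
    show "(1 + norm \<xi>) ^ (DIM(real ^ 'n) + 1) * norm (complex_of_real ((\<kappa> + (norm \<xi>)\<^sup>2) powr (r / 2)) * fourier f \<xi>) \<le> ?c * C" for \<xi> :: "real ^ 'n"
    proof -
      have "\<kappa> + (norm \<xi>)\<^sup>2 \<le> (1 + norm \<xi>)\<^sup>2" using k norm_ge_zero[of \<xi>] unfolding power2_sum power_one by linarith
      then have "(\<kappa> + (norm \<xi>)\<^sup>2) powr (r / 2) \<le> ((1 + norm \<xi>)\<^sup>2) powr (r / 2)"
        using k r by (intro powr_mono2) auto
      also have "\<dots> = (1 + norm \<xi>) powr r"
      proof -
        have "(1 + norm \<xi>)\<^sup>2 = (1 + norm \<xi>) powr 2" by (simp add: add_pos_nonneg)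
        then show ?thesis by (simp only: powr_powr) simp
      qed
      also have "\<dots> \<le> (1 + norm \<xi>) powr real j" using j by (intro powr_mono) auto
      also have "\<dots> = (1 + norm \<xi>) ^ j" by (intro powr_realpow) (simp add: add_pos_nonneg)
      finally have le: "(\<kappa> + (norm \<xi>)\<^sup>2) powr (r / 2) \<le> (1 + norm \<xi>) ^ j" .
      have "(1 + norm \<xi>) ^ (DIM(real ^ 'n) + 1) * norm (complex_of_real ((\<kappa> + (norm \<xi>)\<^sup>2) powr (r / 2)) * fourier f \<xi>)
        = (\<kappa> + (norm \<xi>)\<^sup>2) powr (r / 2) * (?c * ((1 + norm \<xi>) ^ (DIM(real ^ 'n) + 1) * norm (osc f (- \<xi>))))"
        by (simp add: fourier_eq_osc norm_mult)
      also have "\<dots> \<le> (1 + norm \<xi>) ^ j * (?c * ((1 + norm \<xi>) ^ (DIM(real ^ 'n) + 1) * norm (osc f (- \<xi>))))"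
        by (intro mult_right_mono le) auto
      also have "\<dots> = ?c * ((1 + norm (- \<xi>)) ^ (j + (DIM(real ^ 'n) + 1)) * norm (osc f (- \<xi>)))"
        by (simp add: power_add)
      also have "\<dots> \<le> ?c * C" by (intro mult_left_mono C) auto
      finally show ?thesis .
    qed
  qed measurable
qed

lemma integrable_fourier:
  fixes f :: "real ^ 'n::finite \<Rightarrow> complex"
  assumes f: "schwartz f"
  shows "integrable lborel (fourier f)"
proof -
  have "1 + (norm (\<xi> :: real ^ 'n))\<^sup>2 \<noteq> 0" for \<xi> by (smt (verit) zero_le_power2)
  then show ?thesis using integrable_multiplier_fourier[OF f, of 1 0] by simp
qed

text \<open>This puts \<open>f\<close> itself into the final bound, where the multiplier estimate
  produces \<open>osc\<close> of its transform.\<close>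

lemma osc_fourier:
  fixes f :: "real ^ 'n::finite \<Rightarrow> complex"
  assumes f: "schwartz f"
  shows "osc (fourier f) = f"
proof
  fix x
  have cont: "continuous_on UNIV f" by (intro smooth_on_imp_continuous_on schwartz_smooth f)
  have int: "integrable lborel f" by (rule integrable_schwartz[OF f])
  have [measurable]: "f \<in> borel_measurable borel" using int by auto
  \<comment> \<open>Power 0 and order 0: this is the bound on \<open>f\<close> that inversion
    requires.\<close>
  obtain B where B: "\<And>x. (1 + norm x) ^ 0 * norm ((dir_deriv (axis undefined 1) ^^ 0) f x) \<le> B"
    using schwartz_derivative_decay[OF f] by blast
  obtain C where C: "\<And>w. (1 + norm w) ^ (DIM(real ^ 'n) + 1) * norm (osc f w) \<le> C"
    using osc_schwartz_decay[OF f] by blast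
  have io: "integrable lborel (osc f)" by (rule integrable_of_decay[OF _ C]) measurable
  let ?c = "complex_of_real ((2 * pi) powr - real CARD('n))"
  have "osc (fourier f) x = (\<integral>\<xi>. ?c * (cis (x \<bullet> \<xi>) * osc f (- \<xi>)) \<partial>lborel)"
    unfolding osc_def[of "fourier f"] by (simp add: fourier_eq_osc mult.left_commute)
  also have "\<dots> = ?c * (\<integral>\<xi>. cis (x \<bullet> \<xi>) * osc f (- \<xi>) \<partial>lborel)" by (rule integral_mult_right_zero)
  also have "(\<integral>\<xi>. cis (x \<bullet> \<xi>) * osc f (- \<xi>) \<partial>lborel) = \<bar>-1\<bar> ^ DIM(real ^ 'n) *\<^sub>R (\<integral>\<xi>. cis (x \<bullet> (0 + (-1) *\<^sub>R \<xi>)) * osc f (- (0 + (-1) *\<^sub>R \<xi>)) \<partial>lborel)"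
    by (rule integral_lborel_affine(1)) auto
  also have "\<dots> = (\<integral>\<xi>. cis (- (\<xi> \<bullet> x)) * osc f \<xi> \<partial>lborel)" by (simp add: inner_commute)
  also have "\<dots> = (2 * pi) ^ DIM(real ^ 'n) * f x"
    using B cont by (intro osc_inversion[OF int _ _ io]) (auto simp: continuous_on_eq_continuous_at)
  also have "?c * ((2 * pi) ^ DIM(real ^ 'n) * f x) = f x"
  proof -
    have "(2 * pi) powr - real CARD('n) * (2 * pi) ^ CARD('n) = 1"
    proof -
      have "(2 * pi) ^ CARD('n) = (2 * pi) powr real CARD('n)" by (rule powr_realpow[symmetric]) simp
      then show ?thesis by (simp only: powr_add[symmetric]) simp
    qed
    then have "?c * (2 * pi) ^ CARD('n) = 1" by (metis of_real_1 of_real_mult of_real_numeral of_real_power)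
    then show ?thesis by (simp add: mult.assoc[symmetric])
  qed
  finally show "osc (fourier f) x = f x" .
qed

section \<open>Splitting the symbol\<close>

text \<open>An explicit sequence of successive derivatives is what the symbol classes provide; here
  it is brought into the recursive form of \<open>dsym\<close>.\<close>

lemma (in scaled_direction) csym_of_iterates:
  assumes "\<And>l. l \<le> L \<Longrightarrow> continuous_on (- {0}) (A l)"
    and "\<And>l z. l \<le> L \<Longrightarrow> z \<noteq> 0 \<Longrightarrow> norm (A l z) \<le> V z / R z ^ l"
    and "\<And>l z. l < L \<Longrightarrow> z \<noteq> 0 \<Longrightarrow> ((\<lambda>u. A l (z + u *\<^sub>R e)) has_vector_derivative A (Suc l) z) (at 0)"
  shows "csym L V (A 0)"
  using assms
proof (induction L arbitrary: V A)
  case 0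
  then show ?case by simp
next
  case (Suc L)
  have "csym L (\<lambda>z. V z / R z) (A (Suc 0))"
  proof (rule Suc.IH[of "\<lambda>l. A (Suc l)"])
    fix l and z :: 'a assume "l \<le> L" "z \<noteq> 0"
    then show "norm (A (Suc l) z) \<le> V z / R z / R z ^ l" using Suc.prems(2)[of "Suc l" z] by simp
  qed (use Suc.prems in auto)
  then show ?case using Suc.prems(1)[of 0] Suc.prems(2)[of 0] Suc.prems(3)[of 0] by (intro csym_SucI[where a'="A (Suc 0)"]) auto
qed

text \<open>\<open>\<kappa> * \<kappa> = \<kappa>\<close> singles out the values 0 and 1, so that
  \<open>\<kappa>\<close> agrees with its own square in the comparison. The bracket replaces the
  weight of the symbol classes because its square is a polynomial.\<close>

lemma bracket_comparable:
  fixes \<xi> \<eta> :: "'a::euclidean_space"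
  assumes k: "0 \<le> \<kappa>" "\<kappa> * \<kappa> = \<kappa>"
  shows "bracket \<kappa> (\<xi>, \<eta>) \<le> \<kappa> + norm \<xi> + norm \<eta>" "\<kappa> + norm \<xi> + norm \<eta> \<le> 3 * bracket \<kappa> (\<xi>, \<eta>)"
proof -
  have b: "bracket \<kappa> (\<xi>, \<eta>) = sqrt (\<kappa> + (norm \<xi>)\<^sup>2 + (norm \<eta>)\<^sup>2)"
    by (simp add: bracket_def power2_norm_eq_inner add.assoc)
  have "\<kappa> + (norm \<xi>)\<^sup>2 + (norm \<eta>)\<^sup>2 \<le> (\<kappa> + norm \<xi> + norm \<eta>)\<^sup>2"
  proof -
    have "(\<kappa> + norm \<xi> + norm \<eta>)\<^sup>2 = \<kappa> * \<kappa> + (norm \<xi>)\<^sup>2 + (norm \<eta>)\<^sup>2 + 2 * (\<kappa> * norm \<xi> + \<kappa> * norm \<eta> + norm \<xi> * norm \<eta>)"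
      by (simp add: power2_eq_square algebra_simps)
    moreover have "0 \<le> \<kappa> * norm \<xi> + \<kappa> * norm \<eta> + norm \<xi> * norm \<eta>" using k(1) by simp
    moreover have "k + b + c \<le> a" if "a = k * k + b + c + 2 * d" "0 \<le> d" "k * k = k" for a b c d k :: real
      using that by simp
    ultimately show ?thesis using k(2) by blast
  qed
  then show "bracket \<kappa> (\<xi>, \<eta>) \<le> \<kappa> + norm \<xi> + norm \<eta>"
    unfolding b using k(1) by (intro real_le_lsqrt) auto
  have "\<kappa> \<le> sqrt (\<kappa> + (norm \<xi>)\<^sup>2 + (norm \<eta>)\<^sup>2)"
  proof (rule real_le_rsqrt)
    have "\<kappa>\<^sup>2 = \<kappa>" using k(2) by (simp only: power2_eq_square)
    then show "\<kappa>\<^sup>2 \<le> \<kappa> + (norm \<xi>)\<^sup>2 + (norm \<eta>)\<^sup>2" by simp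
  qed
  moreover have "norm \<xi> \<le> sqrt (\<kappa> + (norm \<xi>)\<^sup>2 + (norm \<eta>)\<^sup>2)"
    using k by (intro real_le_rsqrt) simp
  moreover have "norm \<eta> \<le> sqrt (\<kappa> + (norm \<xi>)\<^sup>2 + (norm \<eta>)\<^sup>2)"
    using k by (intro real_le_rsqrt) simp
  ultimately show "\<kappa> + norm \<xi> + norm \<eta> \<le> 3 * bracket \<kappa> (\<xi>, \<eta>)" unfolding b by linarith
qed

lemma powr_comparable:
  assumes "0 < b" "b \<le> t" "t \<le> 3 * b"
  shows "t powr p \<le> 3 powr \<bar>p\<bar> * b powr (p::real)"
proof (cases "p \<ge> 0")
  case True
  have "t powr p \<le> (3 * b) powr p" using assms True by (intro powr_mono2) auto
  then show ?thesis using True assms by (simp add: powr_mult)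
next
  case False
  have "t powr p \<le> b powr p" using assms False by (intro powr_mono2') auto
  also have "\<dots> \<le> 3 powr \<bar>p\<bar> * b powr p"
    using mult_right_mono[of 1 "3 powr \<bar>p\<bar>" "b powr p"] by (simp add: ge_one_powr_ge_zero)
  finally show ?thesis .
qed

lemma Basis_prodE:
  assumes "e \<in> (Basis :: ((real ^ 'n::finite) \<times> (real ^ 'n)) set)"
  obtains i where "e = (axis i 1, 0)" | i where "e = (0, axis i 1)"
  using assms by (auto simp: Basis_prod_def elim!: Basis_vecE)

text \<open>A basis vector of the frequency space is a coordinate direction of \<xi> or of \<eta>,
  so its pure derivatives are instances of \<open>symbol_deriv\<close> with one nonzero
  multi-index.\<close>

lemma symbol_derivative_estimate:
  fixes \<sigma> :: "'n::finite symbol"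
  assumes bd: "\<And>\<beta> \<gamma>. \<exists>C. \<forall>x \<xi> \<eta>. (\<xi>, \<eta>) \<noteq> (0, 0) \<longrightarrow>
       norm (symbol_deriv (\<lambda>_. 0) \<beta> \<gamma> \<sigma> (x, \<xi>, \<eta>)) \<le> C * (\<kappa> + norm \<xi> + norm \<eta>) powr (m - (real (mi_order \<beta>) + real (mi_order \<gamma>)))"
    and e: "e \<in> Basis"
  shows "\<exists>C. \<forall>x \<xi> \<eta>. (\<xi>, \<eta>) \<noteq> (0, 0) \<longrightarrow>
       norm ((dir_deriv (0, e) ^^ l) \<sigma> (x, \<xi>, \<eta>)) \<le> C * (\<kappa> + norm \<xi> + norm \<eta>) powr (m - real l)"
  using e
proof (cases rule: Basis_prodE)
  case (1 i)
  have "symbol_deriv (\<lambda>_. 0) (\<lambda>j. if j = i then l else 0) (\<lambda>_. 0) \<sigma> = (dir_deriv (0, e) ^^ l) \<sigma>"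
    by (simp add: symbol_deriv_def mi_deriv_0 mi_deriv_single 1)
  then show ?thesis using bd[of "\<lambda>j. if j = i then l else 0" "\<lambda>_. 0"] by (simp add: mi_order_0 mi_order_single)
next
  case (2 i)
  have "symbol_deriv (\<lambda>_. 0) (\<lambda>_. 0) (\<lambda>j. if j = i then l else 0) \<sigma> = (dir_deriv (0, e) ^^ l) \<sigma>"
    by (simp add: symbol_deriv_def mi_deriv_0 mi_deriv_single 2)
  then show ?thesis using bd[of "\<lambda>_. 0" "\<lambda>j. if j = i then l else 0"] by (simp add: mi_order_0 mi_order_single)
qed

text \<open>The point \<open>x\<close> is a mere parameter on which the constants of the symbol
  estimates do not depend; the finitely many orders up to \<open>L\<close> are absorbed by summing
  their constants.\<close>

lemma dsym_symbol_direction: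
  fixes \<sigma> :: "'n::finite symbol"
  assumes k: "0 \<le> \<kappa>" "\<kappa> * \<kappa> = \<kappa>" and sm: "smooth_on U \<sigma>" and U: "{(x, \<xi>, \<eta>). (\<xi>, \<eta>) \<noteq> (0, 0)} \<subseteq> U"
    and bd: "\<And>\<beta> \<gamma>. \<exists>C. \<forall>x \<xi> \<eta>. (\<xi>, \<eta>) \<noteq> (0, 0) \<longrightarrow>
       norm (symbol_deriv (\<lambda>_. 0) \<beta> \<gamma> \<sigma> (x, \<xi>, \<eta>)) \<le> C * (\<kappa> + norm \<xi> + norm \<eta>) powr (m - (real (mi_order \<beta>) + real (mi_order \<gamma>)))"
    and e: "e \<in> Basis"
  shows "\<exists>C\<ge>0. \<forall>x. dsym \<kappa> e L (\<lambda>z. C * bracket \<kappa> z powr m) (\<lambda>z. \<sigma> (x, z))"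
proof -
  interpret scaled_direction \<kappa> e by (rule norm_Basis_scaled_direction[OF k(1) e])
  let ?D = "\<lambda>l. (dir_deriv (0, e) ^^ l) \<sigma>"
  have "\<exists>C. \<forall>l x \<xi> \<eta>. (\<xi>, \<eta>) \<noteq> (0, 0) \<longrightarrow> norm (?D l (x, \<xi>, \<eta>)) \<le> C l * (\<kappa> + norm \<xi> + norm \<eta>) powr (m - real l)"
    by (rule choice) (intro allI symbol_derivative_estimate bd e)
  then obtain C where C: "\<And>l x \<xi> \<eta>. (\<xi>, \<eta>) \<noteq> (0, 0) \<Longrightarrow> norm (?D l (x, \<xi>, \<eta>)) \<le> C l * (\<kappa> + norm \<xi> + norm \<eta>) powr (m - real l)"
    by blast
  define B where "B = (\<Sum>l\<le>L. \<bar>C l\<bar> * 3 powr \<bar>m - real l\<bar>)"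
  have sml: "smooth_on U (?D l)" for l by (rule smooth_on_funpow_dir_deriv[OF sm])
  have inU: "(x, z) \<in> U" if "z \<noteq> 0" for x z
    using U that by (cases z) (auto simp: zero_prod_def)
  have "csym L (\<lambda>z. B * R z powr m) (\<lambda>z. ?D 0 (x, z))" for x
  proof (rule csym_of_iterates)
    fix l assume "l \<le> L"
    show "continuous_on (- {0}) (\<lambda>z. ?D l (x, z))"
      by (rule continuous_on_compose2[OF smooth_on_imp_continuous_on[OF sml], where f="\<lambda>z. (x, z)"])
        (use inU in \<open>auto intro!: continuous_intros\<close>)
  next
    fix l and z :: "(real ^ 'n) \<times> (real ^ 'n)" assume l: "l \<le> L" and z: "z \<noteq> 0"
    obtain \<xi> \<eta> where zz: "z = (\<xi>, \<eta>)" by (cases z)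
    have nz: "(\<xi>, \<eta>) \<noteq> (0, 0)" using z zz by (simp add: zero_prod_def)
    let ?t = "\<kappa> + norm \<xi> + norm \<eta>"
    have Rz: "R z > 0" by (rule R_pos[OF z])
    have t: "R z \<le> ?t" "?t \<le> 3 * R z" unfolding zz by (rule bracket_comparable[OF k])+
    have "norm (?D l (x, z)) \<le> C l * ?t powr (m - real l)" unfolding zz by (rule C[OF nz])
    also have "\<dots> \<le> \<bar>C l\<bar> * (3 powr \<bar>m - real l\<bar> * R z powr (m - real l))"
      by (intro mult_mono powr_comparable Rz t) auto
    also have "\<dots> = \<bar>C l\<bar> * 3 powr \<bar>m - real l\<bar> * R z powr (m - real l)" by simp
    also have "\<dots> \<le> B * R z powr (m - real l)"
      unfolding B_def using l by (intro mult_right_mono member_le_sum) auto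
    also have "R z powr (m - real l) = R z powr m / R z ^ l"
      using Rz by (simp add: powr_diff powr_realpow)
    finally show "norm (?D l (x, z)) \<le> B * R z powr m / R z ^ l" by simp
  next
    fix l and z :: "(real ^ 'n) \<times> (real ^ 'n)" assume z: "z \<noteq> 0"
    have "((\<lambda>u. ?D l ((x, z) + u *\<^sub>R (0, e))) has_vector_derivative ?D (Suc l) (x, z)) (at 0)"
      using dir_deriv_has_vector_derivative[OF smooth_on_imp_differentiable[OF sml[of l] inU[OF z, of x]], of "(0, e)"] by simp
    then show "((\<lambda>u. ?D l (x, z + u *\<^sub>R e)) has_vector_derivative ?D (Suc l) (x, z)) (at 0)"
      by simp
  qed
  moreover have "B \<ge> 0" unfolding B_def by (intro sum_nonneg) auto
  ultimately show ?thesis by auto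
qed

section \<open>Partition of unity in frequency\<close>

lemma proj_fst: "linear (\<lambda>z :: 'a::euclidean_space \<times> 'a. (fst z, 0 :: 'a))"
  "(fst z, 0 :: 'a) \<bullet> (fst w, 0) = z \<bullet> (fst w, 0)"
  by (auto intro!: linearI simp: inner_prod_def)

lemma proj_snd: "linear (\<lambda>z :: 'a::euclidean_space \<times> 'a. (0 :: 'a, snd z))"
  "(0 :: 'a, snd z) \<bullet> (0, snd w) = z \<bullet> (0, snd w)"
  by (auto intro!: linearI simp: inner_prod_def)

definition wt :: "real \<Rightarrow> 'a::euclidean_space \<Rightarrow> real" where
  "wt \<kappa> \<xi> = \<kappa> + (norm \<xi>)\<^sup>2"

text \<open>
  \<open>splitting \<kappa> P r \<zeta> \<xi> \<eta> * wt \<kappa> \<zeta> powr (r / 2)\<close> for \<open>\<zeta> = \<xi>\<close> and \<open>\<zeta> = \<eta>\<close> are the two members of a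
  partition of unity. A power \<open>wt \<kappa> \<zeta> powr (P - r / 2)\<close> of large exponent is as smooth at \<open>\<zeta> = 0\<close>
  as the kernel estimate requires, also for \<open>\<kappa> = 0\<close>.
\<close>

definition splitting :: "real \<Rightarrow> nat \<Rightarrow> real \<Rightarrow> 'a::euclidean_space \<Rightarrow> 'a \<Rightarrow> 'a \<Rightarrow> real" where
  "splitting \<kappa> P r \<zeta> \<xi> \<eta> = wt \<kappa> \<zeta> powr (real P - r / 2) * inverse (wt \<kappa> \<xi> ^ P + wt \<kappa> \<eta> ^ P)"

text \<open>The numerator of \<open>splitting\<close> has order \<open>2 * P - r\<close> and the
  denominator order \<open>2 * P\<close>, so the factor lowers the order by \<open>r\<close>. The
  lower bound on \<open>P\<close> leaves the numerator enough derivatives on the subspace where its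
  weight may vanish. The constant is chosen before \<open>a\<close>, hence uniform in the parameter
  \<open>x\<close>.\<close>

lemma dsym_splitting_direction:
  fixes e :: "'a::euclidean_space \<times> 'a"
  assumes k: "0 \<le> \<kappa>" and e: "e \<in> Basis" and P: "real L < real P - r / 2" and C0: "C0 \<ge> 0"
  shows "\<exists>C\<ge>0. \<forall>a. dsym \<kappa> e L (\<lambda>z. C0 * bracket \<kappa> z powr m) a \<longrightarrow>
     dsym \<kappa> e L (\<lambda>z. C * bracket \<kappa> z powr (m - r)) (\<lambda>z. a z * of_real (splitting \<kappa> P r (fst z) (fst z) (snd z))) \<and>
     dsym \<kappa> e L (\<lambda>z. C * bracket \<kappa> z powr (m - r)) (\<lambda>z. a z * of_real (splitting \<kappa> P r (snd z) (fst z) (snd z)))"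
proof -
  interpret scaled_direction \<kappa> e by (rule norm_Basis_scaled_direction[OF k e])
  have q1: "qform (\<lambda>z. (fst z, 0)) z = wt \<kappa> (fst z)" for z :: "'a \<times> 'a"
    using qform_def[OF proj_fst, of z] by (simp add: wt_def power2_norm_eq_inner)
  have q2: "qform (\<lambda>z. (0, snd z)) z = wt \<kappa> (snd z)" for z :: "'a \<times> 'a"
    using qform_def[OF proj_snd, of z] by (simp add: wt_def power2_norm_eq_inner)
  have wt0: "wt \<kappa> \<xi> \<ge> 0" for \<xi> :: 'a using k by (simp add: wt_def)
  define KK where "KK = 2 * (2 ^ L * 2 :: real) ^ P"
  have KK: "KK > 0" by (simp add: KK_def)
  let ?V = "\<lambda>z. (2 ^ L * (2 * (R z)\<^sup>2)) ^ P + (2 ^ L * (2 * (R z)\<^sup>2)) ^ P"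
  have V: "?V z = KK * ((R z)\<^sup>2) ^ P" for z by (simp add: KK_def power_mult_distrib)
  have den: "csym L ?V (\<lambda>z. of_real (wt \<kappa> (fst z)) ^ P + of_real (wt \<kappa> (snd z)) ^ P)"
    using csym_add[OF csym_power[OF csym_qform[OF proj_fst], of L P] csym_power[OF csym_qform[OF proj_snd], of L P]]
    by (simp only: q1 q2)
  \<comment> \<open>Chosen to match the lower bound of the denominator: one of the two weights is at
    least half of \<open>(R z)\<^sup>2\<close>.\<close>
  define c where "c = 1 / (2 ^ P * KK)"
  have c: "c > 0" using KK by (simp add: c_def)
  obtain C1 where C1: "C1 > 0" "\<And>V b. csym L V b \<Longrightarrow> (\<And>z. z \<noteq> 0 \<Longrightarrow> 0 < V z \<and> c * V z \<le> norm (b z)) \<Longrightarrow> csym L (\<lambda>z. C1 / V z) (\<lambda>z. inverse (b z))"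
    using csym_inverse[OF c, of L] by auto
  have inv: "csym L (\<lambda>z. C1 / ?V z) (\<lambda>z. inverse (of_real (wt \<kappa> (fst z)) ^ P + of_real (wt \<kappa> (snd z)) ^ P))"
  proof (rule C1(2)[OF den])
    fix z :: "'a \<times> 'a" assume z: "z \<noteq> 0"
    have "(R z)\<^sup>2 \<le> wt \<kappa> (fst z) + wt \<kappa> (snd z)"
      using k unfolding R_power2 by (simp add: wt_def power2_norm_eq_inner inner_prod_def)
    then have "(R z)\<^sup>2 / 2 \<le> wt \<kappa> (fst z) \<or> (R z)\<^sup>2 / 2 \<le> wt \<kappa> (snd z)" by linarith
    then have "((R z)\<^sup>2 / 2) ^ P \<le> wt \<kappa> (fst z) ^ P + wt \<kappa> (snd z) ^ P"
    proof
      assume "(R z)\<^sup>2 / 2 \<le> wt \<kappa> (fst z)"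
      then have "((R z)\<^sup>2 / 2) ^ P \<le> wt \<kappa> (fst z) ^ P" by (intro power_mono) auto
      then show ?thesis using wt0[of "snd z"] by (simp add: add_increasing2)
    next
      assume "(R z)\<^sup>2 / 2 \<le> wt \<kappa> (snd z)"
      then have "((R z)\<^sup>2 / 2) ^ P \<le> wt \<kappa> (snd z) ^ P" by (intro power_mono) auto
      then show ?thesis using wt0[of "fst z"] by (simp add: add_increasing)
    qed
    moreover have "norm (complex_of_real (wt \<kappa> (fst z)) ^ P + of_real (wt \<kappa> (snd z)) ^ P) = wt \<kappa> (fst z) ^ P + wt \<kappa> (snd z) ^ P"
    proof -
      have "complex_of_real (wt \<kappa> (fst z)) ^ P + of_real (wt \<kappa> (snd z)) ^ P = of_real (wt \<kappa> (fst z) ^ P + wt \<kappa> (snd z) ^ P)" by simp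
      then show ?thesis using wt0 by (simp only: norm_of_real) (simp add: abs_of_nonneg)
    qed
    moreover have "c * ?V z = ((R z)\<^sup>2 / 2) ^ P" unfolding V using KK by (simp add: c_def power_divide)
    moreover have "?V z > 0" unfolding V using KK R_pos[OF z] by simp
    ultimately show "0 < ?V z \<and> c * ?V z \<le> norm (complex_of_real (wt \<kappa> (fst z)) ^ P + of_real (wt \<kappa> (snd z)) ^ P)" by simp
  qed
  obtain A1 where A1: "A1 > 0" "csym L (\<lambda>z. A1 * R z powr (2 * (real P - r / 2))) (\<lambda>z. of_real (wt \<kappa> (fst z) powr (real P - r / 2)))"
    using csym_qform_powr[OF proj_fst P] unfolding q1 by blast
  obtain A2 where A2: "A2 > 0" "csym L (\<lambda>z. A2 * R z powr (2 * (real P - r / 2))) (\<lambda>z. of_real (wt \<kappa> (snd z) powr (real P - r / 2)))"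
    using csym_qform_powr[OF proj_snd P] unfolding q2 by blast
  define C where "C = 2 ^ L * C0 * (2 ^ L * (A1 + A2) * (C1 / KK))"
  have main: "csym L (\<lambda>z. C * R z powr (m - r)) (\<lambda>z. a z * of_real (h z * inverse (wt \<kappa> (fst z) ^ P + wt \<kappa> (snd z) ^ P)))"
    if a: "csym L (\<lambda>z. C0 * R z powr m) a" and h: "csym L (\<lambda>z. A * R z powr (2 * (real P - r / 2))) (\<lambda>z. of_real (h z))" and A: "0 < A" "A \<le> A1 + A2"
    for a h A
  proof -
    have "csym L (\<lambda>z. 2 ^ L * (C0 * R z powr m * (2 ^ L * (A * R z powr (2 * (real P - r / 2)) * (C1 / ?V z)))))
      (\<lambda>z. a z * (of_real (h z) * inverse (of_real (wt \<kappa> (fst z)) ^ P + of_real (wt \<kappa> (snd z)) ^ P)))"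
      by (intro csym_mult a h inv)
    then have "csym L (\<lambda>z. C * R z powr (m - r)) (\<lambda>z. a z * (of_real (h z) * inverse (of_real (wt \<kappa> (fst z)) ^ P + of_real (wt \<kappa> (snd z)) ^ P)))"
    proof (rule csym_mono)
      fix z :: "'a \<times> 'a" assume z: "z \<noteq> 0"
      have Rz: "R z > 0" by (rule R_pos[OF z])
      have p: "R z powr m * (R z powr (2 * (real P - r / 2)) / ((R z)\<^sup>2) ^ P) = R z powr (m - r)"
      proof -
        have "R z powr m * (R z powr (2 * (real P - r / 2)) / R z powr (2 * real P)) = R z powr (m + (2 * (real P - r / 2) - 2 * real P))"
          by (simp only: powr_add powr_diff)
        then show ?thesis unfolding power2_power_eq_powr[OF Rz] by (simp add: algebra_simps)
      qed
      have "2 ^ L * (C0 * R z powr m * (2 ^ L * (A * R z powr (2 * (real P - r / 2)) * (C1 / ?V z))))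
        = 2 ^ L * C0 * (2 ^ L * A * (C1 / KK)) * (R z powr m * (R z powr (2 * (real P - r / 2)) / ((R z)\<^sup>2) ^ P))"
        unfolding V by simp
      also have "\<dots> = 2 ^ L * C0 * (2 ^ L * A * (C1 / KK)) * R z powr (m - r)" unfolding p ..
      also have "\<dots> \<le> C * R z powr (m - r)"
        unfolding C_def using C0 C1(1) KK A by (intro mult_right_mono mult_left_mono) auto
      finally show "2 ^ L * (C0 * R z powr m * (2 ^ L * (A * R z powr (2 * (real P - r / 2)) * (C1 / ?V z)))) \<le> C * R z powr (m - r)" .
    qed
    then show ?thesis by simp
  qed
  show ?thesis
  proof (intro exI[of _ C] conjI allI impI)
    show "C \<ge> 0" using C0 C1(1) KK A1(1) A2(1) by (simp add: C_def)
    fix a assume a: "csym L (\<lambda>z. C0 * R z powr m) a"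
    show "csym L (\<lambda>z. C * R z powr (m - r)) (\<lambda>z. a z * of_real (splitting \<kappa> P r (fst z) (fst z) (snd z)))"
      unfolding splitting_def by (rule main[OF a A1(2) A1(1)]) (use A2(1) in simp)
    show "csym L (\<lambda>z. C * R z powr (m - r)) (\<lambda>z. a z * of_real (splitting \<kappa> P r (snd z) (fst z) (snd z)))"
      unfolding splitting_def by (rule main[OF a A2(2) A2(1)]) (use A1(1) in simp)
  qed
qed

text \<open>The exponents \<open>P - r / 2\<close> and \<open>r / 2\<close> add up to
  \<open>P\<close>, and the two quotients share their denominator. The signs matter too: each part
  is dominated by the whole, which makes the split integrands integrable.\<close>

lemma splitting_identity:
  assumes k: "0 \<le> \<kappa>" and nz: "(\<xi>, \<eta>) \<noteq> (0, 0)" and P: "P > 0"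
  shows "splitting \<kappa> P r \<xi> \<xi> \<eta> * wt \<kappa> \<xi> powr (r / 2) + splitting \<kappa> P r \<eta> \<xi> \<eta> * wt \<kappa> \<eta> powr (r / 2) = 1"
    and "0 \<le> splitting \<kappa> P r \<xi> \<xi> \<eta> * wt \<kappa> \<xi> powr (r / 2)" "0 \<le> splitting \<kappa> P r \<eta> \<xi> \<eta> * wt \<kappa> \<eta> powr (r / 2)"
proof -
  have wt0: "wt \<kappa> \<xi> \<ge> 0" for \<xi> :: 'a using k by (simp add: wt_def)
  have eq: "wt \<kappa> \<zeta> powr (real P - r / 2) * wt \<kappa> \<zeta> powr (r / 2) = wt \<kappa> \<zeta> ^ P" for \<zeta> :: 'a
  proof (cases "wt \<kappa> \<zeta> = 0")
    case False
    then have "wt \<kappa> \<zeta> > 0" using wt0[of \<zeta>] by simp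
    then show ?thesis by (simp add: powr_add[symmetric] powr_realpow)
  \<comment> \<open>Where the weight vanishes both sides are 0 because \<open>P > 0\<close>.\<close>
  qed (use P in simp)
  have "wt \<kappa> \<xi> > 0 \<or> wt \<kappa> \<eta> > 0" using nz k by (auto simp: wt_def intro: add_nonneg_pos)
  then have d: "wt \<kappa> \<xi> ^ P + wt \<kappa> \<eta> ^ P > 0" using wt0 by (auto intro: add_pos_nonneg add_nonneg_pos)
  have "splitting \<kappa> P r \<xi> \<xi> \<eta> * wt \<kappa> \<xi> powr (r / 2) = wt \<kappa> \<xi> ^ P * inverse (wt \<kappa> \<xi> ^ P + wt \<kappa> \<eta> ^ P)"
    unfolding splitting_def eq[symmetric] by (simp add: mult_ac)
  moreover have "splitting \<kappa> P r \<eta> \<xi> \<eta> * wt \<kappa> \<eta> powr (r / 2) = wt \<kappa> \<eta> ^ P * inverse (wt \<kappa> \<xi> ^ P + wt \<kappa> \<eta> ^ P)"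
    unfolding splitting_def eq[symmetric] by (simp add: mult_ac)
  ultimately show "splitting \<kappa> P r \<xi> \<xi> \<eta> * wt \<kappa> \<xi> powr (r / 2) + splitting \<kappa> P r \<eta> \<xi> \<eta> * wt \<kappa> \<eta> powr (r / 2) = 1"
    "0 \<le> splitting \<kappa> P r \<xi> \<xi> \<eta> * wt \<kappa> \<xi> powr (r / 2)" "0 \<le> splitting \<kappa> P r \<eta> \<xi> \<eta> * wt \<kappa> \<eta> powr (r / 2)"
    using d wt0 by (simp_all add: distrib_right[symmetric] less_imp_le)
qed

lemma dsym_mono_const:
  assumes "0 \<le> \<kappa>" "e \<in> Basis" "dsym \<kappa> e L (\<lambda>z. A * bracket \<kappa> z powr m) a" "A \<le> B"
  shows "dsym \<kappa> e L (\<lambda>z. B * bracket \<kappa> z powr m) a"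
proof -
  interpret scaled_direction \<kappa> e by (rule norm_Basis_scaled_direction[OF assms(1,2)])
  show ?thesis by (rule csym_mono[OF assms(3)]) (use assms(4) in \<open>auto intro: mult_right_mono\<close>)
qed

text \<open>There are finitely many directions, so the sum of their constants serves them
  all.\<close>

lemma dsym_split_symbol:
  fixes \<sigma> :: "'n::finite symbol"
  assumes k: "0 \<le> \<kappa>" "\<kappa> * \<kappa> = \<kappa>" and sm: "smooth_on U \<sigma>" and U: "{(x, \<xi>, \<eta>). (\<xi>, \<eta>) \<noteq> (0, 0)} \<subseteq> U"
    and bd: "\<And>\<beta> \<gamma>. \<exists>C. \<forall>x \<xi> \<eta>. (\<xi>, \<eta>) \<noteq> (0, 0) \<longrightarrow>
       norm (symbol_deriv (\<lambda>_. 0) \<beta> \<gamma> \<sigma> (x, \<xi>, \<eta>)) \<le> C * (\<kappa> + norm \<xi> + norm \<eta>) powr (m - (real (mi_order \<beta>) + real (mi_order \<gamma>)))"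
    and P: "real L < real P - r / 2"
  shows "\<exists>C\<ge>0. \<forall>e\<in>Basis. \<forall>x.
     dsym \<kappa> e L (\<lambda>z. C * bracket \<kappa> z powr (m - r)) (\<lambda>z. \<sigma> (x, z) * of_real (splitting \<kappa> P r (fst z) (fst z) (snd z))) \<and>
     dsym \<kappa> e L (\<lambda>z. C * bracket \<kappa> z powr (m - r)) (\<lambda>z. \<sigma> (x, z) * of_real (splitting \<kappa> P r (snd z) (fst z) (snd z)))"
proof -
  define Q where "Q e C \<longleftrightarrow> C \<ge> 0 \<and> (\<forall>x.
     dsym \<kappa> e L (\<lambda>z. C * bracket \<kappa> z powr (m - r)) (\<lambda>z. \<sigma> (x, z) * of_real (splitting \<kappa> P r (fst z) (fst z) (snd z))) \<and>
     dsym \<kappa> e L (\<lambda>z. C * bracket \<kappa> z powr (m - r)) (\<lambda>z. \<sigma> (x, z) * of_real (splitting \<kappa> P r (snd z) (fst z) (snd z))))" for e C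
  have "\<exists>C. Q e C" if e: "e \<in> Basis" for e
  proof -
    obtain C0 where C0: "C0 \<ge> 0" "\<And>x. dsym \<kappa> e L (\<lambda>z. C0 * bracket \<kappa> z powr m) (\<lambda>z. \<sigma> (x, z))"
      using dsym_symbol_direction[OF k sm U bd e] by blast
    from dsym_splitting_direction[OF k(1) e P C0(1), of m] show ?thesis
      unfolding Q_def using C0(2) by meson
  qed
  then have "\<forall>e\<in>Basis. \<exists>C. Q e C" by blast
  from bchoice[OF this] obtain C where "\<forall>e\<in>Basis. Q e (C e)" by (elim exE)
  then have C: "\<And>e. e \<in> Basis \<Longrightarrow> C e \<ge> 0"
     "\<And>e x. e \<in> Basis \<Longrightarrow> dsym \<kappa> e L (\<lambda>z. C e * bracket \<kappa> z powr (m - r)) (\<lambda>z. \<sigma> (x, z) * of_real (splitting \<kappa> P r (fst z) (fst z) (snd z)))"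
     "\<And>e x. e \<in> Basis \<Longrightarrow> dsym \<kappa> e L (\<lambda>z. C e * bracket \<kappa> z powr (m - r)) (\<lambda>z. \<sigma> (x, z) * of_real (splitting \<kappa> P r (snd z) (fst z) (snd z)))"
    unfolding Q_def by simp_all
  have le: "C e \<le> sum C Basis" if "e \<in> Basis" for e
    using C(1) that by (intro member_le_sum) auto
  show ?thesis
  proof (intro exI[of _ "sum C Basis"] conjI ballI allI)
    show "0 \<le> sum C Basis" using C(1) by (rule sum_nonneg)
  qed (auto intro: dsym_mono_const[OF k(1) _ C(2) le] dsym_mono_const[OF k(1) _ C(3) le])
qed

section \<open>The Leibniz-type estimate\<close>

text \<open>The substitute for Minkowski's inequality when \<open>q < 1\<close>: a sum is at most
  twice its larger term.\<close>

lemma epowr_add_le: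
  assumes "q > 0"
  shows "epowr (x + y) q \<le> ennreal (2 powr q) * (epowr x q + epowr y q)"
proof -
  have "x + y \<le> 2 * max x y" by (simp add: mult_2 add_mono)
  then have "epowr (x + y) q \<le> epowr (2 * max x y) q" using assms by (intro epowr_mono) auto
  also have "\<dots> = ennreal (2 powr q) * epowr (max x y) q"
    using epowr_ennreal[of 2 q] by (simp add: epowr_mult)
  also have "\<dots> \<le> ennreal (2 powr q) * (epowr x q + epowr y q)"
    by (intro mult_left_mono) (auto simp: max_def add_increasing add_increasing2)
  finally show ?thesis .
qed

lemma epowr_epowr_inverse: "q > 0 \<Longrightarrow> epowr (epowr x q) (1 / q) = x"
  by (cases x) (auto simp: powr_powr)

lemma Lnorm_eq_epowr: "Lnorm p h = epowr (\<integral>\<^sup>+x. ennreal (norm (h x) powr p) \<partial>lborel) (1 / p)"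
  by (simp add: Lnorm_def epowr_def Let_def)

lemma pnorm_norm: "pnorm p (\<lambda>x. norm (h x)) = Lnorm p h"
  by (simp add: Lnorm_eq_epowr pnorm_def)

lemma measurable_fractional_form [measurable]:
  assumes [measurable]: "f \<in> borel_measurable borel" "g \<in> borel_measurable borel"
  shows "fractional_form s f g \<in> borel_measurable borel"
  unfolding fractional_form_def[abs_def] by measurable

lemma measurable_wt [measurable]: "wt \<kappa> \<in> borel_measurable borel"
  unfolding wt_def[abs_def] by measurable

text \<open>The quasi-triangle inequality costs the factor \<open>2 powr q\<close>; the final power
  \<open>1 / q\<close> undoes \<open>epowr\<close>, so that the result is linear in
  \<open>X1 + X2\<close>.\<close>

lemma Lnorm_le_of_pointwise_bound:
  fixes T :: "'a::euclidean_space \<Rightarrow> complex"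
  assumes q: "q > 0" and D: "D \<ge> 0" "C \<ge> 0"
    and J [measurable]: "J1 \<in> borel_measurable borel" "J2 \<in> borel_measurable borel"
    and point: "\<And>x. ennreal (norm (T x)) \<le> ennreal D * (J1 x + J2 x)"
    and J1: "(\<integral>\<^sup>+x. epowr (J1 x) q \<partial>lborel) \<le> ennreal C * epowr X1 q"
    and J2: "(\<integral>\<^sup>+x. epowr (J2 x) q \<partial>lborel) \<le> ennreal C * epowr X2 q"
  shows "Lnorm q T \<le> ennreal ((D powr q * 2 powr q * C * 2) powr (1 / q)) * (X1 + X2)"
proof -
  let ?A = "ennreal (D powr q * 2 powr q)"
  have "(\<integral>\<^sup>+x. ennreal (norm (T x) powr q) \<partial>lborel) \<le> (\<integral>\<^sup>+x. ?A * (epowr (J1 x) q + epowr (J2 x) q) \<partial>lborel)"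
  proof (rule nn_integral_mono)
    fix x
    have "ennreal (norm (T x) powr q) = epowr (ennreal (norm (T x))) q" by simp
    also have "\<dots> \<le> epowr (ennreal D * (J1 x + J2 x)) q" using q by (intro epowr_mono point) auto
    also have "\<dots> = ennreal (D powr q) * epowr (J1 x + J2 x) q" using D by (simp add: epowr_mult)
    also have "\<dots> \<le> ennreal (D powr q) * (ennreal (2 powr q) * (epowr (J1 x) q + epowr (J2 x) q))"
      by (intro mult_left_mono epowr_add_le q) auto
    finally show "ennreal (norm (T x) powr q) \<le> ?A * (epowr (J1 x) q + epowr (J2 x) q)"
      by (simp add: ennreal_mult mult.assoc)
  qed
  also have "\<dots> = ?A * ((\<integral>\<^sup>+x. epowr (J1 x) q \<partial>lborel) + (\<integral>\<^sup>+x. epowr (J2 x) q \<partial>lborel))"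
    by (subst nn_integral_cmult, measurable, subst nn_integral_add) auto
  also have "\<dots> \<le> ?A * (ennreal C * epowr X1 q + ennreal C * epowr X2 q)"
    by (intro mult_left_mono add_mono J1 J2) auto
  also have "\<dots> \<le> ?A * (ennreal C * epowr (X1 + X2) q + ennreal C * epowr (X1 + X2) q)"
    using q by (intro mult_left_mono add_mono epowr_mono) (auto simp: add_increasing add_increasing2)
  also have "\<dots> = ennreal (D powr q * 2 powr q * C * 2) * epowr (X1 + X2) q"
  proof -
    have "ennreal (D powr q * 2 powr q * C * 2) = ?A * ennreal C * 2"
      using D by (simp add: ennreal_mult)
    then show ?thesis by (simp add: mult_2[symmetric] mult_ac)
  qed
  also have "\<dots> = epowr (ennreal ((D powr q * 2 powr q * C * 2) powr (1 / q)) * (X1 + X2)) q"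
    using q D by (simp add: epowr_mult powr_powr)
  finally have "Lnorm q T \<le> epowr (epowr (ennreal ((D powr q * 2 powr q * C * 2) powr (1 / q)) * (X1 + X2)) q) (1 / q)"
    unfolding Lnorm_eq_epowr using q by (intro epowr_mono) auto
  then show ?thesis by (simp only: epowr_epowr_inverse[OF q])
qed

text \<open>Both symbol classes are covered at once: \<open>\<kappa> = 1\<close> goes with
  \<open>U = UNIV\<close>, and \<open>\<kappa> = 0\<close> with \<open>U\<close> the region off the
  zero frequency.\<close>

theorem bilinear_op_bound:
  fixes \<sigma> :: "'n::finite symbol" and p1 p2 q s :: real
  assumes p: "1 < p1" "1 < p2" "0 < q" "0 < s" and s: "s < 2 * real CARD('n)"
    and rel: "1 / q = 1 / p1 + 1 / p2 - s / real CARD('n)" and ms: "- s \<le> m"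
    and k: "0 \<le> \<kappa>" "\<kappa> * \<kappa> = \<kappa>" and sm: "smooth_on U \<sigma>" and U: "{(x, \<xi>, \<eta>). (\<xi>, \<eta>) \<noteq> (0, 0)} \<subseteq> U"
    and bd: "\<And>\<beta> \<gamma>. \<exists>C. \<forall>x \<xi> \<eta>. (\<xi>, \<eta>) \<noteq> (0, 0) \<longrightarrow>
       norm (symbol_deriv (\<lambda>_. 0) \<beta> \<gamma> \<sigma> (x, \<xi>, \<eta>)) \<le> C * (\<kappa> + norm \<xi> + norm \<eta>) powr (m - (real (mi_order \<beta>) + real (mi_order \<gamma>)))"
  shows "\<exists>C::real. \<forall>f g. schwartz f \<and> schwartz g \<longrightarrow>
    Lnorm q (bilinear_op \<sigma> f g) \<le> ennreal C *
      (Lnorm p1 (fourier_multiplier (\<lambda>\<xi>. wt \<kappa> \<xi> powr ((m + s) / 2)) f) * Lnorm p2 g +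
       Lnorm p1 f * Lnorm p2 (fourier_multiplier (\<lambda>\<xi>. wt \<kappa> \<xi> powr ((m + s) / 2)) g))"
proof -
  let ?n = "CARD('n)"
  define r where "r = m + s"
  have r: "r \<ge> 0" using ms by (simp add: r_def)
  have k1: "\<kappa> \<le> 1" using k by (metis mult_cancel_right1 order_refl zero_le_one)
  \<comment> \<open>Room for \<open>2 * ?n + 2\<close> derivatives of the weights raised to
    \<open>P - r / 2\<close>, as many as the kernel estimate takes in the frequency space of
    dimension \<open>2 * ?n\<close>.\<close>
  obtain P :: nat where P: "real (2 * ?n + 2) + r / 2 < real P" using reals_Archimedean2 by blast
  have P0: "P > 0" using P r by (cases P) auto
  have Pr: "real (2 * ?n + 2) < real P - r / 2" using P by linarith
  have mr: "m - r = - s" by (simp add: r_def)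
  obtain C0 where C0: "C0 \<ge> 0"
    "\<And>e x. e \<in> Basis \<Longrightarrow> dsym \<kappa> e (2 * ?n + 2) (\<lambda>z. C0 * bracket \<kappa> z powr (- s)) (\<lambda>z. \<sigma> (x, z) * of_real (splitting \<kappa> P r (fst z) (fst z) (snd z)))"
    "\<And>e x. e \<in> Basis \<Longrightarrow> dsym \<kappa> e (2 * ?n + 2) (\<lambda>z. C0 * bracket \<kappa> z powr (- s)) (\<lambda>z. \<sigma> (x, z) * of_real (splitting \<kappa> P r (snd z) (fst z) (snd z)))"
    using dsym_split_symbol[OF k sm U bd Pr] unfolding mr by blast
  have sn: "s \<le> 2 * real DIM(real ^ 'n)" using s by simp
  have "\<exists>D>0. \<forall>a :: (real ^ 'n) \<times> (real ^ 'n) \<Rightarrow> complex. (\<forall>e\<in>Basis. dsym \<kappa> e (2 * ?n + 2) (\<lambda>z. C0 * bracket \<kappa> z powr (- s)) a) \<longrightarrow>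
    (\<forall>\<phi> \<gamma> x. integrable lborel \<phi> \<longrightarrow> integrable lborel \<gamma> \<longrightarrow> integrable lborel (\<lambda>z. a z * (\<phi> (fst z) * \<gamma> (snd z))) \<longrightarrow>
      ennreal (norm (\<integral>z. cis ((x, x) \<bullet> z) * (a z * (\<phi> (fst z) * \<gamma> (snd z))) \<partial>lborel)) \<le>
      ennreal D * fractional_form s (\<lambda>y. norm (osc \<phi> y)) (\<lambda>y. norm (osc \<gamma> y)) x)"
    using bilinear_multiplier_bound[OF k(1) less_imp_le[OF p(4)] sn C0(1)] by simp
  then obtain D where D: "D > 0" and D': "\<forall>a :: (real ^ 'n) \<times> (real ^ 'n) \<Rightarrow> complex. (\<forall>e\<in>Basis. dsym \<kappa> e (2 * ?n + 2) (\<lambda>z. C0 * bracket \<kappa> z powr (- s)) a) \<longrightarrow>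
    (\<forall>\<phi> \<gamma> x. integrable lborel \<phi> \<longrightarrow> integrable lborel \<gamma> \<longrightarrow> integrable lborel (\<lambda>z. a z * (\<phi> (fst z) * \<gamma> (snd z))) \<longrightarrow>
      ennreal (norm (\<integral>z. cis ((x, x) \<bullet> z) * (a z * (\<phi> (fst z) * \<gamma> (snd z))) \<partial>lborel)) \<le>
      ennreal D * fractional_form s (\<lambda>y. norm (osc \<phi> y)) (\<lambda>y. norm (osc \<gamma> y)) x)"
    by (elim exE conjE)
  have reln: "1 / q = 1 / p1 + 1 / p2 - s / real DIM(real ^ 'n)" using rel by simp
  obtain CF where CF: "CF > 0"
    "\<And>f g :: real ^ 'n \<Rightarrow> real. f \<in> borel_measurable borel \<Longrightarrow> g \<in> borel_measurable borel \<Longrightarrow> (\<And>x. 0 \<le> f x) \<Longrightarrow> (\<And>x. 0 \<le> g x) \<Longrightarrow>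
       (\<integral>\<^sup>+x. epowr (fractional_form s f g x) q \<partial>lborel) \<le> ennreal CF * epowr (pnorm p1 f * pnorm p2 g) q"
    using fractional_form_bound[OF p reln] by blast
  show ?thesis
  proof (intro exI allI impI)
    fix f g :: "real ^ 'n \<Rightarrow> complex" assume "schwartz f \<and> schwartz g"
    then have f: "schwartz f" and g: "schwartz g" by auto
    define \<mu> where "\<mu> \<xi> = wt \<kappa> \<xi> powr (r / 2)" for \<xi> :: "real ^ 'n"
    define \<phi> where "\<phi> \<xi> = complex_of_real (\<mu> \<xi>) * fourier f \<xi>" for \<xi>
    define \<gamma> where "\<gamma> \<xi> = complex_of_real (\<mu> \<xi>) * fourier g \<xi>" for \<xi>
    have [measurable]: "f \<in> borel_measurable borel" "g \<in> borel_measurable borel"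
      using integrable_schwartz[OF f] integrable_schwartz[OF g] by auto
    have [measurable]: "\<mu> \<in> borel_measurable borel" unfolding \<mu>_def[abs_def] by measurable
    have [measurable]: "\<phi> \<in> borel_measurable borel" "\<gamma> \<in> borel_measurable borel"
      unfolding \<phi>_def[abs_def] \<gamma>_def[abs_def] by measurable
    have i\<phi>: "integrable lborel \<phi>" and i\<gamma>: "integrable lborel \<gamma>"
      using integrable_multiplier_fourier[OF f k(1) k1 r] integrable_multiplier_fourier[OF g k(1) k1 r]
      unfolding \<phi>_def[abs_def] \<gamma>_def[abs_def] \<mu>_def wt_def by auto
    note i_f = integrable_fourier[OF f] and ig = integrable_fourier[OF g]
    define J1 where "J1 = fractional_form s (\<lambda>y. norm (osc \<phi> y)) (\<lambda>y. norm (osc (fourier g) y))"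
    define J2 where "J2 = fractional_form s (\<lambda>y. norm (osc (fourier f) y)) (\<lambda>y. norm (osc \<gamma> y))"
    have point: "ennreal (norm (bilinear_op \<sigma> f g x)) \<le> ennreal D * (J1 x + J2 x)" for x
    proof -
      define a1 where "a1 z = \<sigma> (x, z) * of_real (splitting \<kappa> P r (fst z) (fst z) (snd z))" for z
      define a2 where "a2 z = \<sigma> (x, z) * of_real (splitting \<kappa> P r (snd z) (fst z) (snd z))" for z
      define W where "W z = cis ((x, x) \<bullet> z) * (\<sigma> (x, z) * (fourier f (fst z) * fourier g (snd z)))" for z
      define Q1 where "Q1 z = a1 z * (\<phi> (fst z) * fourier g (snd z))" for z
      define Q2 where "Q2 z = a2 z * (fourier f (fst z) * \<gamma> (snd z))" for z
      have op: "bilinear_op \<sigma> f g x = (\<integral>z. W z \<partial>lborel)"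
        unfolding bilinear_op_def
      proof (rule Bochner_Integration.integral_cong[OF refl])
        fix z :: "(real ^ 'n) \<times> (real ^ 'n)"
        show "(case z of (\<xi>, \<eta>) \<Rightarrow> cis (x \<bullet> (\<xi> + \<eta>)) * \<sigma> (x, \<xi>, \<eta>) * fourier f \<xi> * fourier g \<eta>) = W z"
          by (cases z) (simp add: W_def inner_add_right mult.assoc)
      qed
      show ?thesis
      proof (cases "integrable lborel W")
        \<comment> \<open>a non-integrable integrand gives the junk value \<open>bilinear_op \<sigma> f g x = 0\<close>\<close>
        case False
        then show ?thesis unfolding op by (simp add: not_integrable_integral_eq)
      next
        case W: True
        obtain e0 :: "(real ^ 'n) \<times> (real ^ 'n)" where e0: "e0 \<in> Basis" using nonempty_Basis by blast
        interpret scaled_direction \<kappa> e0 by (rule norm_Basis_scaled_direction[OF k(1) e0])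
        have [measurable]: "a1 \<in> borel_measurable borel" "a2 \<in> borel_measurable borel"
          unfolding a1_def[abs_def] a2_def[abs_def]
          by (rule measurable_continuous_off_0[OF csymD(1)[OF C0(2)[OF e0]]] measurable_continuous_off_0[OF csymD(1)[OF C0(3)[OF e0]]])+
        have [measurable]: "Q1 \<in> borel_measurable borel" "Q2 \<in> borel_measurable borel"
        proof -
          have pr: "fst \<in> (borel :: ((real ^ 'n) \<times> (real ^ 'n)) measure) \<rightarrow>\<^sub>M borel" "snd \<in> (borel :: ((real ^ 'n) \<times> (real ^ 'n)) measure) \<rightarrow>\<^sub>M borel"
            by (intro borel_measurable_continuous_onI continuous_intros)+
          have cf: "(\<lambda>z. h (fst z)) \<in> borel_measurable (borel :: ((real ^ 'n) \<times> (real ^ 'n)) measure)"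
            if "h \<in> borel_measurable borel" for h :: "real ^ 'n \<Rightarrow> complex"
            using measurable_compose[OF pr(1) that] .
          have cs: "(\<lambda>z. h (snd z)) \<in> borel_measurable (borel :: ((real ^ 'n) \<times> (real ^ 'n)) measure)"
            if "h \<in> borel_measurable borel" for h :: "real ^ 'n \<Rightarrow> complex"
            using measurable_compose[OF pr(2) that] .
          show "Q1 \<in> borel_measurable borel" "Q2 \<in> borel_measurable borel"
            unfolding Q1_def[abs_def] Q2_def[abs_def]
            by (intro borel_measurable_times cf cs; measurable)+
        qed
        \<comment> \<open>Apart from the phase, the parts are the integrand multiplied by numbers
          \<open>t1\<close> and \<open>t2\<close> in the unit interval with sum 1, so integrability
          of the whole passes to each part.\<close>
        have split: "norm (Q1 z) \<le> norm (W z) \<and> norm (Q2 z) \<le> norm (W z) \<and> W z = cis ((x, x) \<bullet> z) * Q1 z + cis ((x, x) \<bullet> z) * Q2 z"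
          if z: "z \<noteq> 0" for z
        proof -
          define t1 where "t1 = splitting \<kappa> P r (fst z) (fst z) (snd z) * \<mu> (fst z)"
          define t2 where "t2 = splitting \<kappa> P r (snd z) (fst z) (snd z) * \<mu> (snd z)"
          have nz: "(fst z, snd z) \<noteq> (0, 0)" using z by (simp add: zero_prod_def)
          have t: "t1 + t2 = 1" "t1 \<ge> 0" "t2 \<ge> 0"
            unfolding t1_def t2_def \<mu>_def using splitting_identity[OF k(1) nz P0] by auto
          define S where "S = \<sigma> (x, z) * (fourier f (fst z) * fourier g (snd z))"
          have Q1: "Q1 z = of_real t1 * S" and Q2: "Q2 z = of_real t2 * S"
            by (simp_all add: Q1_def Q2_def a1_def a2_def \<phi>_def \<gamma>_def S_def t1_def t2_def mult_ac)
          have W: "W z = cis ((x, x) \<bullet> z) * S" by (simp add: W_def S_def)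
          have "cis ((x, x) \<bullet> z) * Q1 z + cis ((x, x) \<bullet> z) * Q2 z = cis ((x, x) \<bullet> z) * (of_real (t1 + t2) * S)"
            unfolding Q1 Q2 by (simp add: algebra_simps)
          then have 1: "W z = cis ((x, x) \<bullet> z) * Q1 z + cis ((x, x) \<bullet> z) * Q2 z" unfolding W t by simp
          have 2: "norm (Q1 z) \<le> norm (W z)" "norm (Q2 z) \<le> norm (W z)"
            unfolding Q1 Q2 W norm_mult using t by (auto intro!: mult_left_le_one_le)
          show ?thesis using 1 2 by blast
        qed
        have iQ1: "integrable lborel Q1"
        proof (rule Bochner_Integration.integrable_bound[OF W])
          show "AE z in lborel. norm (Q1 z) \<le> norm (W z)"
            using AE_lborel_singleton[of 0] by eventually_elim (use split in blast)
        qed measurable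
        have iQ2: "integrable lborel Q2"
        proof (rule Bochner_Integration.integrable_bound[OF W])
          show "AE z in lborel. norm (Q2 z) \<le> norm (W z)"
            using AE_lborel_singleton[of 0] by eventually_elim (use split in blast)
        qed measurable
        have [measurable]: "W \<in> borel_measurable borel" using W by auto
        have "(\<integral>z. W z \<partial>lborel) = (\<integral>z. cis ((x, x) \<bullet> z) * Q1 z + cis ((x, x) \<bullet> z) * Q2 z \<partial>lborel)"
        proof (rule integral_cong_AE)
          show "AE z in lborel. W z = cis ((x, x) \<bullet> z) * Q1 z + cis ((x, x) \<bullet> z) * Q2 z"
            using AE_lborel_singleton[of 0] by eventually_elim (use split in blast)
        qed measurable
        also have "\<dots> = (\<integral>z. cis ((x, x) \<bullet> z) * Q1 z \<partial>lborel) + (\<integral>z. cis ((x, x) \<bullet> z) * Q2 z \<partial>lborel)"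
          by (intro Bochner_Integration.integral_add integrable_cis_mult iQ1 iQ2)
        finally have "norm (bilinear_op \<sigma> f g x) \<le> norm (\<integral>z. cis ((x, x) \<bullet> z) * Q1 z \<partial>lborel) + norm (\<integral>z. cis ((x, x) \<bullet> z) * Q2 z \<partial>lborel)"
          unfolding op by (simp add: norm_triangle_ineq)
        then have "ennreal (norm (bilinear_op \<sigma> f g x)) \<le> ennreal (norm (\<integral>z. cis ((x, x) \<bullet> z) * Q1 z \<partial>lborel)) + ennreal (norm (\<integral>z. cis ((x, x) \<bullet> z) * Q2 z \<partial>lborel))"
          by (simp add: ennreal_leI flip: ennreal_plus)
        also have "\<dots> \<le> ennreal D * J1 x + ennreal D * J2 x"
        proof (rule add_mono)
          have d1: "\<forall>e\<in>Basis. dsym \<kappa> e (2 * ?n + 2) (\<lambda>z. C0 * bracket \<kappa> z powr (- s)) a1"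
            unfolding a1_def[abs_def] using C0(2) by blast
          show "ennreal (norm (\<integral>z. cis ((x, x) \<bullet> z) * Q1 z \<partial>lborel)) \<le> ennreal D * J1 x"
            using D'[rule_format, OF d1[rule_format] i\<phi> ig, of x] iQ1 unfolding J1_def Q1_def[abs_def] by blast
          have d2: "\<forall>e\<in>Basis. dsym \<kappa> e (2 * ?n + 2) (\<lambda>z. C0 * bracket \<kappa> z powr (- s)) a2"
            unfolding a2_def[abs_def] using C0(3) by blast
          show "ennreal (norm (\<integral>z. cis ((x, x) \<bullet> z) * Q2 z \<partial>lborel)) \<le> ennreal D * J2 x"
            using D'[rule_format, OF d2[rule_format] i_f i\<gamma>, of x] iQ2 unfolding J2_def Q2_def[abs_def] by blast
        qed
        finally show ?thesis by (simp add: distrib_left)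
      qed
    qed
    have "Lnorm q (bilinear_op \<sigma> f g) \<le> ennreal ((D powr q * 2 powr q * CF * 2) powr (1 / q)) *
       (pnorm p1 (\<lambda>y. norm (osc \<phi> y)) * pnorm p2 (\<lambda>y. norm (osc (fourier g) y)) +
        pnorm p1 (\<lambda>y. norm (osc (fourier f) y)) * pnorm p2 (\<lambda>y. norm (osc \<gamma> y)))"
    proof (rule Lnorm_le_of_pointwise_bound[OF p(3) _ _ _ _ point])
      show "(\<integral>\<^sup>+x. epowr (J1 x) q \<partial>lborel) \<le> ennreal CF * epowr (pnorm p1 (\<lambda>y. norm (osc \<phi> y)) * pnorm p2 (\<lambda>y. norm (osc (fourier g) y))) q"
        unfolding J1_def by (rule CF(2)) auto
      show "(\<integral>\<^sup>+x. epowr (J2 x) q \<partial>lborel) \<le> ennreal CF * epowr (pnorm p1 (\<lambda>y. norm (osc (fourier f) y)) * pnorm p2 (\<lambda>y. norm (osc \<gamma> y))) q"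
        unfolding J2_def by (rule CF(2)) auto
      show "J1 \<in> borel_measurable borel" unfolding J1_def by measurable
      show "J2 \<in> borel_measurable borel" unfolding J2_def by measurable
    qed (use D CF(1) in auto)
    then show "Lnorm q (bilinear_op \<sigma> f g) \<le> ennreal ((D powr q * 2 powr q * CF * 2) powr (1 / q)) *
      (Lnorm p1 (fourier_multiplier (\<lambda>\<xi>. wt \<kappa> \<xi> powr ((m + s) / 2)) f) * Lnorm p2 g +
       Lnorm p1 f * Lnorm p2 (fourier_multiplier (\<lambda>\<xi>. wt \<kappa> \<xi> powr ((m + s) / 2)) g))"
      unfolding pnorm_norm osc_fourier[OF f] osc_fourier[OF g] fourier_multiplier_eq_osc \<phi>_def[abs_def] \<gamma>_def[abs_def] \<mu>_def r_def .
  qed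
qed

section \<open>Bessel and Riesz multipliers and the conclusion\<close>

lemma bessel_J_eq: "bessel_J r = fourier_multiplier (\<lambda>\<xi>. wt 1 \<xi> powr (r / 2))"
  by (simp add: bessel_J_def wt_def)

text \<open>At the origin both multipliers are 0, as \<open>0 powr x\<close> is 0 for every
  \<open>x\<close>, so the identity holds at every point.\<close>

lemma riesz_D_eq: "riesz_D r = fourier_multiplier (\<lambda>\<xi>. wt 0 \<xi> powr (r / 2))"
proof -
  have "norm \<xi> powr r = wt 0 \<xi> powr (r / 2)" for \<xi> :: "real ^ 'a"
  proof (cases "\<xi> = 0")
    case False
    then have "(norm \<xi>)\<^sup>2 = norm \<xi> powr 2" by simp
    then show ?thesis unfolding wt_def by (simp only: add_0_left powr_powr) simp
  qed (simp add: wt_def)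
  then show ?thesis by (simp add: riesz_D_def)
qed

theorem corollary13:
  fixes p1 p2 q s :: real
  assumes "1 < p1" and "1 < p2" and "0 < q" and "0 < s"
    and "1 / q = 1 / p1 + 1 / p2 - s / real CARD('n::finite)"
  shows
    "(\<forall>m \<delta>. \<forall>\<sigma> :: 'n symbol.
        s \<in> {0<..<2 * real CARD('n)} \<and> 0 \<le> \<delta> \<and> \<delta> < 1 \<and> - s \<le> m \<and> \<sigma> \<in> BS m \<delta> \<longrightarrow>
        (\<exists>C::real. \<forall>f g. schwartz f \<and> schwartz g \<longrightarrow>
           Lnorm q (bilinear_op \<sigma> f g)
             \<le> ennreal C * (sobolev_norm (m + s) p1 f * Lnorm p2 g
                             + Lnorm p1 f * sobolev_norm (m + s) p2 g))) \<and>
     (\<forall>m \<delta>. \<forall>\<sigma> :: 'n symbol.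
        s \<in> {0<..<2 * real CARD('n)} \<and> 0 \<le> \<delta> \<and> \<delta> < 1 \<and> - s \<le> m \<and> \<sigma> \<in> hom_BS m \<delta> \<longrightarrow>
        (\<exists>C::real. \<forall>f g. schwartz f \<and> schwartz g \<longrightarrow>
           Lnorm q (bilinear_op \<sigma> f g)
             \<le> ennreal C * (hom_sobolev_norm (m + s) p1 f * Lnorm p2 g
                             + Lnorm p1 f * hom_sobolev_norm (m + s) p2 g)))"
proof (intro conjI allI impI)
  fix m \<delta> and \<sigma> :: "'n symbol"
  assume *: "s \<in> {0<..<2 * real CARD('n)} \<and> 0 \<le> \<delta> \<and> \<delta> < 1 \<and> - s \<le> m \<and> \<sigma> \<in> BS m \<delta>"
  then have sm: "smooth_on UNIV \<sigma>"
    and bd: "\<And>\<alpha> \<beta> \<gamma>. \<exists>C. \<forall>x \<xi> \<eta>. norm (symbol_deriv \<alpha> \<beta> \<gamma> \<sigma> (x, \<xi>, \<eta>))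
      \<le> C * (1 + norm \<xi> + norm \<eta>) powr (m - (real (mi_order \<beta>) + real (mi_order \<gamma>)) + \<delta> * real (mi_order \<alpha>))"
    unfolding BS_def by blast+
  show "\<exists>C::real. \<forall>f g. schwartz f \<and> schwartz g \<longrightarrow>
           Lnorm q (bilinear_op \<sigma> f g)
             \<le> ennreal C * (sobolev_norm (m + s) p1 f * Lnorm p2 g
                             + Lnorm p1 f * sobolev_norm (m + s) p2 g)"
    unfolding sobolev_norm_def bessel_J_eq
  proof (rule bilinear_op_bound[OF assms(1-4) _ assms(5) _ _ _ sm])
    show "\<exists>C. \<forall>x \<xi> \<eta>. (\<xi>, \<eta>) \<noteq> (0, 0) \<longrightarrow> norm (symbol_deriv (\<lambda>_. 0) \<beta> \<gamma> \<sigma> (x, \<xi>, \<eta>))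
       \<le> C * (1 + norm \<xi> + norm \<eta>) powr (m - (real (mi_order \<beta>) + real (mi_order \<gamma>)))" for \<beta> \<gamma>
      using bd[of "\<lambda>_. 0" \<beta> \<gamma>] by (auto simp: mi_order_0)
  qed (use * in auto)
next
  fix m \<delta> and \<sigma> :: "'n symbol"
  assume *: "s \<in> {0<..<2 * real CARD('n)} \<and> 0 \<le> \<delta> \<and> \<delta> < 1 \<and> - s \<le> m \<and> \<sigma> \<in> hom_BS m \<delta>"
  then have sm: "smooth_on {(x, \<xi>, \<eta>). (\<xi>, \<eta>) \<noteq> (0, 0)} \<sigma>"
    and bd: "\<And>\<alpha> \<beta> \<gamma>. \<exists>C. \<forall>x \<xi> \<eta>. (\<xi>, \<eta>) \<noteq> (0, 0) \<longrightarrow> norm (symbol_deriv \<alpha> \<beta> \<gamma> \<sigma> (x, \<xi>, \<eta>))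
      \<le> C * (norm \<xi> + norm \<eta>) powr (m - (real (mi_order \<beta>) + real (mi_order \<gamma>)) + \<delta> * real (mi_order \<alpha>))"
    unfolding hom_BS_def by blast+
  show "\<exists>C::real. \<forall>f g. schwartz f \<and> schwartz g \<longrightarrow>
           Lnorm q (bilinear_op \<sigma> f g)
             \<le> ennreal C * (hom_sobolev_norm (m + s) p1 f * Lnorm p2 g
                             + Lnorm p1 f * hom_sobolev_norm (m + s) p2 g)"
    unfolding hom_sobolev_norm_def riesz_D_eq
  \<comment> \<open>Here \<open>\<kappa> = 0\<close>, and \<open>U\<close> is exactly the domain on
    which a homogeneous symbol is smooth.\<close>
  proof (rule bilinear_op_bound[OF assms(1-4) _ assms(5) _ _ _ sm])
    show "\<exists>C. \<forall>x \<xi> \<eta>. (\<xi>, \<eta>) \<noteq> (0, 0) \<longrightarrow> norm (symbol_deriv (\<lambda>_. 0) \<beta> \<gamma> \<sigma> (x, \<xi>, \<eta>))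
       \<le> C * (0 + norm \<xi> + norm \<eta>) powr (m - (real (mi_order \<beta>) + real (mi_order \<gamma>)))" for \<beta> \<gamma>
      using bd[of "\<lambda>_. 0" \<beta> \<gamma>] by (simp add: mi_order_0)
  qed (use * in auto)
qed

end
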